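(* Let $\Lambda$ be a principal ideal domain, $p\in\Lambda$ a prime element, $B$ a finitely generated $\Lambda$-module and $A$ a submodule of $B$ which is $p^2$-bounded. Then the pair $(B;A)$ has a direct sum decomposition, unique up to isomorphism and reordering, into finitely many indecomposable pairs, each of which is (a) of type $(\Lambda/(q);0)$ where $q$ is a prime power relatively prime to $p$, or (b) of type $P^\ell_m$ or $Q_s^t$ in $\mathcal S_2(\Lambda/(p^n))$ for some $n\in\mathbb N$, or (c) the indecomposable projective pair $(\Lambda;0)$.
   Context: A pair $(B;A)$ consists of a finitely generated $\Lambda$-module $B$ and a submodule $A\subseteq B$. A morphism $(B;A)\to(D;C)$ is a $\Lambda$-linear map $f:B\to D$ with $f(A)\subseteq C$. Direct sums are $(B;A)\oplus(B';A')=(B\oplus B';A\oplus A')$. The submodule $A$ is $p^2$-bounded if $p^2A=0$. For a commutative local uniserial ring $R$ of length $n$ with maximal ideal generated by $p$ (such as $R=\Lambda/(p^n)$), $\mathcal S_2(R)$ is the category of pairs $(B;A)$ with $B$ a finitely generated $R$-module and $A\subseteq B$ a submodule with $p^2A=0$. The following are the pairs of types $P_m^\ell$ and $Q_s^t$ in $\mathcal S_2(R)$. - The picket $P^\ell_m$ (for $m\in\{0,1,2\}$, $1\le\ell\le n$, $m\le\ell$) is $P^\ell_m=(R/(p^\ell);\,(p^{\ell-m})/(p^\ell))$, that is, the pair $(B;A)$ with $B$ cyclic of length $\ell$ and $A$ its unique submodule of length $m$. - For $1\le s<t-1$ and $t\le n$, $Q^t_s=(B;A)$ where $B=R/(p^t)\oplus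 R/(p^s)$ and $A$ is the cyclic submodule generated by $(p^{t-2},p^{s-1})$. Pairs over $\Lambda/(p^n)$ are regarded as pairs over $\Lambda$. *)

theory Defs
  imports "HOL-Algebra.Algebra"
begin

section \<open>Modules\<close>

text \<open>
  The record \<^typ>\<open>('a, 'b) module\<close> extends the ring record. The locale \<^locale>\<open>module\<close> does not
  constrain the fields \<open>mult\<close> and \<open>one\<close>, and no notion below depends on their values in a module.
\<close>

definition mod_hom :: "('a, 'r) ring_scheme \<Rightarrow> ('a, 'b) module \<Rightarrow> ('a, 'c) module \<Rightarrow> ('b \<Rightarrow> 'c) set" where
  "mod_hom R M N =
     {f \<in> hom (add_monoid M) (add_monoid N).
        \<forall>r \<in> carrier R. \<forall>x \<in> carrier M. f (r \<odot>\<^bsub>M\<^esub> x) = r \<odot>\<^bsub>N\<^esub> f x}"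

definition generated_submodule :: "('a, 'r) ring_scheme \<Rightarrow> ('a, 'b) module \<Rightarrow> 'b set \<Rightarrow> 'b set" where
  "generated_submodule R M S = \<Inter>{N. submodule N R M \<and> S \<subseteq> N}"

definition finitely_generated :: "('a, 'r) ring_scheme \<Rightarrow> ('a, 'b) module \<Rightarrow> bool" where
  "finitely_generated R M \<longleftrightarrow>
     (\<exists>S. finite S \<and> S \<subseteq> carrier M \<and> generated_submodule R M S = carrier M)"

definition self_module :: "('a, 'r) ring_scheme \<Rightarrow> ('a, 'a) module" where
  "self_module R =
     \<lparr>carrier = carrier R, monoid.mult = monoid.mult R, one = one R, ring.zero = ring.zero R,
      ring.add = ring.add R, smult = monoid.mult R\<rparr>"

text \<open>A module over the codomain of \<open>\<phi>\<close>, regarded as a module over its domain.\<close>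

definition restrict_scalars :: "('a \<Rightarrow> 's) \<Rightarrow> ('s, 'b) module \<Rightarrow> ('a, 'b) module" where
  "restrict_scalars \<phi> M =
     \<lparr>carrier = carrier M, monoid.mult = monoid.mult M, one = one M, ring.zero = ring.zero M,
      ring.add = ring.add M, smult = (\<lambda>r x. \<phi> r \<odot>\<^bsub>M\<^esub> x)\<rparr>"

text \<open>The cyclic \<open>R\<close>-module \<open>R/I\<close>.\<close>

definition quot_module :: "('a, 'r) ring_scheme \<Rightarrow> 'a set \<Rightarrow> ('a, 'a set) module" where
  "quot_module R I = restrict_scalars (\<lambda>r. I +>\<^bsub>R\<^esub> r) (self_module (R Quot I))"

definition module_sum :: "('a, 'b) module \<Rightarrow> ('a, 'c) module \<Rightarrow> ('a, 'b \<times> 'c) module" where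
  "module_sum M N =
     \<lparr>carrier = carrier M \<times> carrier N,
      monoid.mult = (\<lambda>(x, y) (x', y'). (x \<otimes>\<^bsub>M\<^esub> x', y \<otimes>\<^bsub>N\<^esub> y')),
      one = (\<one>\<^bsub>M\<^esub>, \<one>\<^bsub>N\<^esub>),
      ring.zero = (\<zero>\<^bsub>M\<^esub>, \<zero>\<^bsub>N\<^esub>),
      ring.add = (\<lambda>(x, y) (x', y'). (x \<oplus>\<^bsub>M\<^esub> x', y \<oplus>\<^bsub>N\<^esub> y')),
      smult = (\<lambda>r (x, y). (r \<odot>\<^bsub>M\<^esub> x, r \<odot>\<^bsub>N\<^esub> y))\<rparr>"

definition module_list_sum :: "('a, 'b) module list \<Rightarrow> ('a, nat \<Rightarrow> 'b) module" where
  "module_list_sum Ms =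
     (let I = {..<length Ms} in
     \<lparr>carrier = (\<Pi>\<^sub>E i\<in>I. carrier (Ms ! i)),
      monoid.mult = (\<lambda>x y. \<lambda>i\<in>I. x i \<otimes>\<^bsub>Ms ! i\<^esub> y i),
      one = (\<lambda>i\<in>I. \<one>\<^bsub>Ms ! i\<^esub>),
      ring.zero = (\<lambda>i\<in>I. \<zero>\<^bsub>Ms ! i\<^esub>),
      ring.add = (\<lambda>x y. \<lambda>i\<in>I. x i \<oplus>\<^bsub>Ms ! i\<^esub> y i),
      smult = (\<lambda>r x. \<lambda>i\<in>I. r \<odot>\<^bsub>Ms ! i\<^esub> x i)\<rparr>)"


section \<open>Pairs\<close>

text \<open>\<open>(B, A)\<close> stands for the pair \<open>(B;A)\<close>.\<close>

type_synonym ('a, 'b) mod_pair = "('a, 'b) module \<times> 'b set"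

definition is_pair :: "('a, 'r) ring_scheme \<Rightarrow> ('a, 'b) mod_pair \<Rightarrow> bool" where
  "is_pair R = (\<lambda>(B, A). module R B \<and> finitely_generated R B \<and> submodule A R B)"

definition pair_hom ::
  "('a, 'r) ring_scheme \<Rightarrow> ('a, 'b) mod_pair \<Rightarrow> ('a, 'c) mod_pair \<Rightarrow> ('b \<Rightarrow> 'c) set" where
  "pair_hom R = (\<lambda>(B, A) (D, C). {f \<in> mod_hom R B D. f ` A \<subseteq> C})"

definition pair_iso ::
  "('a, 'r) ring_scheme \<Rightarrow> ('a, 'b) mod_pair \<Rightarrow> ('a, 'c) mod_pair \<Rightarrow> bool" where
  "pair_iso R U V \<longleftrightarrow>
     (\<exists>f \<in> pair_hom R U V. \<exists>g \<in> pair_hom R V U.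
        (\<forall>x \<in> carrier (fst U). g (f x) = x) \<and> (\<forall>y \<in> carrier (fst V). f (g y) = y))"

definition pair_sum :: "('a, 'b) mod_pair \<Rightarrow> ('a, 'c) mod_pair \<Rightarrow> ('a, 'b \<times> 'c) mod_pair" where
  "pair_sum = (\<lambda>(B, A) (B', A'). (module_sum B B', A \<times> A'))"

definition pair_list_sum :: "('a, 'b) mod_pair list \<Rightarrow> ('a, nat \<Rightarrow> 'b) mod_pair" where
  "pair_list_sum Us =
     (module_list_sum (map fst Us), \<Pi>\<^sub>E i\<in>{..<length Us}. snd (Us ! i))"

definition zero_pair :: "('a, 'b) mod_pair \<Rightarrow> bool" where
  "zero_pair U \<longleftrightarrow> carrier (fst U) = {\<zero>\<^bsub>fst U\<^esub>}"

text \<open>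
  It is no restriction that the summands \<open>V\<close> and \<open>W\<close> have the element type of \<open>U\<close>: any summand
  of \<open>U\<close> is isomorphic to a pair whose module is a submodule of that of \<open>U\<close>.
\<close>

definition indecomposable_pair :: "('a, 'r) ring_scheme \<Rightarrow> ('a, 'b) mod_pair \<Rightarrow> bool" where
  "indecomposable_pair R U \<longleftrightarrow>
     is_pair R U \<and> \<not> zero_pair U \<and>
     (\<forall>(V :: ('a, 'b) mod_pair) (W :: ('a, 'b) mod_pair).
        is_pair R V \<and> is_pair R W \<and> pair_iso R U (pair_sum V W) \<longrightarrow> zero_pair V \<or> zero_pair W)"

text \<open>
  The empty list decomposes the zero pair. The element type \<open>'c\<close> of the summands may differ from
  that of \<open>U\<close>.
\<close>

definition indecomposable_decomposition ::
  "('a, 'r) ring_scheme \<Rightarrow> ('a, 'b) mod_pair \<Rightarrow> ('a, 'c) mod_pair list \<Rightarrow> bool" where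
  "indecomposable_decomposition R U Vs \<longleftrightarrow>
     (\<forall>V \<in> set Vs. indecomposable_pair R V) \<and> pair_iso R U (pair_list_sum Vs)"

definition same_up_to_iso_and_order ::
  "('a, 'r) ring_scheme \<Rightarrow> ('a, 'b) mod_pair list \<Rightarrow> ('a, 'c) mod_pair list \<Rightarrow> bool" where
  "same_up_to_iso_and_order R Us Vs \<longleftrightarrow>
     (\<exists>\<sigma>. bij_betw \<sigma> {..<length Us} {..<length Vs} \<and>
          (\<forall>i < length Us. pair_iso R (Us ! i) (Vs ! \<sigma> i)))"

definition p2_bounded :: "('a, 'r) ring_scheme \<Rightarrow> 'a \<Rightarrow> ('a, 'b) mod_pair \<Rightarrow> bool" where
  "p2_bounded R p = (\<lambda>(B, A). \<forall>a \<in> A. (p [^]\<^bsub>R\<^esub> (2::nat)) \<odot>\<^bsub>B\<^esub> a = \<zero>\<^bsub>B\<^esub>)"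

definition restrict_pair :: "('a \<Rightarrow> 's) \<Rightarrow> ('s, 'b) mod_pair \<Rightarrow> ('a, 'b) mod_pair" where
  "restrict_pair \<phi> = (\<lambda>(B, A). (restrict_scalars \<phi> B, A))"


section \<open>The indecomposable pairs\<close>

text \<open>
  Here \<open>R\<close> is meant to be a commutative local uniserial ring of length \<open>n\<close> with maximal ideal
  generated by \<open>p\<close>; the ranges of the parameters are imposed in \<open>type_P\<close> and \<open>type_Q\<close> below.
  \<open>picket R p \<ell> m\<close> is \<open>P\<^sup>\<ell>\<^sub>m\<close>, and \<open>bipicket R p t s\<close> is \<open>Q\<^sup>t\<^sub>s\<close>.
\<close>

definition picket :: "('a, 'r) ring_scheme \<Rightarrow> 'a \<Rightarrow> nat \<Rightarrow> nat \<Rightarrow> ('a, 'a set) mod_pair" where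
  "picket R p l m =
     (let I = PIdl\<^bsub>R\<^esub> (p [^]\<^bsub>R\<^esub> l)
      in (quot_module R I, (\<lambda>x. I +>\<^bsub>R\<^esub> x) ` (PIdl\<^bsub>R\<^esub> (p [^]\<^bsub>R\<^esub> (l - m)))))"

definition bipicket :: "('a, 'r) ring_scheme \<Rightarrow> 'a \<Rightarrow> nat \<Rightarrow> nat \<Rightarrow> ('a, 'a set \<times> 'a set) mod_pair" where
  "bipicket R p t s =
     (let I = PIdl\<^bsub>R\<^esub> (p [^]\<^bsub>R\<^esub> t); J = PIdl\<^bsub>R\<^esub> (p [^]\<^bsub>R\<^esub> s);
          B = module_sum (quot_module R I) (quot_module R J)
      in (B, generated_submodule R B
               {(I +>\<^bsub>R\<^esub> (p [^]\<^bsub>R\<^esub> (t - 2)), J +>\<^bsub>R\<^esub> (p [^]\<^bsub>R\<^esub> (s - 1)))}))"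

text \<open>
  The quotient ring \<open>\<Lambda>/(p\<^sup>n)\<close> with its projection. Pairs over it become pairs over \<open>\<Lambda>\<close> by
  restriction of scalars along the projection; the image of \<open>p\<close> generates its maximal ideal.
\<close>

definition trunc_ring :: "('a, 'r) ring_scheme \<Rightarrow> 'a \<Rightarrow> nat \<Rightarrow> 'a set ring" where
  "trunc_ring R p n = R Quot (PIdl\<^bsub>R\<^esub> (p [^]\<^bsub>R\<^esub> n))"

definition trunc_proj :: "('a, 'r) ring_scheme \<Rightarrow> 'a \<Rightarrow> nat \<Rightarrow> 'a \<Rightarrow> 'a set" where
  "trunc_proj R p n r = (PIdl\<^bsub>R\<^esub> (p [^]\<^bsub>R\<^esub> n)) +>\<^bsub>R\<^esub> r"

definition type_P :: "('a, 'r) ring_scheme \<Rightarrow> 'a \<Rightarrow> nat \<Rightarrow> ('a, 'b) mod_pair \<Rightarrow> bool" where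
  "type_P R p n U \<longleftrightarrow>
     (\<exists>l m. m \<in> {0, 1, 2} \<and> 1 \<le> l \<and> l \<le> n \<and> m \<le> l \<and>
        pair_iso R U
          (restrict_pair (trunc_proj R p n) (picket (trunc_ring R p n) (trunc_proj R p n p) l m)))"

definition type_Q :: "('a, 'r) ring_scheme \<Rightarrow> 'a \<Rightarrow> nat \<Rightarrow> ('a, 'b) mod_pair \<Rightarrow> bool" where
  "type_Q R p n U \<longleftrightarrow>
     (\<exists>s t. 1 \<le> s \<and> s < t - 1 \<and> t \<le> n \<and>
        pair_iso R U
          (restrict_pair (trunc_proj R p n) (bipicket (trunc_ring R p n) (trunc_proj R p n p) t s)))"

text \<open>
  The pairs \<open>(\<Lambda>/(q);0)\<close> with \<open>q\<close> a positive power of a prime element, relatively prime to \<open>p\<close>.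
\<close>

definition type_prime_to_p :: "('a, 'r) ring_scheme \<Rightarrow> 'a \<Rightarrow> ('a, 'b) mod_pair \<Rightarrow> bool" where
  "type_prime_to_p R p U \<longleftrightarrow>
     (\<exists>r e q. r \<in> carrier R \<and> ring_prime\<^bsub>R\<^esub> r \<and> 1 \<le> e \<and> q = r [^]\<^bsub>R\<^esub> (e::nat) \<and>
        \<one>\<^bsub>R\<^esub> gcdof\<^bsub>R\<^esub> q p \<and>
        pair_iso R U (quot_module R (PIdl\<^bsub>R\<^esub> q), {\<zero>\<^bsub>quot_module R (PIdl\<^bsub>R\<^esub> q)\<^esub>}))"

definition type_free :: "('a, 'r) ring_scheme \<Rightarrow> ('a, 'b) mod_pair \<Rightarrow> bool" where
  "type_free R U \<longleftrightarrow> pair_iso R U (self_module R, {\<zero>\<^bsub>R\<^esub>})"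

end

theory Submission
  imports Defs
begin

text \<open>
  Existence rests on a single fact: every nonzero pair with \<open>p\<^sup>2\<close>-bounded submodule has a nonzero direct
  summand of one of the listed types (\<open>split_standard_summand\<close>). Finitely generated modules over a
  principal ideal domain are Noetherian, so splitting off such summands comes to an end
  (\<open>standard_decomposition_internal\<close>).

  Summands of a module \<open>D\<close> come from \<open>split_cyclic\<close>: if \<open>x\<close> has order \<open>q\<^sup>e\<^sup>+\<^sup>1\<close> for a prime \<open>q\<close>, and \<open>C0\<close> is a
  submodule that contains \<open>q\<^sup>e\<^sup>+\<^sup>1 D\<close> but not \<open>q\<^sup>e x\<close>, then the cyclic module of \<open>x\<close> has a complement
  containing \<open>C0\<close>. If \<open>D\<close> is not torsion, then a free module splits off, and its complement contains the
  torsion submodule \<open>A\<close>. If \<open>D\<close> is torsion and \<open>A = 0\<close>, then an element of maximal order splits off. In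
  the remaining cases \<open>A\<close> is viewed as a module with a height function, the height of \<open>a\<close> being the largest
  \<open>k\<close> with \<open>a \<in> p\<^sup>k D\<close>. A suitable \<open>a \<in> A\<close> has a complement \<open>A'\<close> in \<open>A\<close> such
  that adding elements of \<open>A'\<close> to a multiple of \<open>a\<close> never increases its height, and then \<open>split_cyclic\<close>, with \<open>A'\<close> part of \<open>C0\<close>, splits off a
  summand of \<open>D\<close> around \<open>a\<close>. If \<open>p a = 0\<close>, or if the height of \<open>p a\<close> exceeds that of \<open>a\<close> by one, then this
  summand is cyclic and gives a picket. If there is a gap between the two heights, it has two
  generators and gives a bipicket (\<open>split_bounded_square\<close>).

  Uniqueness is the theorem of Krull and Schmidt. Every endomorphism of a torsion pair from the list is
  the sum of a scalar and a nilpotent map, so the endomorphism ring is local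
  (\<open>presented_cyclic_local\<close>, \<open>presented_bipicket_local\<close>), and such a pair can be cancelled from direct sums
  (\<open>local_cancel\<close>). Once the torsion pairs are cancelled, only copies of the free pair remain,
  and these are counted by their rank (\<open>free_rank_mono\<close>). Together this is \<open>krull_schmidt_unique\<close>.

  Uniqueness of decompositions into listed pairs also yields that the listed pairs are
  indecomposable: a splitting of one of them would refine to a decomposition with more members.
  Conversely an indecomposable pair is listed, because a listed summand splits off from it. Hence
  uniqueness extends to all decompositions into indecomposable pairs.
\<close>

section \<open>Homomorphisms of pairs\<close>

lemma mod_homD:
  assumes "f \<in> mod_hom R M N"
  shows "\<And>x. x \<in> carrier M \<Longrightarrow> f x \<in> carrier N"
    and "\<And>x y. \<lbrakk>x \<in> carrier M; y \<in> carrier M\<rbrakk> \<Longrightarrow> f (x \<oplus>\<^bsub>M\<^esub> y) = f x \<oplus>\<^bsub>N\<^esub> f y"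
    and "\<And>r x. \<lbrakk>r \<in> carrier R; x \<in> carrier M\<rbrakk> \<Longrightarrow> f (r \<odot>\<^bsub>M\<^esub> x) = r \<odot>\<^bsub>N\<^esub> f x"
  using assms by (auto simp: mod_hom_def hom_def)

lemma pair_homI:
  assumes "\<And>x. x \<in> carrier (fst U) \<Longrightarrow> f x \<in> carrier (fst V)"
    and "\<And>x y. \<lbrakk>x \<in> carrier (fst U); y \<in> carrier (fst U)\<rbrakk> \<Longrightarrow> f (x \<oplus>\<^bsub>fst U\<^esub> y) = f x \<oplus>\<^bsub>fst V\<^esub> f y"
    and "\<And>r x. \<lbrakk>r \<in> carrier R; x \<in> carrier (fst U)\<rbrakk> \<Longrightarrow> f (r \<odot>\<^bsub>fst U\<^esub> x) = r \<odot>\<^bsub>fst V\<^esub> f x"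
    and "\<And>x. x \<in> snd U \<Longrightarrow> f x \<in> snd V"
  shows "f \<in> pair_hom R U V"
  using assms by (cases U; cases V) (auto simp: pair_hom_def mod_hom_def hom_def)

lemma pair_homD:
  assumes "f \<in> pair_hom R U V"
  shows "\<And>x. x \<in> carrier (fst U) \<Longrightarrow> f x \<in> carrier (fst V)"
    and "\<And>x y. \<lbrakk>x \<in> carrier (fst U); y \<in> carrier (fst U)\<rbrakk> \<Longrightarrow> f (x \<oplus>\<^bsub>fst U\<^esub> y) = f x \<oplus>\<^bsub>fst V\<^esub> f y"
    and "\<And>r x. \<lbrakk>r \<in> carrier R; x \<in> carrier (fst U)\<rbrakk> \<Longrightarrow> f (r \<odot>\<^bsub>fst U\<^esub> x) = r \<odot>\<^bsub>fst V\<^esub> f x"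
    and "\<And>x. x \<in> snd U \<Longrightarrow> f x \<in> snd V"
  using assms by (cases U; cases V; auto simp: pair_hom_def mod_hom_def hom_def)+

lemma pair_hom_comp:
  assumes "f \<in> pair_hom R U V" "g \<in> pair_hom R V W"
  shows "(\<lambda>x. g (f x)) \<in> pair_hom R U W"
  by (rule pair_homI) (simp_all add: pair_homD[OF assms(1)] pair_homD[OF assms(2)])

lemma pair_hom_id: "(\<lambda>x. x) \<in> pair_hom R U U"
  by (rule pair_homI) auto

lemma pair_isoI:
  assumes "f \<in> pair_hom R U V" "g \<in> pair_hom R V U"
    and "\<And>x. x \<in> carrier (fst U) \<Longrightarrow> g (f x) = x"
    and "\<And>y. y \<in> carrier (fst V) \<Longrightarrow> f (g y) = y"
  shows "pair_iso R U V"
  unfolding pair_iso_def using assms by blast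

lemma pair_isoE:
  assumes "pair_iso R U V"
  obtains f g where "f \<in> pair_hom R U V" "g \<in> pair_hom R V U"
    and "\<And>x. x \<in> carrier (fst U) \<Longrightarrow> g (f x) = x"
    and "\<And>y. y \<in> carrier (fst V) \<Longrightarrow> f (g y) = y"
  using assms unfolding pair_iso_def by blast

lemma pair_iso_refl: "pair_iso R U U"
  by (rule pair_isoI[OF pair_hom_id pair_hom_id]) auto

lemma pair_iso_sym: "pair_iso R U V \<Longrightarrow> pair_iso R V U"
  unfolding pair_iso_def by blast

lemma pair_iso_trans [trans]:
  assumes "pair_iso R U V" "pair_iso R V W" shows "pair_iso R U W"
proof -
  obtain f g where f: "f \<in> pair_hom R U V" "g \<in> pair_hom R V U"
    "\<And>x. x \<in> carrier (fst U) \<Longrightarrow> g (f x) = x" "\<And>y. y \<in> carrier (fst V) \<Longrightarrow> f (g y) = y"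
    using pair_isoE[OF assms(1)] by blast
  obtain h k where h: "h \<in> pair_hom R V W" "k \<in> pair_hom R W V"
    "\<And>x. x \<in> carrier (fst V) \<Longrightarrow> k (h x) = x" "\<And>y. y \<in> carrier (fst W) \<Longrightarrow> h (k y) = y"
    using pair_isoE[OF assms(2)] by blast
  show ?thesis
    by (rule pair_isoI[OF pair_hom_comp[OF f(1) h(1)] pair_hom_comp[OF h(2) f(2)]])
      (simp_all add: f(3,4) h(3,4) pair_homD(1)[OF f(1)] pair_homD(1)[OF h(2)])
qed

lemma pair_hom_inverse:
  assumes f: "f \<in> pair_hom R U V" and "module R (fst U)" and A: "snd U \<subseteq> carrier (fst U)"
    and bij: "bij_betw f (carrier (fst U)) (carrier (fst V))"
    and onto: "snd V \<subseteq> f ` snd U"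
  shows "\<exists>g \<in> pair_hom R V U. (\<forall>x \<in> carrier (fst U). g (f x) = x) \<and> (\<forall>y \<in> carrier (fst V). f (g y) = y)"
proof -
  interpret U: module R "fst U" by fact
  define g where "g = the_inv_into (carrier (fst U)) f"
  have inj: "inj_on f (carrier (fst U))" and im: "f ` carrier (fst U) = carrier (fst V)"
    using bij by (auto simp: bij_betw_def)
  have gf: "g (f x) = x" if "x \<in> carrier (fst U)" for x
    unfolding g_def by (rule the_inv_into_f_f[OF inj that])
  have ex: "\<exists>x \<in> carrier (fst U). y = f x" if "y \<in> carrier (fst V)" for y
    using that im by blast
  have g: "g \<in> pair_hom R V U"
  proof (rule pair_homI)
    fix y assume "y \<in> carrier (fst V)"
    then show "g y \<in> carrier (fst U)" using ex gf by force
  next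
    fix y z assume "y \<in> carrier (fst V)" "z \<in> carrier (fst V)"
    then obtain a b where ab: "a \<in> carrier (fst U)" "b \<in> carrier (fst U)" "y = f a" "z = f b"
      using ex by meson
    have "y \<oplus>\<^bsub>fst V\<^esub> z = f (a \<oplus>\<^bsub>fst U\<^esub> b)" using ab by (simp add: pair_homD[OF f])
    then show "g (y \<oplus>\<^bsub>fst V\<^esub> z) = g y \<oplus>\<^bsub>fst U\<^esub> g z" using ab gf by simp
  next
    fix r y assume r: "r \<in> carrier R" and "y \<in> carrier (fst V)"
    then obtain a where a: "a \<in> carrier (fst U)" "y = f a" using ex by meson
    have "r \<odot>\<^bsub>fst V\<^esub> y = f (r \<odot>\<^bsub>fst U\<^esub> a)" using a r by (simp add: pair_homD[OF f])
    then show "g (r \<odot>\<^bsub>fst V\<^esub> y) = r \<odot>\<^bsub>fst U\<^esub> g y" using a r gf by simp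
  next
    fix y assume "y \<in> snd V"
    then obtain a where "a \<in> snd U" "y = f a" using onto by blast
    then show "g y \<in> snd U" using gf A by auto
  qed
  show ?thesis
    by (intro bexI[OF _ g] conjI ballI) (use gf ex in force)+
qed

lemma pair_iso_if_bij:
  assumes f: "f \<in> pair_hom R U V" and "module R (fst U)" and A: "snd U \<subseteq> carrier (fst U)"
    and bij: "bij_betw f (carrier (fst U)) (carrier (fst V))"
    and onto: "snd V \<subseteq> f ` snd U"
  shows "pair_iso R U V"
  using pair_hom_inverse[OF assms] f unfolding pair_iso_def by blast

lemma mod_hom_zero:
  assumes "f \<in> mod_hom R M N" "module R M" "module R N"
  shows "f \<zero>\<^bsub>M\<^esub> = \<zero>\<^bsub>N\<^esub>"
proof -
  interpret M: module R M by fact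
  interpret N: module R N by fact
  have "f (\<zero>\<^bsub>R\<^esub> \<odot>\<^bsub>M\<^esub> \<zero>\<^bsub>M\<^esub>) = \<zero>\<^bsub>R\<^esub> \<odot>\<^bsub>N\<^esub> f \<zero>\<^bsub>M\<^esub>" by (intro mod_homD[OF assms(1)]) auto
  then show ?thesis by (simp add: mod_homD[OF assms(1)])
qed

lemma pair_hom_mod_hom: "f \<in> pair_hom R U V \<Longrightarrow> f \<in> mod_hom R (fst U) (fst V)"
  by (cases U; cases V) (auto simp: pair_hom_def)

lemmas pair_hom_zero = mod_hom_zero[OF pair_hom_mod_hom]

lemma (in module) minus_eq_smult: "x \<in> carrier M \<Longrightarrow> \<ominus>\<^bsub>M\<^esub> x = (\<ominus> \<one>) \<odot>\<^bsub>M\<^esub> x"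
  by (simp add: smult_l_minus)

lemma pair_hom_minus:
  assumes f: "f \<in> pair_hom R U V" and "module R (fst U)" "module R (fst V)" "x \<in> carrier (fst U)"
  shows "f (\<ominus>\<^bsub>fst U\<^esub> x) = \<ominus>\<^bsub>fst V\<^esub> f x"
proof -
  interpret U: module R "fst U" by fact
  interpret V: module R "fst V" by fact
  show ?thesis using assms(4) by (simp add: U.minus_eq_smult V.minus_eq_smult pair_homD[OF f])
qed

lemma (in module) submoduleI':
  assumes "H \<subseteq> carrier M" and "\<zero>\<^bsub>M\<^esub> \<in> H" and "\<And>a b. \<lbrakk>a \<in> H; b \<in> H\<rbrakk> \<Longrightarrow> a \<oplus>\<^bsub>M\<^esub> b \<in> H"
    and "\<And>a x. \<lbrakk>a \<in> carrier R; x \<in> H\<rbrakk> \<Longrightarrow> a \<odot>\<^bsub>M\<^esub> x \<in> H"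
  shows "submodule H R M"
  by (rule submoduleI) (use assms in \<open>auto simp: minus_eq_smult subset_iff\<close>)

lemma (in module) submodule_zero: "submodule H R M \<Longrightarrow> \<zero>\<^bsub>M\<^esub> \<in> H"
  using submoduleE[of H] smult_l_null by (metis R.zero_closed ex_in_conv subsetD)

section \<open>Direct sums of pairs\<close>

text \<open>
  What homomorphisms see of a pair. Unlike finite generation it passes to direct sums at once, and
  no argument about uniqueness needs more.
\<close>

definition mpair :: "('a, 'r) ring_scheme \<Rightarrow> ('a, 'b) mod_pair \<Rightarrow> bool" where
  "mpair R U \<longleftrightarrow> module R (fst U) \<and> submodule (snd U) R (fst U)"

lemma mpairD:
  assumes "mpair R U"
  shows "module R (fst U)" "submodule (snd U) R (fst U)" "snd U \<subseteq> carrier (fst U)"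
    "\<zero>\<^bsub>fst U\<^esub> \<in> snd U" "\<And>x y. \<lbrakk>x \<in> snd U; y \<in> snd U\<rbrakk> \<Longrightarrow> x \<oplus>\<^bsub>fst U\<^esub> y \<in> snd U"
    "\<And>r x. \<lbrakk>r \<in> carrier R; x \<in> snd U\<rbrakk> \<Longrightarrow> r \<odot>\<^bsub>fst U\<^esub> x \<in> snd U"
    "\<And>x. x \<in> snd U \<Longrightarrow> \<ominus>\<^bsub>fst U\<^esub> x \<in> snd U"
proof -
  show m: "module R (fst U)" and s: "submodule (snd U) R (fst U)" using assms by (auto simp: mpair_def)
  interpret U: module R "fst U" by fact
  show "snd U \<subseteq> carrier (fst U)"
    "\<zero>\<^bsub>fst U\<^esub> \<in> snd U" "\<And>x y. \<lbrakk>x \<in> snd U; y \<in> snd U\<rbrakk> \<Longrightarrow> x \<oplus>\<^bsub>fst U\<^esub> y \<in> snd U"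
    "\<And>r x. \<lbrakk>r \<in> carrier R; x \<in> snd U\<rbrakk> \<Longrightarrow> r \<odot>\<^bsub>fst U\<^esub> x \<in> snd U"
    "\<And>x. x \<in> snd U \<Longrightarrow> \<ominus>\<^bsub>fst U\<^esub> x \<in> snd U"
    using U.submoduleE[OF s] U.submodule_zero[OF s] by auto
qed

lemma is_pair_mpair: "is_pair R U \<Longrightarrow> mpair R U"
  by (auto simp: is_pair_def mpair_def)

lemma pair_sum_simps [simp]:
  "carrier (fst (pair_sum V W)) = carrier (fst V) \<times> carrier (fst W)"
  "snd (pair_sum V W) = snd V \<times> snd W"
  "\<zero>\<^bsub>fst (pair_sum V W)\<^esub> = (\<zero>\<^bsub>fst V\<^esub>, \<zero>\<^bsub>fst W\<^esub>)"
  "(x, y) \<oplus>\<^bsub>fst (pair_sum V W)\<^esub> (x', y') = (x \<oplus>\<^bsub>fst V\<^esub> x', y \<oplus>\<^bsub>fst W\<^esub> y')"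
  "r \<odot>\<^bsub>fst (pair_sum V W)\<^esub> (x, y) = (r \<odot>\<^bsub>fst V\<^esub> x, r \<odot>\<^bsub>fst W\<^esub> y)"
  by (cases V; cases W; simp add: pair_sum_def module_sum_def)+

lemma pair_list_sum_simps [simp]:
  "carrier (fst (pair_list_sum Us)) = (\<Pi>\<^sub>E i\<in>{..<length Us}. carrier (fst (Us ! i)))"
  "snd (pair_list_sum Us) = (\<Pi>\<^sub>E i\<in>{..<length Us}. snd (Us ! i))"
  "\<zero>\<^bsub>fst (pair_list_sum Us)\<^esub> = (\<lambda>i\<in>{..<length Us}. \<zero>\<^bsub>fst (Us ! i)\<^esub>)"
  "f \<oplus>\<^bsub>fst (pair_list_sum Us)\<^esub> g = (\<lambda>i\<in>{..<length Us}. f i \<oplus>\<^bsub>fst (Us ! i)\<^esub> g i)"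
  "r \<odot>\<^bsub>fst (pair_list_sum Us)\<^esub> f = (\<lambda>i\<in>{..<length Us}. r \<odot>\<^bsub>fst (Us ! i)\<^esub> f i)"
  by (auto simp: pair_list_sum_def module_list_sum_def Let_def intro!: restrict_ext PiE_cong)

lemma module_module_sum:
  assumes "module R M" "module R N"
  shows "module R (module_sum M N)"
proof -
  interpret M: module R M by fact
  interpret N: module R N by fact
  show ?thesis
  proof (rule moduleI)
    show "cring R" by (rule M.R.is_cring)
    show "abelian_group (module_sum M N)"
    proof (rule abelian_groupI)
      fix x assume "x \<in> carrier (module_sum M N)"
      then show "\<exists>y\<in>carrier (module_sum M N). y \<oplus>\<^bsub>module_sum M N\<^esub> x = \<zero>\<^bsub>module_sum M N\<^esub>"
        by (intro bexI[of _ "(\<ominus>\<^bsub>M\<^esub> fst x, \<ominus>\<^bsub>N\<^esub> snd x)"])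
          (auto simp: module_sum_def M.M.l_neg N.M.l_neg)
    qed (auto simp: module_sum_def M.M.a_ac N.M.a_ac)
  qed (auto simp: module_sum_def M.smult_l_distr N.smult_l_distr M.smult_r_distr N.smult_r_distr
      M.smult_assoc1 N.smult_assoc1)
qed

lemma module_module_list_sum:
  assumes "cring R" "\<And>M. M \<in> set Ms \<Longrightarrow> module R M"
  shows "module R (module_list_sum Ms)"
proof -
  have m: "module R (Ms ! i)" if "i < length Ms" for i using that assms by simp
  then have ag: "abelian_group (Ms ! i)" if "i < length Ms" for i using that by (simp add: module_def)
  then have am: "abelian_monoid (Ms ! i)" if "i < length Ms" for i using that by (simp add: abelian_group_def)
  show ?thesis
  proof (rule moduleI)
    show "abelian_group (module_list_sum Ms)"
    proof (rule abelian_groupI)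
      fix x assume "x \<in> carrier (module_list_sum Ms)"
      then show "\<exists>y\<in>carrier (module_list_sum Ms). y \<oplus>\<^bsub>module_list_sum Ms\<^esub> x = \<zero>\<^bsub>module_list_sum Ms\<^esub>"
        by (intro bexI[of _ "\<lambda>i\<in>{..<length Ms}. \<ominus>\<^bsub>Ms ! i\<^esub> x i"])
          (auto simp: module_list_sum_def Let_def PiE_def Pi_def fun_eq_iff restrict_def extensional_def
             abelian_group.l_neg[OF ag] abelian_group.a_inv_closed[OF ag])
    qed (auto simp: module_list_sum_def Let_def PiE_def Pi_def fun_eq_iff restrict_def extensional_def
        abelian_monoid.a_closed[OF am] abelian_monoid.zero_closed[OF am]
        abelian_monoid.a_ac[OF am] abelian_monoid.l_zero[OF am] abelian_monoid.r_zero[OF am])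
  qed (auto simp: assms(1) module_list_sum_def Let_def PiE_def Pi_def fun_eq_iff restrict_def extensional_def
      module.smult_closed[OF m] module.smult_l_distr[OF m] module.smult_r_distr[OF m]
      module.smult_assoc1[OF m] module.smult_one[OF m])
qed

lemma mpair_pair_sum:
  assumes "mpair R V" "mpair R W" shows "mpair R (pair_sum V W)"
proof -
  have m: "module R (fst (pair_sum V W))"
    using module_module_sum[OF mpairD(1)[OF assms(1)] mpairD(1)[OF assms(2)]]
    by (cases V; cases W) (simp add: pair_sum_def)
  show ?thesis unfolding mpair_def
    by (intro conjI m module.submoduleI'[OF m])
      (auto simp: mpairD[OF assms(1)] mpairD[OF assms(2)]
        subsetD[OF mpairD(3)[OF assms(1)]] subsetD[OF mpairD(3)[OF assms(2)]])
qed

lemma mpair_pair_list_sum: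
  assumes "cring R" "\<And>U. U \<in> set Us \<Longrightarrow> mpair R U" shows "mpair R (pair_list_sum Us)"
proof -
  have m: "module R (fst (pair_list_sum Us))"
    unfolding pair_list_sum_def by (auto intro!: module_module_list_sum assms mpairD(1))
  have i: "mpair R (Us ! i)" if "i < length Us" for i using assms that by simp
  show ?thesis unfolding mpair_def
    by (intro conjI m module.submoduleI'[OF m])
      (auto simp: PiE_def Pi_def mpairD[OF i] subsetD[OF mpairD(3)[OF i]])
qed

text \<open>
  The summand may stand anywhere in the list. Inductions over decompositions can therefore remove
  corresponding summands from two lists without ever permuting either of them.
\<close>

lemma pair_list_sum_extract:
  fixes U :: "('a, 'b) mod_pair"
  shows "pair_iso R (pair_list_sum (xs @ U # ys)) (pair_sum U (pair_list_sum (xs @ ys)))"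
proof -
  define n where "n = length xs"
  define d :: "nat \<Rightarrow> nat" where "d i = (if i < n then i else Suc i)" for i
  let ?L = "xs @ U # ys" and ?R = "xs @ ys"
  let ?f = "\<lambda>x. (x n, \<lambda>i\<in>{..<length ?R}. x (d i))"
  let ?g = "\<lambda>(u, y). \<lambda>i\<in>{..<length ?L}. if i = n then u else y (if i < n then i else i - 1)"
  have Ln: "?L ! n = U" by (simp add: n_def)
  have Ld: "?L ! (d i) = ?R ! i" for i by (auto simp: d_def n_def nth_append)
  have Le: "?R ! (if i < n then i else i - 1) = ?L ! i" if "i \<noteq> n" for i
    using that by (auto simp: n_def nth_append nth_Cons split: nat.split)
      (metis Suc_diff_Suc diff_Suc_1 linorder_neqE_nat nat.inject diff_right_commute)+
  have dl: "d i < length ?L" if "i < length ?R" for i using that by (auto simp: d_def n_def)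
  have el: "(if i < n then i else i - 1) < length ?R" if "i \<noteq> n" "i < length ?L" for i
    using that by (auto simp: n_def)
  have nl: "n < length ?L" by (simp add: n_def)
  have de: "d (if i < n then i else i - 1) = i" if "i \<noteq> n" for i using that by (auto simp: d_def)
  have ed: "(if d i < n then d i else d i - 1) = i" "d i \<noteq> n" for i by (auto simp: d_def)
  have f_mem: "x n \<in> F U" "(\<lambda>i\<in>{..<length ?R}. x (d i)) \<in> (\<Pi>\<^sub>E i\<in>{..<length ?R}. F (?R ! i))"
    if "x \<in> (\<Pi>\<^sub>E i\<in>{..<length ?L}. F (?L ! i))" for x and F :: "('a, 'b) mod_pair \<Rightarrow> 'b set"
  proof -
    have *: "x i \<in> F (?L ! i)" if "i < length ?L" for i
      using PiE_mem[OF \<open>x \<in> _\<close>] that by simp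
    show "x n \<in> F U" using *[OF nl] Ln by simp
    show "(\<lambda>i\<in>{..<length ?R}. x (d i)) \<in> (\<Pi>\<^sub>E i\<in>{..<length ?R}. F (?R ! i))"
    proof (rule restrict_PiE_iff[THEN iffD2], rule ballI)
      fix i assume "i \<in> {..<length ?R}"
      then show "x (d i) \<in> F (?R ! i)" using *[OF dl, of i] Ld[of i] by simp
    qed
  qed
  have g_mem: "?g (u, y) \<in> (\<Pi>\<^sub>E i\<in>{..<length ?L}. F (?L ! i))"
    if "u \<in> F U" "y \<in> (\<Pi>\<^sub>E i\<in>{..<length ?R}. F (?R ! i))" for u y and F :: "('a, 'b) mod_pair \<Rightarrow> 'b set"
  proof -
    have *: "y i \<in> F (?R ! i)" if "i < length ?R" for i
      using PiE_mem[OF \<open>y \<in> _\<close>] that by simp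
    have "(if i = n then u else y (if i < n then i else i - 1)) \<in> F (?L ! i)" if "i < length ?L" for i
      using *[OF el[OF _ that]] Le[of i] that(1) Ln \<open>u \<in> _\<close> by (cases "i = n") auto
    then show ?thesis by simp
  qed
  show ?thesis
  proof (rule pair_isoI)
    show "?f \<in> pair_hom R (pair_list_sum ?L) (pair_sum U (pair_list_sum ?R))"
    proof (rule pair_homI)
      show "?f x \<in> carrier (fst (pair_sum U (pair_list_sum ?R)))"
        if "x \<in> carrier (fst (pair_list_sum ?L))" for x
        using f_mem[of x "\<lambda>V. carrier (fst V)"] that by simp
      show "?f x \<in> snd (pair_sum U (pair_list_sum ?R))"
        if "x \<in> snd (pair_list_sum ?L)" for x
        using f_mem[of x snd] that by simp
    qed (use nl dl Ln Ld in \<open>auto simp: fun_eq_iff simp del: length_append\<close>)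
    show "?g \<in> pair_hom R (pair_sum U (pair_list_sum ?R)) (pair_list_sum ?L)"
    proof (rule pair_homI)
      show "?g x \<in> carrier (fst (pair_list_sum ?L))"
        if "x \<in> carrier (fst (pair_sum U (pair_list_sum ?R)))" for x
      proof -
        have "fst x \<in> (\<lambda>V. carrier (fst V)) U" "snd x \<in> (\<Pi>\<^sub>E i\<in>{..<length ?R}. (\<lambda>V. carrier (fst V)) (?R ! i))"
          using that by (simp_all only: pair_sum_simps pair_list_sum_simps mem_Times_iff)
        from g_mem[OF this] show ?thesis by (simp only: pair_list_sum_simps prod.collapse)
      qed
      show "?g x \<in> snd (pair_list_sum ?L)"
        if "x \<in> snd (pair_sum U (pair_list_sum ?R))" for x
      proof -
        have "fst x \<in> snd U" "snd x \<in> (\<Pi>\<^sub>E i\<in>{..<length ?R}. snd (?R ! i))"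
          using that by (simp_all only: pair_sum_simps pair_list_sum_simps mem_Times_iff)
        from g_mem[OF this] show ?thesis by (simp only: pair_list_sum_simps prod.collapse)
      qed
      show "?g (x \<oplus>\<^bsub>fst (pair_sum U (pair_list_sum ?R))\<^esub> y) = ?g x \<oplus>\<^bsub>fst (pair_list_sum ?L)\<^esub> ?g y" for x y
      proof
        fix i
        show "?g (x \<oplus>\<^bsub>fst (pair_sum U (pair_list_sum ?R))\<^esub> y) i = (?g x \<oplus>\<^bsub>fst (pair_list_sum ?L)\<^esub> ?g y) i"
          using el[of i] Le[of i] Ln
          by (cases x; cases y; cases "i < length ?L"; cases "i = n")
            (simp_all del: length_append append_Cons length_Cons)
      qed
      show "?g (r \<odot>\<^bsub>fst (pair_sum U (pair_list_sum ?R))\<^esub> x) = r \<odot>\<^bsub>fst (pair_list_sum ?L)\<^esub> ?g x" for r x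
      proof
        fix i
        show "?g (r \<odot>\<^bsub>fst (pair_sum U (pair_list_sum ?R))\<^esub> x) i = (r \<odot>\<^bsub>fst (pair_list_sum ?L)\<^esub> ?g x) i"
          using el[of i] Le[of i] Ln
          by (cases x; cases "i < length ?L"; cases "i = n")
            (simp_all del: length_append append_Cons length_Cons)
      qed
    qed
    show "?g (?f x) = x" if "x \<in> carrier (fst (pair_list_sum ?L))" for x
      using that el de by (auto simp: PiE_iff fun_eq_iff extensional_def simp del: length_append)
    show "?f (?g y) = y" if "y \<in> carrier (fst (pair_sum U (pair_list_sum ?R)))" for y
      using that dl ed nl by (auto simp: PiE_iff fun_eq_iff extensional_def simp del: length_append)
  qed
qed

lemmas pair_list_sum_Cons = pair_list_sum_extract[where xs = "[]", simplified]

section \<open>Krull--Schmidt cancellation for pairs with local endomorphism rings\<close>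

lemma module_minus_hom:
  assumes "module R M" "module R N" and "f \<in> mod_hom R M N" "g \<in> mod_hom R M N"
  shows "(\<lambda>x. f x \<ominus>\<^bsub>N\<^esub> g x) \<in> mod_hom R M N"
proof -
  interpret M: module R M by fact
  interpret N: module R N by fact
  note f = mod_homD[OF assms(3)] and g = mod_homD[OF assms(4)]
  show ?thesis unfolding mod_hom_def hom_def
    by (auto simp: f g a_minus_def N.M.minus_add N.M.a_ac N.smult_r_distr N.smult_r_minus)
qed

lemma pair_hom_minus_hom:
  assumes "mpair R U" "mpair R V" "f \<in> pair_hom R U V" "g \<in> pair_hom R U V"
  shows "(\<lambda>x. f x \<ominus>\<^bsub>fst V\<^esub> g x) \<in> pair_hom R U V"
proof -
  have "(\<lambda>x. f x \<ominus>\<^bsub>fst V\<^esub> g x) \<in> mod_hom R (fst U) (fst V)"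
    by (intro module_minus_hom pair_hom_mod_hom mpairD(1) assms)
  moreover have "f x \<ominus>\<^bsub>fst V\<^esub> g x \<in> snd V" if "x \<in> snd U" for x
    unfolding a_minus_def
    by (intro mpairD(5,7)[OF assms(2)] pair_homD(4)[OF assms(3)] pair_homD(4)[OF assms(4)] that)
  ultimately show ?thesis by (auto simp: pair_hom_def split: prod.splits)
qed

lemma pair_hom_Pair:
  assumes "f \<in> pair_hom R U V" "g \<in> pair_hom R U W"
  shows "(\<lambda>x. (f x, g x)) \<in> pair_hom R U (pair_sum V W)"
  by (rule pair_homI) (simp_all add: pair_homD[OF assms(1)] pair_homD[OF assms(2)])

lemma pair_hom_fst: "fst \<in> pair_hom R (pair_sum V W) V"
  and pair_hom_snd: "snd \<in> pair_hom R (pair_sum V W) W"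
  by (rule pair_homI; force)+

lemma pair_hom_zero_map:
  assumes "mpair R U" "mpair R V" shows "(\<lambda>_. \<zero>\<^bsub>fst V\<^esub>) \<in> pair_hom R U V"
proof -
  interpret V: module R "fst V" by (rule mpairD(1)[OF assms(2)])
  show ?thesis by (rule pair_homI) (simp_all add: mpairD[OF assms(2)])
qed

lemma pair_hom_inl: "mpair R V \<Longrightarrow> mpair R W \<Longrightarrow> (\<lambda>x. (x, \<zero>\<^bsub>fst W\<^esub>)) \<in> pair_hom R V (pair_sum V W)"
  by (intro pair_hom_Pair pair_hom_id pair_hom_zero_map)

lemma pair_hom_inr: "mpair R V \<Longrightarrow> mpair R W \<Longrightarrow> (\<lambda>y. (\<zero>\<^bsub>fst V\<^esub>, y)) \<in> pair_hom R W (pair_sum V W)"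
  by (intro pair_hom_Pair pair_hom_id pair_hom_zero_map)

definition pair_auto :: "('a, 'r) ring_scheme \<Rightarrow> ('a, 'b) mod_pair \<Rightarrow> ('b \<Rightarrow> 'b) \<Rightarrow> bool" where
  "pair_auto R U f \<longleftrightarrow> f \<in> pair_hom R U U \<and>
     (\<exists>g \<in> pair_hom R U U. \<forall>x \<in> carrier (fst U). g (f x) = x \<and> f (g x) = x)"

definition retract :: "('a, 'r) ring_scheme \<Rightarrow> ('a, 'b) mod_pair \<Rightarrow> ('a, 'c) mod_pair \<Rightarrow> bool" where
  "retract R U V \<longleftrightarrow>
     (\<exists>f \<in> pair_hom R U V. \<exists>g \<in> pair_hom R V U. \<forall>x \<in> carrier (fst U). g (f x) = x)"

text \<open>Locality of the endomorphism ring, without the ring: one of \<open>f\<close> and \<open>1 - f\<close> is invertible.\<close>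

definition local_pair :: "('a, 'r) ring_scheme \<Rightarrow> ('a, 'b) mod_pair \<Rightarrow> bool" where
  "local_pair R U \<longleftrightarrow> mpair R U \<and> \<not> zero_pair U \<and>
     (\<forall>f \<in> pair_hom R U U. pair_auto R U f \<or> pair_auto R U (\<lambda>x. x \<ominus>\<^bsub>fst U\<^esub> f x))"

lemma retractI:
  assumes "f \<in> pair_hom R U V" "g \<in> pair_hom R V U" "pair_auto R U (\<lambda>x. g (f x))"
  shows "retract R U V"
proof -
  obtain h where h: "h \<in> pair_hom R U U" "\<forall>x \<in> carrier (fst U). h (g (f x)) = x"
    using assms(3) unfolding pair_auto_def by blast
  show ?thesis unfolding retract_def
    using h(2) by (intro bexI[OF _ assms(1)] bexI[OF _ pair_hom_comp[OF assms(2) h(1)]])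
qed

lemma pair_auto_cong:
  assumes "pair_auto R U f" "\<And>x. x \<in> carrier (fst U) \<Longrightarrow> f x = g x" "mpair R U"
  shows "pair_auto R U g"
proof -
  interpret U: module R "fst U" by (rule mpairD(1)[OF assms(3)])
  have f: "f \<in> pair_hom R U U" using assms(1) by (auto simp: pair_auto_def)
  have "g \<in> pair_hom R U U"
    by (rule pair_homI) (use pair_homD[OF f] mpairD(3)[OF assms(3)] in \<open>auto simp: assms(2)[symmetric] subset_iff\<close>)
  then show ?thesis using assms(1,2) pair_homD(1) unfolding pair_auto_def
    by (metis (no_types, lifting))
qed

lemma pair_auto_comp:
  assumes "pair_auto R U f" "pair_auto R U g"
  shows "pair_auto R U (\<lambda>x. f (g x))"
proof -
  obtain f' where f: "f \<in> pair_hom R U U" "f' \<in> pair_hom R U U"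
    "\<forall>x \<in> carrier (fst U). f' (f x) = x \<and> f (f' x) = x" using assms(1) by (auto simp: pair_auto_def)
  obtain g' where g: "g \<in> pair_hom R U U" "g' \<in> pair_hom R U U"
    "\<forall>x \<in> carrier (fst U). g' (g x) = x \<and> g (g' x) = x" using assms(2) by (auto simp: pair_auto_def)
  show ?thesis unfolding pair_auto_def
    using pair_hom_comp[OF g(1) f(1)] pair_hom_comp[OF f(2) g(2)] f(3) g(3)
      pair_homD(1)[OF g(1)] pair_homD(1)[OF f(2)]
    by (intro conjI bexI[of _ "\<lambda>x. g' (f' x)"]) auto
qed

text \<open>
  Since \<open>g \<circ> f\<close> is the identity, \<open>f \<circ> g\<close> is an idempotent. In a local ring an idempotent is \<open>1\<close> or
  \<open>0\<close>, and here it is not \<open>0\<close> because \<open>U\<close> is not zero.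
\<close>

lemma retract_of_local:
  assumes U: "mpair R U" "\<not> zero_pair U" and V: "local_pair R V"
    and f: "f \<in> pair_hom R U V" and g: "g \<in> pair_hom R V U"
    and gf: "\<And>x. x \<in> carrier (fst U) \<Longrightarrow> g (f x) = x"
    and y: "y \<in> carrier (fst V)"
  shows "f (g y) = y"
proof -
  have mV: "mpair R V" using V by (simp add: local_pair_def)
  interpret U: module R "fst U" by (rule mpairD(1)[OF U(1)])
  interpret V: module R "fst V" by (rule mpairD(1)[OF mV])
  note f' = pair_homD[OF f] and g' = pair_homD[OF g]
  consider "pair_auto R V (\<lambda>y. f (g y))" | "pair_auto R V (\<lambda>y. y \<ominus>\<^bsub>fst V\<^esub> f (g y))"
    using V pair_hom_comp[OF g f] unfolding local_pair_def by blast
  then show ?thesis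
  proof cases
    case 1
    then obtain h where "\<forall>x \<in> carrier (fst V). h (f (g x)) = x" unfolding pair_auto_def by blast
    then show ?thesis using y f' g' gf by metis
  next
    case 2
    then obtain h where h: "h \<in> pair_hom R V V" "\<forall>y \<in> carrier (fst V). h (y \<ominus>\<^bsub>fst V\<^esub> f (g y)) = y"
      unfolding pair_auto_def by blast
    have z: "x = \<zero>\<^bsub>fst U\<^esub>" if x: "x \<in> carrier (fst U)" for x
    proof -
      have "f x \<ominus>\<^bsub>fst V\<^esub> f (g (f x)) = \<zero>\<^bsub>fst V\<^esub>"
        using gf[OF x] f' x by (simp add: a_minus_def V.M.r_neg)
      then have "f x = \<zero>\<^bsub>fst V\<^esub>"
        using h(2) f' x pair_hom_zero[OF h(1)] V.module_axioms by metis
      then show ?thesis using gf[OF x] pair_hom_zero[OF g] V.module_axioms U.module_axioms by metis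
    qed
    with U(2) show ?thesis by (auto simp: zero_pair_def)
  qed
qed

lemma retract_of_local_iso:
  assumes "mpair R U" "\<not> zero_pair U" "local_pair R V" "retract R U V"
  shows "pair_iso R U V"
proof -
  obtain f g where fg: "f \<in> pair_hom R U V" "g \<in> pair_hom R V U" "\<And>x. x \<in> carrier (fst U) \<Longrightarrow> g (f x) = x"
    using assms(4) unfolding retract_def by blast
  show ?thesis by (rule pair_isoI[OF fg(1,2,3) retract_of_local[OF assms(1-3) fg]])
qed

text \<open>
  The identity of \<open>U\<close> is the sum of the two endomorphisms that factor through \<open>V\<close> and through \<open>W\<close>;
  by locality one of them is invertible.
\<close>

lemma retract_pair_sum:
  assumes U: "local_pair R U" and V: "mpair R V" and W: "mpair R W"
    and "retract R U (pair_sum V W)"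
  shows "retract R U V \<or> retract R U W"
proof -
  have mU: "mpair R U" using U by (simp add: local_pair_def)
  interpret U: module R "fst U" by (rule mpairD(1)[OF mU])
  interpret V: module R "fst V" by (rule mpairD(1)[OF V])
  interpret W: module R "fst W" by (rule mpairD(1)[OF W])
  obtain f g where f: "f \<in> pair_hom R U (pair_sum V W)" and g: "g \<in> pair_hom R (pair_sum V W) U"
    and gf: "\<And>x. x \<in> carrier (fst U) \<Longrightarrow> g (f x) = x"
    using assms(4) unfolding retract_def by blast
  have f1: "(\<lambda>x. fst (f x)) \<in> pair_hom R U V" by (rule pair_hom_comp[OF f pair_hom_fst])
  have f2: "(\<lambda>x. snd (f x)) \<in> pair_hom R U W" by (rule pair_hom_comp[OF f pair_hom_snd])
  have g1: "(\<lambda>x. g (x, \<zero>\<^bsub>fst W\<^esub>)) \<in> pair_hom R V U" by (rule pair_hom_comp[OF pair_hom_inl[OF V W] g])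
  have g2: "(\<lambda>x. g (\<zero>\<^bsub>fst V\<^esub>, x)) \<in> pair_hom R W U" by (rule pair_hom_comp[OF pair_hom_inr[OF V W] g])
  note h1 = pair_hom_comp[OF f1 g1] and h2 = pair_hom_comp[OF f2 g2]
  have sum: "x = g (fst (f x), \<zero>\<^bsub>fst W\<^esub>) \<oplus>\<^bsub>fst U\<^esub> g (\<zero>\<^bsub>fst V\<^esub>, snd (f x))" if x: "x \<in> carrier (fst U)" for x
  proof -
    have m: "fst (f x) \<in> carrier (fst V)" "snd (f x) \<in> carrier (fst W)"
      using pair_homD(1)[OF f x] by auto
    have "f x = (fst (f x), \<zero>\<^bsub>fst W\<^esub>) \<oplus>\<^bsub>fst (pair_sum V W)\<^esub> (\<zero>\<^bsub>fst V\<^esub>, snd (f x))"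
      using m by simp
    then have "g (f x) = g (fst (f x), \<zero>\<^bsub>fst W\<^esub>) \<oplus>\<^bsub>fst U\<^esub> g (\<zero>\<^bsub>fst V\<^esub>, snd (f x))"
      using pair_homD(2)[OF g, of "(fst (f x), \<zero>\<^bsub>fst W\<^esub>)" "(\<zero>\<^bsub>fst V\<^esub>, snd (f x))"] m by simp
    then show ?thesis using gf[OF x] by simp
  qed
  consider "pair_auto R U (\<lambda>x. g (fst (f x), \<zero>\<^bsub>fst W\<^esub>))"
    | "pair_auto R U (\<lambda>x. x \<ominus>\<^bsub>fst U\<^esub> g (fst (f x), \<zero>\<^bsub>fst W\<^esub>))"
    using U h1 unfolding local_pair_def by blast
  then show ?thesis
  proof cases
    case 1 then show ?thesis using retractI[OF f1 g1] by blast
  next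
    case 2
    have "pair_auto R U (\<lambda>x. g (\<zero>\<^bsub>fst V\<^esub>, snd (f x)))"
    proof (rule pair_auto_cong[OF 2 _ mU])
      fix x assume x: "x \<in> carrier (fst U)"
      show "x \<ominus>\<^bsub>fst U\<^esub> g (fst (f x), \<zero>\<^bsub>fst W\<^esub>) = g (\<zero>\<^bsub>fst V\<^esub>, snd (f x))"
        using sum[OF x] pair_homD(1)[OF h1 x] pair_homD(1)[OF h2 x] x
        by (smt (verit) U.M.add.inv_solve_right' U.M.minus_eq U.M.a_comm)
    qed
    then show ?thesis using retractI[OF f2 g2] by blast
  qed
qed

lemma retract_iso:
  assumes "retract R U V" "pair_iso R V W" shows "retract R U W"
proof -
  obtain f g where fg: "f \<in> pair_hom R U V" "g \<in> pair_hom R V U" "\<And>x. x \<in> carrier (fst U) \<Longrightarrow> g (f x) = x"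
    using assms(1) unfolding retract_def by blast
  obtain h k where hk: "h \<in> pair_hom R V W" "k \<in> pair_hom R W V"
    "\<And>x. x \<in> carrier (fst V) \<Longrightarrow> k (h x) = x" using pair_isoE[OF assms(2)] by metis
  show ?thesis unfolding retract_def
    using pair_hom_comp[OF fg(1) hk(1)] pair_hom_comp[OF hk(2) fg(2)] fg(3) hk(3) pair_homD(1)[OF fg(1)]
    by (intro bexI[of _ "\<lambda>x. h (f x)"] bexI[of _ "\<lambda>x. g (k x)"]) auto
qed

lemma retract_pair_list_sum:
  fixes Vs :: "('a, 'c) mod_pair list"
  assumes "local_pair R U" "\<And>V. V \<in> set Vs \<Longrightarrow> mpair R V" "retract R U (pair_list_sum Vs)"
  shows "\<exists>V \<in> set Vs. retract R U V"
  using assms(2,3)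
proof (induction Vs)
  case Nil
  have mU: "mpair R U" using assms(1) by (simp add: local_pair_def)
  interpret U: module R "fst U" by (rule mpairD(1)[OF mU])
  obtain f where "f \<in> pair_hom R U (pair_list_sum ([] :: ('a, 'c) mod_pair list))" "\<exists>g. \<forall>x \<in> carrier (fst U). g (f x) = x"
    using Nil(2) unfolding retract_def by blast
  then obtain g where fg: "f \<in> pair_hom R U (pair_list_sum ([] :: ('a, 'c) mod_pair list))" "\<And>x. x \<in> carrier (fst U) \<Longrightarrow> g (f x) = x"
    by blast
  have "f x = (\<lambda>i. undefined)" if "x \<in> carrier (fst U)" for x
    using pair_homD(1)[OF fg(1) that] by simp
  then have "x = \<zero>\<^bsub>fst U\<^esub>" if "x \<in> carrier (fst U)" for x
    using fg(2)[OF that] fg(2)[OF U.M.zero_closed] that by simp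
  then have "zero_pair U" by (auto simp: zero_pair_def)
  then show ?case using assms(1) by (simp add: local_pair_def)
next
  case (Cons V Vs)
  have mU: "mpair R U" using assms(1) by (simp add: local_pair_def)
  interpret U: module R "fst U" by (rule mpairD(1)[OF mU])
  have "retract R U V \<or> retract R U (pair_list_sum Vs)"
    using Cons.prems
    by (intro retract_pair_sum[OF assms(1)] mpair_pair_list_sum retract_iso[OF _ pair_list_sum_Cons] U.R.is_cring) auto
  then show ?case using Cons by auto
qed

text \<open>
  Cancellation of \<open>U\<close> from \<open>\<phi> : U \<oplus> P \<cong> U \<oplus> Q\<close> when the component \<open>U \<rightarrow> U\<close> of \<open>\<phi>\<close> is invertible:
  the Schur complement of that component is an isomorphism \<open>P \<rightarrow> Q\<close>, whose inverse is the
  component \<open>Q \<rightarrow> P\<close> of the inverse of \<open>\<phi>\<close>.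
\<close>

lemma cancel_if_auto:
  assumes U: "mpair R U" and P: "mpair R P" and Q: "mpair R Q"
    and phi: "\<phi> \<in> pair_hom R (pair_sum U P) (pair_sum U Q)"
    and psi: "\<psi> \<in> pair_hom R (pair_sum U Q) (pair_sum U P)"
    and psi_phi: "\<And>x. x \<in> carrier (fst (pair_sum U P)) \<Longrightarrow> \<psi> (\<phi> x) = x"
    and phi_psi: "\<And>y. y \<in> carrier (fst (pair_sum U Q)) \<Longrightarrow> \<phi> (\<psi> y) = y"
    and auto: "pair_auto R U (\<lambda>u. fst (\<phi> (u, \<zero>\<^bsub>fst P\<^esub>)))"
  shows "pair_iso R P Q"
proof -
  interpret U: module R "fst U" by (rule mpairD(1)[OF U])
  interpret P: module R "fst P" by (rule mpairD(1)[OF P])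
  interpret Q: module R "fst Q" by (rule mpairD(1)[OF Q])
  define a where "a u = fst (\<phi> (u, \<zero>\<^bsub>fst P\<^esub>))" for u
  define b where "b x = fst (\<phi> (\<zero>\<^bsub>fst U\<^esub>, x))" for x
  have a: "a \<in> pair_hom R U U" unfolding a_def
    by (rule pair_hom_comp[OF pair_hom_comp[OF pair_hom_inl[OF U P] phi] pair_hom_fst])
  have b: "b \<in> pair_hom R P U" unfolding b_def
    by (rule pair_hom_comp[OF pair_hom_comp[OF pair_hom_inr[OF U P] phi] pair_hom_fst])
  obtain c where c: "c \<in> pair_hom R U U" "\<And>u. u \<in> carrier (fst U) \<Longrightarrow> c (a u) = u"
    "\<And>u. u \<in> carrier (fst U) \<Longrightarrow> a (c u) = u"
    using auto unfolding pair_auto_def a_def by blast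
  note a' = pair_homD[OF a] and b' = pair_homD[OF b] and c' = pair_homD[OF c(1)]
  have split: "fst (\<phi> (u, x)) = a u \<oplus>\<^bsub>fst U\<^esub> b x" if "u \<in> carrier (fst U)" "x \<in> carrier (fst P)" for u x
  proof -
    have "\<phi> (u, x) = \<phi> (u, \<zero>\<^bsub>fst P\<^esub>) \<oplus>\<^bsub>fst (pair_sum U Q)\<^esub> \<phi> (\<zero>\<^bsub>fst U\<^esub>, x)"
      using pair_homD(2)[OF phi, of "(u, \<zero>\<^bsub>fst P\<^esub>)" "(\<zero>\<^bsub>fst U\<^esub>, x)"] that by simp
    then show ?thesis by (cases "\<phi> (u, \<zero>\<^bsub>fst P\<^esub>)"; cases "\<phi> (\<zero>\<^bsub>fst U\<^esub>, x)") (simp add: a_def b_def)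
  qed
  define e where "e x = \<zero>\<^bsub>fst U\<^esub> \<ominus>\<^bsub>fst U\<^esub> c (b x)" for x
  have e: "e \<in> pair_hom R P U" unfolding e_def
    by (intro pair_hom_minus_hom pair_hom_zero_map pair_hom_comp[OF b c(1)] P U)
  note e' = pair_homD[OF e]
  have ae: "a (e x) \<oplus>\<^bsub>fst U\<^esub> b x = \<zero>\<^bsub>fst U\<^esub>" if x: "x \<in> carrier (fst P)" for x
  proof -
    have "e x = \<ominus>\<^bsub>fst U\<^esub> c (b x)" using b' c' x by (simp add: e_def a_minus_def)
    then have "a (e x) = \<ominus>\<^bsub>fst U\<^esub> b x"
      using pair_hom_minus[OF a U.module_axioms U.module_axioms] b' c' c(3) x by simp
    then show ?thesis using b' x by (simp add: U.M.l_neg)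
  qed
  have e_uniq: "w = e x" if w: "w \<in> carrier (fst U)" and x: "x \<in> carrier (fst P)"
    and "a w \<oplus>\<^bsub>fst U\<^esub> b x = \<zero>\<^bsub>fst U\<^esub>" for w x
  proof -
    have "a w = a (e x)"
      using that(3) ae[OF x] a' b' e' w x by (metis U.M.add.right_cancel)
    then show ?thesis using c(2) w e' x by metis
  qed
  define t where "t x = snd (\<phi> (e x, x))" for x
  define s where "s y = snd (\<psi> (\<zero>\<^bsub>fst U\<^esub>, y))" for y
  have t: "t \<in> pair_hom R P Q" unfolding t_def
    by (rule pair_hom_comp[OF pair_hom_comp[OF pair_hom_Pair[OF e pair_hom_id] phi] pair_hom_snd])
  have s: "s \<in> pair_hom R Q P" unfolding s_def
    by (rule pair_hom_comp[OF pair_hom_comp[OF pair_hom_inr[OF U Q] psi] pair_hom_snd])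
  show ?thesis
  proof (rule pair_isoI[OF t s])
    fix x assume x: "x \<in> carrier (fst P)"
    have "\<phi> (e x, x) = (\<zero>\<^bsub>fst U\<^esub>, t x)"
      using split[OF e'(1)[OF x] x] ae[OF x] by (simp add: t_def prod_eq_iff)
    then have "\<psi> (\<zero>\<^bsub>fst U\<^esub>, t x) = (e x, x)" using psi_phi[of "(e x, x)"] e'(1)[OF x] x by simp
    then show "s (t x) = x" by (simp add: s_def)
  next
    fix y assume y: "y \<in> carrier (fst Q)"
    obtain w x where wx: "\<psi> (\<zero>\<^bsub>fst U\<^esub>, y) = (w, x)" by fastforce
    have m: "w \<in> carrier (fst U)" "x \<in> carrier (fst P)"
      using pair_homD(1)[OF psi, of "(\<zero>\<^bsub>fst U\<^esub>, y)"] y wx by auto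
    have p: "\<phi> (w, x) = (\<zero>\<^bsub>fst U\<^esub>, y)" using phi_psi[of "(\<zero>\<^bsub>fst U\<^esub>, y)"] y wx by simp
    then have "w = e x" using e_uniq[OF m] split[OF m] by simp
    then show "t (s y) = y" using p wx by (simp add: s_def t_def)
  qed
qed

text \<open>
  Let \<open>a : U \<rightarrow> U\<close> and \<open>c : U \<rightarrow> Q\<close> be components of an isomorphism \<open>\<phi> : U \<oplus> P \<rightarrow> U \<oplus> Q\<close>, and \<open>a2\<close>, \<open>b2\<close> the
  components of its inverse that lead back to \<open>U\<close>. Then \<open>a2 \<circ> a + b2 \<circ> c\<close> is the identity of \<open>U\<close>. By
  locality a summand is invertible, and this makes \<open>a\<close> invertible, possibly after a change of \<open>\<phi>\<close>.
\<close>

lemma local_cancel: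
  assumes loc: "local_pair R U" and P: "mpair R P" and Q: "mpair R Q"
    and iso: "pair_iso R (pair_sum U P) (pair_sum U Q)"
  shows "pair_iso R P Q"
proof -
  have U: "mpair R U" "\<not> zero_pair U" using loc by (simp_all add: local_pair_def)
  interpret U: module R "fst U" by (rule mpairD(1)[OF U(1)])
  interpret P: module R "fst P" by (rule mpairD(1)[OF P])
  interpret Q: module R "fst Q" by (rule mpairD(1)[OF Q])
  obtain \<phi> \<psi> where phi: "\<phi> \<in> pair_hom R (pair_sum U P) (pair_sum U Q)"
    and psi: "\<psi> \<in> pair_hom R (pair_sum U Q) (pair_sum U P)"
    and psi_phi: "\<And>x. x \<in> carrier (fst (pair_sum U P)) \<Longrightarrow> \<psi> (\<phi> x) = x"
    and phi_psi: "\<And>y. y \<in> carrier (fst (pair_sum U Q)) \<Longrightarrow> \<phi> (\<psi> y) = y"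
    using pair_isoE[OF iso] by blast
  define a where "a u = fst (\<phi> (u, \<zero>\<^bsub>fst P\<^esub>))" for u
  define c where "c u = snd (\<phi> (u, \<zero>\<^bsub>fst P\<^esub>))" for u
  define a2 where "a2 u = fst (\<psi> (u, \<zero>\<^bsub>fst Q\<^esub>))" for u
  define b2 where "b2 y = fst (\<psi> (\<zero>\<^bsub>fst U\<^esub>, y))" for y
  have a: "a \<in> pair_hom R U U" unfolding a_def
    by (rule pair_hom_comp[OF pair_hom_comp[OF pair_hom_inl[OF U(1) P] phi] pair_hom_fst])
  have c: "c \<in> pair_hom R U Q" unfolding c_def
    by (rule pair_hom_comp[OF pair_hom_comp[OF pair_hom_inl[OF U(1) P] phi] pair_hom_snd])
  have a2: "a2 \<in> pair_hom R U U" unfolding a2_def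
    by (rule pair_hom_comp[OF pair_hom_comp[OF pair_hom_inl[OF U(1) Q] psi] pair_hom_fst])
  have b2: "b2 \<in> pair_hom R Q U" unfolding b2_def
    by (rule pair_hom_comp[OF pair_hom_comp[OF pair_hom_inr[OF U(1) Q] psi] pair_hom_fst])
  note a' = pair_homD[OF a] and c' = pair_homD[OF c] and a2' = pair_homD[OF a2] and b2' = pair_homD[OF b2]
  have sum: "a2 (a u) \<oplus>\<^bsub>fst U\<^esub> b2 (c u) = u" if u: "u \<in> carrier (fst U)" for u
  proof -
    have "\<phi> (u, \<zero>\<^bsub>fst P\<^esub>) = (a u, c u)" by (simp add: a_def c_def)
    then have "\<psi> (a u, c u) = (u, \<zero>\<^bsub>fst P\<^esub>)" using psi_phi[of "(u, \<zero>\<^bsub>fst P\<^esub>)"] u by simp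
    moreover have "\<psi> (a u, c u) = \<psi> (a u, \<zero>\<^bsub>fst Q\<^esub>) \<oplus>\<^bsub>fst (pair_sum U P)\<^esub> \<psi> (\<zero>\<^bsub>fst U\<^esub>, c u)"
      using pair_homD(2)[OF psi, of "(a u, \<zero>\<^bsub>fst Q\<^esub>)" "(\<zero>\<^bsub>fst U\<^esub>, c u)"] a' c' u by simp
    ultimately show ?thesis
      by (cases "\<psi> (a u, \<zero>\<^bsub>fst Q\<^esub>)"; cases "\<psi> (\<zero>\<^bsub>fst U\<^esub>, c u)") (simp add: a2_def b2_def)
  qed
  have finish: "pair_iso R P Q" if "pair_auto R U a"
    by (rule cancel_if_auto[OF U(1) P Q phi psi psi_phi phi_psi]) (use that in \<open>simp_all add: a_def[abs_def]\<close>)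
  have left_inv: "pair_auto R U a" if g: "g \<in> pair_hom R U U" and ga: "pair_auto R U (\<lambda>u. g (a u))" for g
  proof -
    obtain h where h: "h \<in> pair_hom R U U" "\<forall>x \<in> carrier (fst U). h (g (a x)) = x"
      using ga unfolding pair_auto_def by blast
    have hg: "(\<lambda>x. h (g x)) \<in> pair_hom R U U" by (rule pair_hom_comp[OF g h(1)])
    have "a (h (g y)) = y" if "y \<in> carrier (fst U)" for y
      by (rule retract_of_local[OF U loc a hg _ that]) (use h in auto)
    then have "\<forall>x \<in> carrier (fst U). h (g (a x)) = x \<and> a (h (g x)) = x" using h(2) by blast
    then show ?thesis unfolding pair_auto_def by (intro conjI a bexI[OF _ hg])
  qed
  have f: "(\<lambda>u. b2 (c u)) \<in> pair_hom R U U" by (rule pair_hom_comp[OF c b2])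
  consider "pair_auto R U (\<lambda>u. b2 (c u))" | "pair_auto R U (\<lambda>u. u \<ominus>\<^bsub>fst U\<^esub> b2 (c u))"
    using loc f unfolding local_pair_def by blast
  then show ?thesis
  proof cases
    case 2
    have "pair_auto R U (\<lambda>u. a2 (a u))"
    proof (rule pair_auto_cong[OF 2 _ U(1)])
      fix u assume u: "u \<in> carrier (fst U)"
      show "u \<ominus>\<^bsub>fst U\<^esub> b2 (c u) = a2 (a u)"
        using sum[OF u] a' a2' b2' c' u by (metis U.M.add.inv_solve_right U.M.minus_eq)
    qed
    then show ?thesis using finish left_inv[OF a2] by blast
  next
    case 1
    then obtain g where g: "g \<in> pair_hom R U U" "\<And>u. u \<in> carrier (fst U) \<Longrightarrow> b2 (c (g u)) = u"
      unfolding pair_auto_def by blast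
    note g' = pair_homD[OF g(1)]
    consider "pair_auto R U (\<lambda>u. g (a u))" | "pair_auto R U (\<lambda>u. u \<ominus>\<^bsub>fst U\<^esub> g (a u))"
      using loc pair_hom_comp[OF a g(1)] unfolding local_pair_def by blast
    then show ?thesis
    proof cases
      case i: 1
      then show ?thesis using finish left_inv[OF g(1)] by blast
    next
      case i: 2
      \<comment> \<open>Here \<open>a\<close> need not be invertible. Composing \<open>\<phi>\<close> with the involution \<open>\<theta>\<close> of \<open>U \<oplus> Q\<close> turns this
         component into \<open>b2 \<circ> c - a = b2 \<circ> c \<circ> (1 - g \<circ> a)\<close>, a product of invertible maps.\<close>
      define \<theta> where "\<theta> z = (b2 (snd z) \<ominus>\<^bsub>fst U\<^esub> fst z, snd z)" for z
      have th: "\<theta> \<in> pair_hom R (pair_sum U Q) (pair_sum U Q)"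
        unfolding \<theta>_def
        by (intro pair_hom_Pair pair_hom_minus_hom pair_hom_comp[OF pair_hom_snd b2] pair_hom_fst pair_hom_snd
            mpair_pair_sum U(1) Q)
      have thth: "\<theta> (\<theta> z) = z" if zm: "z \<in> carrier (fst (pair_sum U Q))" for z
      proof -
        obtain u y where z: "z = (u, y)" "u \<in> carrier (fst U)" "y \<in> carrier (fst Q)"
          using zm by (cases z) auto
        have "b2 y \<ominus>\<^bsub>fst U\<^esub> (b2 y \<ominus>\<^bsub>fst U\<^esub> u) = u"
          using z b2'(1)[OF z(3)] by (simp add: a_minus_def U.M.minus_add U.M.r_neg2)
        then show ?thesis by (simp add: \<theta>_def z)
      qed
      have "pair_auto R U (\<lambda>u. b2 (c (u \<ominus>\<^bsub>fst U\<^esub> g (a u))))"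
        using pair_auto_comp[OF 1 i] .
      then have "pair_auto R U (\<lambda>u. fst (\<theta> (\<phi> (u, \<zero>\<^bsub>fst P\<^esub>))))"
      proof (rule pair_auto_cong[OF _ _ U(1)])
        fix u assume u: "u \<in> carrier (fst U)"
        have "b2 (c (u \<ominus>\<^bsub>fst U\<^esub> g (a u))) = b2 (c u) \<ominus>\<^bsub>fst U\<^esub> b2 (c (g (a u)))"
          using pair_homD(2)[OF f, of u "\<ominus>\<^bsub>fst U\<^esub> g (a u)"] pair_hom_minus[OF f U.module_axioms U.module_axioms, of "g (a u)"]
            u a' g' by (simp add: a_minus_def)
        then show "b2 (c (u \<ominus>\<^bsub>fst U\<^esub> g (a u))) = fst (\<theta> (\<phi> (u, \<zero>\<^bsub>fst P\<^esub>)))"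
          using g(2) a' u by (simp add: \<theta>_def flip: a_def c_def)
      qed
      then show ?thesis
        using phi_psi psi_phi pair_homD(1)[OF phi] pair_homD(1)[OF th] thth
        by (intro cancel_if_auto[OF U(1) P Q pair_hom_comp[OF phi th] pair_hom_comp[OF th psi]]) auto
    qed
  qed
qed

section \<open>Isomorphisms between direct sums\<close>

lemma pair_sum_cong:
  assumes "pair_iso R V V'" "pair_iso R W W'"
  shows "pair_iso R (pair_sum V W) (pair_sum V' W')"
proof -
  obtain f g where f: "f \<in> pair_hom R V V'" "g \<in> pair_hom R V' V"
    "\<And>x. x \<in> carrier (fst V) \<Longrightarrow> g (f x) = x" "\<And>y. y \<in> carrier (fst V') \<Longrightarrow> f (g y) = y"
    using pair_isoE[OF assms(1)] by blast
  obtain h k where h: "h \<in> pair_hom R W W'" "k \<in> pair_hom R W' W"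
    "\<And>x. x \<in> carrier (fst W) \<Longrightarrow> k (h x) = x" "\<And>y. y \<in> carrier (fst W') \<Longrightarrow> h (k y) = y"
    using pair_isoE[OF assms(2)] by blast
  show ?thesis
    by (rule pair_isoI[OF
          pair_hom_Pair[OF pair_hom_comp[OF pair_hom_fst f(1)] pair_hom_comp[OF pair_hom_snd h(1)]]
          pair_hom_Pair[OF pair_hom_comp[OF pair_hom_fst f(2)] pair_hom_comp[OF pair_hom_snd h(2)]]])
      (auto simp: f h)
qed

lemma pair_sum_assoc:
  "pair_iso R (pair_sum (pair_sum U V) W) (pair_sum U (pair_sum V W))"
  by (rule pair_isoI[where f = "\<lambda>((x, y), z). (x, (y, z))" and g = "\<lambda>(x, (y, z)). ((x, y), z)"];
      (rule pair_homI)?) auto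

lemma zero_pair_iso:
  assumes "pair_iso R U V" "module R (fst U)" "module R (fst V)" "zero_pair U" shows "zero_pair V"
proof -
  obtain f g where fg: "f \<in> pair_hom R U V" "g \<in> pair_hom R V U" "\<And>y. y \<in> carrier (fst V) \<Longrightarrow> f (g y) = y"
    using pair_isoE[OF assms(1)] by metis
  interpret V: module R "fst V" by fact
  have "y = \<zero>\<^bsub>fst V\<^esub>" if "y \<in> carrier (fst V)" for y
    using fg(3)[OF that] pair_homD(1)[OF fg(2) that] assms(4) pair_hom_zero[OF fg(1) assms(2,3)]
    by (auto simp: zero_pair_def)
  then show ?thesis by (auto simp: zero_pair_def)
qed

lemma pair_list_sum_Nil_iso: 
  fixes W :: "('a, 'b) mod_pair"
  assumes "mpair R W"
  shows "pair_iso R (pair_sum (pair_list_sum ([] :: ('a, 'c) mod_pair list)) W) W"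
proof (rule pair_isoI[OF pair_hom_snd])
  interpret W: module R "fst W" using mpairD(1)[OF assms] .
  show "(\<lambda>w. (\<lambda>_. undefined, w)) \<in> pair_hom R W (pair_sum (pair_list_sum ([] :: ('a, 'c) mod_pair list)) W)"
    by (rule pair_homI) (auto simp: fun_eq_iff)
qed auto

lemma pair_list_sum_append:
  assumes "\<And>W. W \<in> set Ws \<Longrightarrow> mpair R W" "cring R"
  shows "pair_iso R (pair_list_sum (Vs @ Ws)) (pair_sum (pair_list_sum Vs) (pair_list_sum Ws))"
proof (induction Vs)
  case Nil
  then show ?case
    using pair_iso_sym[OF pair_list_sum_Nil_iso[OF mpair_pair_list_sum[OF assms(2,1)]]] by simp
next
  case (Cons V Vs)
  have "pair_iso R (pair_list_sum ((V # Vs) @ Ws)) (pair_sum V (pair_list_sum (Vs @ Ws)))"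
    using pair_list_sum_Cons[of R V "Vs @ Ws"] by simp
  also have "pair_iso R \<dots> (pair_sum V (pair_sum (pair_list_sum Vs) (pair_list_sum Ws)))"
    by (intro pair_sum_cong pair_iso_refl Cons)
  also have "pair_iso R \<dots> (pair_sum (pair_sum V (pair_list_sum Vs)) (pair_list_sum Ws))"
    by (rule pair_iso_sym[OF pair_sum_assoc])
  also have "pair_iso R \<dots> (pair_sum (pair_list_sum (V # Vs)) (pair_list_sum Ws))"
    by (intro pair_sum_cong pair_iso_refl pair_iso_sym[OF pair_list_sum_Cons])
  finally show ?case .
qed

section \<open>Free pairs\<close>

lemma self_module_simps [simp]:
  "carrier (self_module R) = carrier R" "\<zero>\<^bsub>self_module R\<^esub> = \<zero>\<^bsub>R\<^esub>"
  "x \<oplus>\<^bsub>self_module R\<^esub> y = x \<oplus>\<^bsub>R\<^esub> y" "x \<odot>\<^bsub>self_module R\<^esub> y = x \<otimes>\<^bsub>R\<^esub> y"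
  by (simp_all add: self_module_def)

lemma (in cring) module_self_module: "module R (self_module R)"
proof (rule moduleI)
  show "abelian_group (self_module R)"
    by (rule abelian_groupI) (auto simp: a_ac intro: bexI[of _ "\<ominus> x" for x] l_neg)
qed (auto simp: is_cring l_distr r_distr m_assoc)

abbreviation free_pair :: "('a, 'r) ring_scheme \<Rightarrow> ('a, 'a) mod_pair" where
  "free_pair R \<equiv> (self_module R, {\<zero>\<^bsub>R\<^esub>})"

lemma (in cring) mpair_free_pair: "mpair R (free_pair R)"
  using module.submoduleI'[OF module_self_module, of "{\<zero>}"] module_self_module by (simp add: mpair_def)

definition torsion_free :: "('a, 'r) ring_scheme \<Rightarrow> ('a, 'b) module \<Rightarrow> bool" where
  "torsion_free R M \<longleftrightarrow> (\<forall>r \<in> carrier R. \<forall>x \<in> carrier M. r \<odot>\<^bsub>M\<^esub> x = \<zero>\<^bsub>M\<^esub> \<longrightarrow> r = \<zero>\<^bsub>R\<^esub> \<or> x = \<zero>\<^bsub>M\<^esub>)"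

text \<open>
  Comparison of ranks without determinants or dimensions: an injection \<open>f\<close> of \<open>R \<oplus> P\<close> into
  \<open>R \<oplus> Q\<close> has a vector \<open>w = (1, x0)\<close> whose image has a nonzero first coordinate \<open>c\<close> (or else
  \<open>f\<close> already maps \<open>P\<close> into \<open>Q\<close>), and \<open>c f(x) - f\<^sub>1(x) f(w)\<close> eliminates that coordinate.
\<close>

lemma (in domain) injection_cancel_free:
  assumes P: "module R (fst P)" and Q: "module R (fst Q)" and tf: "torsion_free R (fst P)"
    and f: "f \<in> mod_hom R (fst (pair_sum (free_pair R) P)) (fst (pair_sum (free_pair R) Q))"
    and inj: "inj_on f (carrier (fst (pair_sum (free_pair R) P)))"
  shows "\<exists>g \<in> mod_hom R (fst P) (fst Q). inj_on g (carrier (fst P))"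
proof -
  interpret P: module R "fst P" by fact
  interpret Q: module R "fst Q" by fact
  have mem: "fst (f (r, x)) \<in> carrier R" "snd (f (r, x)) \<in> carrier (fst Q)"
    if "r \<in> carrier R" "x \<in> carrier (fst P)" for r x
    using mod_homD(1)[OF f, of "(r, x)"] that by (auto simp: mem_Times_iff)
  have add: "fst (f (r \<oplus> s, x \<oplus>\<^bsub>fst P\<^esub> y)) = fst (f (r, x)) \<oplus> fst (f (s, y))"
    "snd (f (r \<oplus> s, x \<oplus>\<^bsub>fst P\<^esub> y)) = snd (f (r, x)) \<oplus>\<^bsub>fst Q\<^esub> snd (f (s, y))"
    if "r \<in> carrier R" "s \<in> carrier R" "x \<in> carrier (fst P)" "y \<in> carrier (fst P)" for r s x y
    using mod_homD(2)[OF f, of "(r, x)" "(s, y)"] that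
    by (cases "f (r, x)"; cases "f (s, y)"; simp)+
  have smul: "fst (f (s \<otimes> r, s \<odot>\<^bsub>fst P\<^esub> x)) = s \<otimes> fst (f (r, x))"
    "snd (f (s \<otimes> r, s \<odot>\<^bsub>fst P\<^esub> x)) = s \<odot>\<^bsub>fst Q\<^esub> snd (f (r, x))"
    if "r \<in> carrier R" "s \<in> carrier R" "x \<in> carrier (fst P)" for r s x
    using mod_homD(3)[OF f, of s "(r, x)"] that by (cases "f (r, x)"; simp)+
  define f1 where "f1 x = fst (f (\<zero>, x))" for x
  define f2 where "f2 x = snd (f (\<zero>, x))" for x
  have f1: "f1 x \<in> carrier R" "f1 (x \<oplus>\<^bsub>fst P\<^esub> y) = f1 x \<oplus> f1 y" "r \<in> carrier R \<Longrightarrow> f1 (r \<odot>\<^bsub>fst P\<^esub> x) = r \<otimes> f1 x"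
    if "x \<in> carrier (fst P)" "y \<in> carrier (fst P)" for x y r
    using mem[of \<zero> x] add[of \<zero> \<zero> x y] smul[of \<zero> r x] that by (simp_all add: f1_def)
  have f2: "f2 x \<in> carrier (fst Q)" "f2 (x \<oplus>\<^bsub>fst P\<^esub> y) = f2 x \<oplus>\<^bsub>fst Q\<^esub> f2 y"
    "r \<in> carrier R \<Longrightarrow> f2 (r \<odot>\<^bsub>fst P\<^esub> x) = r \<odot>\<^bsub>fst Q\<^esub> f2 x"
    if "x \<in> carrier (fst P)" "y \<in> carrier (fst P)" for x y r
    using mem[of \<zero> x] add[of \<zero> \<zero> x y] smul[of \<zero> r x] that by (simp_all add: f2_def)
  show ?thesis
  proof (cases "\<exists>x0 \<in> carrier (fst P). fst (f (\<one>, x0)) \<noteq> \<zero>")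
    case False
    have "f1 x = \<zero>" if x: "x \<in> carrier (fst P)" for x
      using add(1)[of \<one> \<zero> "\<zero>\<^bsub>fst P\<^esub>" x] False x mem[of \<zero> x] by (simp add: f1_def)
    then have "f (\<zero>, x) = (\<zero>, f2 x)" if "x \<in> carrier (fst P)" for x
      using that by (simp add: f1_def f2_def prod_eq_iff)
    then have "inj_on f2 (carrier (fst P))"
      using inj_onD[OF inj, of "(\<zero>, x)" "(\<zero>, y)" for x y] by (intro inj_onI) auto
    moreover have "f2 \<in> mod_hom R (fst P) (fst Q)"
      using f2 unfolding mod_hom_def hom_def by auto
    ultimately show ?thesis by blast
  next
    case True
    then obtain x0 where x0: "x0 \<in> carrier (fst P)" "fst (f (\<one>, x0)) \<noteq> \<zero>" by blast
    define c where "c = fst (f (\<one>, x0))"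
    define w where "w = snd (f (\<one>, x0))"
    have c: "c \<in> carrier R" "c \<noteq> \<zero>" and w: "w \<in> carrier (fst Q)"
      using x0 mem[of \<one> x0] by (simp_all add: c_def w_def)
    define g where "g x = c \<odot>\<^bsub>fst Q\<^esub> f2 x \<oplus>\<^bsub>fst Q\<^esub> (\<ominus> f1 x) \<odot>\<^bsub>fst Q\<^esub> w" for x
    have g: "g \<in> mod_hom R (fst P) (fst Q)"
      unfolding mod_hom_def hom_def
    proof (intro CollectI conjI ballI)
      fix x y assume "x \<in> carrier (add_monoid (fst P))" "y \<in> carrier (add_monoid (fst P))"
      then have xy: "x \<in> carrier (fst P)" "y \<in> carrier (fst P)" by simp_all
      show "g (x \<otimes>\<^bsub>add_monoid (fst P)\<^esub> y) = g x \<otimes>\<^bsub>add_monoid (fst Q)\<^esub> g y"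
        using xy c w f1[OF xy] f2[OF xy] f1[OF xy(2,1)] f2[OF xy(2,1)]
        by (simp add: g_def Q.smult_r_distr Q.smult_l_distr Q.M.a_ac minus_add)
    next
      fix r x assume rx: "r \<in> carrier R" "x \<in> carrier (fst P)"
      have "c \<odot>\<^bsub>fst Q\<^esub> (r \<odot>\<^bsub>fst Q\<^esub> f2 x) = r \<odot>\<^bsub>fst Q\<^esub> (c \<odot>\<^bsub>fst Q\<^esub> f2 x)"
        using rx c f2[OF rx(2) rx(2)] by (simp flip: Q.smult_assoc1 add: m_comm)
      moreover have "(\<ominus> (r \<otimes> f1 x)) \<odot>\<^bsub>fst Q\<^esub> w = r \<odot>\<^bsub>fst Q\<^esub> ((\<ominus> f1 x) \<odot>\<^bsub>fst Q\<^esub> w)"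
        using rx c w f1[OF rx(2) rx(2)] by (simp flip: Q.smult_assoc1 add: r_minus)
      ultimately show "g (r \<odot>\<^bsub>fst P\<^esub> x) = r \<odot>\<^bsub>fst Q\<^esub> g x"
        using rx c w f1[OF rx(2) rx(2)] f2[OF rx(2) rx(2)]
        by (simp add: g_def Q.smult_r_distr)
    next
      show "g \<in> carrier (add_monoid (fst P)) \<rightarrow> carrier (add_monoid (fst Q))"
        using c w f1 f2 by (auto simp: g_def)
    qed
    have ker: "x = \<zero>\<^bsub>fst P\<^esub>" if x: "x \<in> carrier (fst P)" and gx: "g x = \<zero>\<^bsub>fst Q\<^esub>" for x
    proof -
      let ?z = "(\<ominus> f1 x, c \<odot>\<^bsub>fst P\<^esub> x \<oplus>\<^bsub>fst P\<^esub> (\<ominus> f1 x) \<odot>\<^bsub>fst P\<^esub> x0)"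
      note fx = f1(1)[OF x x]
      have 1: "fst (f ?z) = \<zero>"
        using add(1)[of \<zero> "\<ominus> f1 x" "c \<odot>\<^bsub>fst P\<^esub> x" "(\<ominus> f1 x) \<odot>\<^bsub>fst P\<^esub> x0"]
          smul(1)[of \<one> "\<ominus> f1 x" x0] f1(3)[OF x x c(1)] fx c x0(1) x
        by (simp add: f1_def[symmetric] c_def[symmetric]) (simp add: m_comm[of "\<ominus> f1 x" c] r_minus r_neg)
      have 2: "snd (f ?z) = \<zero>\<^bsub>fst Q\<^esub>"
        using add(2)[of \<zero> "\<ominus> f1 x" "c \<odot>\<^bsub>fst P\<^esub> x" "(\<ominus> f1 x) \<odot>\<^bsub>fst P\<^esub> x0"]
          smul(2)[of \<one> "\<ominus> f1 x" x0] f2(3)[OF x x c(1)] fx c x0(1) x gx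
        by (simp add: f2_def[symmetric] w_def[symmetric] g_def)
      have z: "f (\<zero>, \<zero>\<^bsub>fst P\<^esub>) = (\<zero>, \<zero>\<^bsub>fst Q\<^esub>)"
        using smul[of \<zero> \<zero> "\<zero>\<^bsub>fst P\<^esub>"] mem[of \<zero> "\<zero>\<^bsub>fst P\<^esub>"] by (simp add: prod_eq_iff)
      have "?z = (\<zero>, \<zero>\<^bsub>fst P\<^esub>)"
        by (rule inj_onD[OF inj]) (use 1 2 z fx c x0(1) x in \<open>simp_all add: prod_eq_iff\<close>)
      then have m: "\<ominus> f1 x = \<zero>" and "c \<odot>\<^bsub>fst P\<^esub> x \<oplus>\<^bsub>fst P\<^esub> (\<ominus> f1 x) \<odot>\<^bsub>fst P\<^esub> x0 = \<zero>\<^bsub>fst P\<^esub>" by auto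
      then have "c \<odot>\<^bsub>fst P\<^esub> x = \<zero>\<^bsub>fst P\<^esub>" unfolding m using c x x0 by simp
      then show ?thesis using tf c x unfolding torsion_free_def by blast
    qed
    have "inj_on g (carrier (fst P))"
    proof (rule inj_onI)
      fix x y assume xy: "x \<in> carrier (fst P)" "y \<in> carrier (fst P)" and e: "g x = g y"
      note g' = mod_homD[OF g]
      have "g (x \<oplus>\<^bsub>fst P\<^esub> (\<ominus> \<one>) \<odot>\<^bsub>fst P\<^esub> y) = g x \<oplus>\<^bsub>fst Q\<^esub> (\<ominus> \<one>) \<odot>\<^bsub>fst Q\<^esub> g y"
        using xy g' by simp
      also have "\<dots> = \<zero>\<^bsub>fst Q\<^esub>"
        using xy g'(1) e by (simp add: Q.smult_l_minus Q.M.r_neg)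
      finally have "x \<oplus>\<^bsub>fst P\<^esub> (\<ominus> \<one>) \<odot>\<^bsub>fst P\<^esub> y = \<zero>\<^bsub>fst P\<^esub>" using ker xy by simp
      then show "x = y" using xy by (simp add: P.smult_l_minus P.M.r_neg P.M.minus_equality[symmetric])
         (metis P.M.a_comm P.M.minus_equality P.M.minus_minus P.M.a_inv_closed)
    qed
    with g show ?thesis by blast
  qed
qed

lemma torsion_free_inj:
  assumes "f \<in> mod_hom R M N" "inj_on f (carrier M)" "module R M" "module R N" "torsion_free R N"
  shows "torsion_free R M"
proof -
  interpret M: module R M by fact
  interpret N: module R N by fact
  have "r = \<zero>\<^bsub>R\<^esub> \<or> x = \<zero>\<^bsub>M\<^esub>" if "r \<in> carrier R" "x \<in> carrier M" "r \<odot>\<^bsub>M\<^esub> x = \<zero>\<^bsub>M\<^esub>" for r x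
  proof -
    have "r \<odot>\<^bsub>N\<^esub> f x = \<zero>\<^bsub>N\<^esub>"
      using mod_homD(3)[OF assms(1) that(1,2)] mod_hom_zero[OF assms(1,3,4)] that(3) by simp
    then have "r = \<zero>\<^bsub>R\<^esub> \<or> f x = f \<zero>\<^bsub>M\<^esub>"
      using assms(5) mod_homD(1)[OF assms(1) that(2)] that(1) mod_hom_zero[OF assms(1,3,4)]
      unfolding torsion_free_def by auto
    then show ?thesis using inj_onD[OF assms(2)] that by auto
  qed
  then show ?thesis unfolding torsion_free_def by blast
qed

lemma pair_iso_retract: "pair_iso R U V \<Longrightarrow> retract R U V"
  unfolding pair_iso_def retract_def by blast

lemma mod_hom_comp_inj:
  assumes "f \<in> mod_hom R M N" "inj_on f (carrier M)" "g \<in> mod_hom R N L" "inj_on g (carrier N)"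
  shows "(\<lambda>x. g (f x)) \<in> mod_hom R M L" "inj_on (\<lambda>x. g (f x)) (carrier M)"
  using mod_homD[OF assms(1)] mod_homD[OF assms(3)] assms(2,4)
  by (auto simp: mod_hom_def hom_def inj_on_def)

lemma pair_iso_inj:
  assumes "pair_iso R U V"
  obtains f where "f \<in> mod_hom R (fst U) (fst V)" "inj_on f (carrier (fst U))"
  using assms by (elim pair_isoE) (metis inj_on_inverseI pair_hom_mod_hom)

definition torsion_pair :: "('a, 'r) ring_scheme \<Rightarrow> ('a, 'b) mod_pair \<Rightarrow> bool" where
  "torsion_pair R U \<longleftrightarrow>
     (\<exists>c \<in> carrier R. c \<noteq> \<zero>\<^bsub>R\<^esub> \<and> (\<forall>x \<in> carrier (fst U). c \<odot>\<^bsub>fst U\<^esub> x = \<zero>\<^bsub>fst U\<^esub>))"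

definition krull_schmidt_summand :: "('a, 'r) ring_scheme \<Rightarrow> ('a, 'b) mod_pair \<Rightarrow> bool" where
  "krull_schmidt_summand R U \<longleftrightarrow>
     local_pair R U \<and> torsion_pair R U \<or> type_free R U \<and> mpair R U"

context domain
begin

lemma torsion_free_pair_list_sum:
  assumes "\<And>U. U \<in> set Us \<Longrightarrow> type_free R U \<and> mpair R U"
  shows "torsion_free R (fst (pair_list_sum Us))"
proof -
  have "torsion_free R (fst (Us ! i))" if i: "i < length Us" for i
  proof -
    have "type_free R (Us ! i)" "mpair R (Us ! i)" using assms i by auto
    moreover have "torsion_free R (self_module R)" by (auto simp: torsion_free_def integral_iff)
    ultimately show ?thesis
      unfolding type_free_def by (metis fst_conv pair_iso_inj torsion_free_inj mpairD(1) module_self_module)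
  qed
  then have *: "r = \<zero> \<or> x = \<zero>\<^bsub>fst (Us ! i)\<^esub>"
    if "i < length Us" "r \<in> carrier R" "x \<in> carrier (fst (Us ! i))" "r \<odot>\<^bsub>fst (Us ! i)\<^esub> x = \<zero>\<^bsub>fst (Us ! i)\<^esub>" for i r x
    using that unfolding torsion_free_def by blast
  show ?thesis unfolding torsion_free_def
  proof (intro ballI impI)
    fix r x assume r: "r \<in> carrier R" and x: "x \<in> carrier (fst (pair_list_sum Us))"
      and z: "r \<odot>\<^bsub>fst (pair_list_sum Us)\<^esub> x = \<zero>\<^bsub>fst (pair_list_sum Us)\<^esub>"
    have "r = \<zero> \<or> x i = \<zero>\<^bsub>fst (Us ! i)\<^esub>" if i: "i < length Us" for i
    proof (rule *[OF i r])
      show "x i \<in> carrier (fst (Us ! i))" using x i by auto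
      show "r \<odot>\<^bsub>fst (Us ! i)\<^esub> x i = \<zero>\<^bsub>fst (Us ! i)\<^esub>" using fun_cong[OF z, of i] i by simp
    qed
    moreover have "x = \<zero>\<^bsub>fst (pair_list_sum Us)\<^esub>" if "\<And>i. i < length Us \<Longrightarrow> x i = \<zero>\<^bsub>fst (Us ! i)\<^esub>"
      using x that by (auto simp: fun_eq_iff PiE_iff extensional_def restrict_def)
    ultimately show "r = \<zero> \<or> x = \<zero>\<^bsub>fst (pair_list_sum Us)\<^esub>" by blast
  qed
qed

lemma free_rank_mono:
  fixes Us :: "('a, 'c) mod_pair list" and Vs :: "('a, 'd) mod_pair list"
  assumes "\<And>U. U \<in> set Us \<Longrightarrow> type_free R U \<and> mpair R U" "\<And>V. V \<in> set Vs \<Longrightarrow> type_free R V \<and> mpair R V"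
    and "f \<in> mod_hom R (fst (pair_list_sum Us)) (fst (pair_list_sum Vs))"
    and "inj_on f (carrier (fst (pair_list_sum Us)))"
  shows "length Us \<le> length Vs"
  using assms
proof (induction Us arbitrary: Vs f)
  case Cons: (Cons U Us)
  have mU: "mpair R (pair_list_sum Us)"
    using Cons.prems(1) by (auto intro!: mpair_pair_list_sum is_cring)
  have "pair_iso R (pair_sum (free_pair R) (pair_list_sum Us)) (pair_list_sum (U # Us))"
    using Cons.prems(1)[of U]
    by (intro pair_iso_sym[OF pair_iso_trans[OF pair_list_sum_Cons pair_sum_cong[OF _ pair_iso_refl]]])
      (auto simp: type_free_def)
  then obtain h where h: "h \<in> mod_hom R (fst (pair_sum (free_pair R) (pair_list_sum Us))) (fst (pair_list_sum (U # Us)))"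
    "inj_on h (carrier (fst (pair_sum (free_pair R) (pair_list_sum Us))))" by (rule pair_iso_inj)
  have fh: "(\<lambda>x. f (h x)) \<in> mod_hom R (fst (pair_sum (free_pair R) (pair_list_sum Us))) (fst (pair_list_sum Vs))"
    "inj_on (\<lambda>x. f (h x)) (carrier (fst (pair_sum (free_pair R) (pair_list_sum Us))))"
    using mod_hom_comp_inj[OF h Cons.prems(3,4)] by blast+
  show ?case
  proof (cases Vs)
    case Nil
    interpret S: module R "fst (pair_list_sum Us)" using mU mpairD(1) by blast
    define z where "z = \<zero>\<^bsub>fst (pair_list_sum Us)\<^esub>"
    have z: "(\<one>, z) \<in> carrier (fst (pair_sum (free_pair R) (pair_list_sum Us)))"
      "(\<zero>, z) \<in> carrier (fst (pair_sum (free_pair R) (pair_list_sum Us)))"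
      using S.M.zero_closed by (simp_all add: z_def del: pair_list_sum_simps)
    have "(\<one>, z) = (\<zero>, z)"
      by (rule inj_onD[OF fh(2) _ z]) (use mod_homD(1)[OF fh(1) z(1)] mod_homD(1)[OF fh(1) z(2)] Nil in simp)
    then show ?thesis by simp
  next
    case Vs: (Cons V Ws)
    have "pair_iso R (pair_list_sum Vs) (pair_sum (free_pair R) (pair_list_sum Ws))"
      using Cons.prems(2)[of V] Vs
      by (auto simp: type_free_def intro!: pair_iso_trans[OF pair_list_sum_Cons pair_sum_cong[OF _ pair_iso_refl]])
    then obtain k where k: "k \<in> mod_hom R (fst (pair_list_sum Vs)) (fst (pair_sum (free_pair R) (pair_list_sum Ws)))"
      "inj_on k (carrier (fst (pair_list_sum Vs)))" by (rule pair_iso_inj)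
    have Ws: "type_free R W \<and> mpair R W" if "W \<in> set Ws" for W using Cons.prems(2) Vs that by auto
    have Us: "type_free R W \<and> mpair R W" if "W \<in> set Us" for W using Cons.prems(1) that by auto
    have "\<exists>g \<in> mod_hom R (fst (pair_list_sum Us)) (fst (pair_list_sum Ws)). inj_on g (carrier (fst (pair_list_sum Us)))"
      by (rule injection_cancel_free[OF _ _ torsion_free_pair_list_sum[OF Us] mod_hom_comp_inj[OF fh k]])
        (use Us Ws in \<open>auto intro!: mpairD(1) mpair_pair_list_sum is_cring\<close>)
    then have "length Us \<le> length Ws" using Cons.IH[OF Us Ws] by blast
    then show ?thesis using Vs by simp
  qed
qed simp

section \<open>Uniqueness of decompositions\<close>

lemma local_torsion_not_retract_of_free:
  assumes U: "local_pair R U" "torsion_pair R U" and V: "type_free R V"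
  shows "\<not> retract R U V"
proof
  assume "retract R U V"
  then have "retract R U (free_pair R)" using V retract_iso unfolding type_free_def by blast
  then obtain f g where f: "f \<in> pair_hom R U (free_pair R)" and g: "g \<in> pair_hom R (free_pair R) U"
    and gf: "\<And>x. x \<in> carrier (fst U) \<Longrightarrow> g (f x) = x" unfolding retract_def by blast
  obtain c where c: "c \<in> carrier R" "c \<noteq> \<zero>" "\<And>x. x \<in> carrier (fst U) \<Longrightarrow> c \<odot>\<^bsub>fst U\<^esub> x = \<zero>\<^bsub>fst U\<^esub>"
    using U(2) unfolding torsion_pair_def by blast
  have mU: "module R (fst U)" and mL: "module R (fst (free_pair R))"
    using mpairD(1)[of R U] mpairD(1)[OF mpair_free_pair] U(1) unfolding local_pair_def by blast+
  have "x = \<zero>\<^bsub>fst U\<^esub>" if x: "x \<in> carrier (fst U)" for x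
  proof -
    have "c \<otimes> f x = \<zero>"
      using pair_homD(3)[OF f c(1) x] c(3)[OF x] pair_hom_zero[OF f mU mL] by simp
    then have "f x = \<zero>" using pair_homD(1)[OF f x] c by (simp add: integral_iff)
    then show ?thesis using gf[OF x] pair_hom_zero[OF g mL mU] by simp
  qed
  moreover have "\<zero>\<^bsub>fst U\<^esub> \<in> carrier (fst U)"
    using mU by (simp add: module_def abelian_group_def abelian_monoid.zero_closed)
  ultimately have "zero_pair U" unfolding zero_pair_def by blast
  then show False using U(1) unfolding local_pair_def by blast
qed

text \<open>
  A local torsion summand \<open>U\<close> on one side is a retract of some summand \<open>V\<close> on the other. As \<open>V\<close>
  cannot be free, it is isomorphic to \<open>U\<close>, and \<open>U\<close> can be cancelled.
\<close>

lemma exchange_local: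
  fixes Vs :: "('a, 'd) mod_pair list"
  assumes U: "local_pair R U" "torsion_pair R U" and P: "mpair R P"
    and Vs: "\<And>V. V \<in> set Vs \<Longrightarrow> krull_schmidt_summand R V"
    and iso: "pair_iso R (pair_sum U P) (pair_list_sum Vs)"
  obtains ys V zs where "Vs = ys @ V # zs" "pair_iso R U V" "local_pair R V" "pair_iso R P (pair_list_sum (ys @ zs))"
proof -
  have mU: "mpair R U" "\<not> zero_pair U" using U(1) by (simp_all add: local_pair_def)
  have mV: "mpair R V" if "V \<in> set Vs" for V
    using Vs[OF that] by (auto simp: krull_schmidt_summand_def local_pair_def)
  interpret U: module R "fst U" by (rule mpairD(1)[OF mU(1)])
  interpret P: module R "fst P" by (rule mpairD(1)[OF P])
  have "retract R U (pair_sum U P)"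
    unfolding retract_def
    by (intro bexI[OF _ pair_hom_inl[OF mU(1) P]] bexI[OF _ pair_hom_fst]) simp
  then have "retract R U (pair_list_sum Vs)" using retract_iso iso by blast
  then obtain V where V: "V \<in> set Vs" "retract R U V"
    using retract_pair_list_sum[OF U(1)] mV by blast
  have "local_pair R V"
    using Vs[OF V(1)] V(2) local_torsion_not_retract_of_free[OF U] unfolding krull_schmidt_summand_def by blast
  then have UV: "pair_iso R U V" using retract_of_local_iso[OF mU] V(2) by blast
  obtain ys zs where Vs': "Vs = ys @ V # zs" using split_list[OF V(1)] by blast
  have "pair_iso R (pair_sum U P) (pair_sum V (pair_list_sum (ys @ zs)))"
    using pair_iso_trans[OF iso] pair_list_sum_extract[of R ys V zs] Vs' by simp
  also have "pair_iso R \<dots> (pair_sum U (pair_list_sum (ys @ zs)))"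
    by (intro pair_sum_cong pair_iso_refl pair_iso_sym[OF UV])
  finally have "pair_iso R P (pair_list_sum (ys @ zs))"
    using mV Vs' by (intro local_cancel[OF U(1) P mpair_pair_list_sum]) (auto intro: is_cring)
  with that Vs' UV \<open>local_pair R V\<close> show ?thesis by blast
qed

text \<open>
  Summands with local endomorphism ring are cancelled one after the other. When none is left on
  one side, none is left on the other, and free pairs are counted by their rank.
\<close>

theorem krull_schmidt_unique:
  fixes Us :: "('a, 'c) mod_pair list" and Vs :: "('a, 'd) mod_pair list"
  assumes "\<And>U. U \<in> set Us \<Longrightarrow> krull_schmidt_summand R U"
    and "\<And>V. V \<in> set Vs \<Longrightarrow> krull_schmidt_summand R V"
    and "pair_iso R (pair_list_sum Us) (pair_list_sum Vs)"
  shows "rel_mset (pair_iso R) (mset Us) (mset Vs)"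
  using assms
proof (induction "length Us" arbitrary: Us Vs rule: less_induct)
  case less
  have mUs: "mpair R U" if "U \<in> set Us" for U
    using less.prems(1)[OF that] by (auto simp: krull_schmidt_summand_def local_pair_def)
  have mVs: "mpair R V" if "V \<in> set Vs" for V
    using less.prems(2)[OF that] by (auto simp: krull_schmidt_summand_def local_pair_def)
  show ?case
  proof (cases "\<exists>U \<in> set Us. local_pair R U \<and> torsion_pair R U")
    case True
    then obtain U where U: "U \<in> set Us" "local_pair R U" "torsion_pair R U" by blast
    obtain ws xs where Us: "Us = ws @ U # xs" using split_list[OF U(1)] by blast
    have m: "mpair R (pair_list_sum (ws @ xs))"
      using mUs Us by (intro mpair_pair_list_sum is_cring) auto
    have "pair_iso R (pair_sum U (pair_list_sum (ws @ xs))) (pair_list_sum Vs)"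
      using pair_iso_trans[OF pair_iso_sym[OF pair_list_sum_extract[of R ws U xs]]] less.prems(3) Us by simp
    then obtain ys V zs where Vs: "Vs = ys @ V # zs" "pair_iso R U V"
      "pair_iso R (pair_list_sum (ws @ xs)) (pair_list_sum (ys @ zs))"
      using exchange_local[OF U(2,3) m less.prems(2)] by metis
    have "rel_mset (pair_iso R) (mset (ws @ xs)) (mset (ys @ zs))"
      by (rule less.hyps) (use less.prems Us Vs in auto)
    from rel_mset_Plus[of "pair_iso R", OF Vs(2) this] show ?thesis by (simp add: Us Vs)
  next
    case False
    then have Us: "type_free R U \<and> mpair R U" if "U \<in> set Us" for U
      using that less.prems(1) unfolding krull_schmidt_summand_def by blast
    have Vs: "type_free R V \<and> mpair R V" if V: "V \<in> set Vs" for V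
    proof (rule ccontr)
      assume "\<not> (type_free R V \<and> mpair R V)"
      then have loc: "local_pair R V" "torsion_pair R V"
        using less.prems(2)[OF V] by (auto simp: krull_schmidt_summand_def)
      obtain ys zs where Vs': "Vs = ys @ V # zs" using split_list[OF V] by blast
      have m: "mpair R (pair_list_sum (ys @ zs))"
        using mVs Vs' by (intro mpair_pair_list_sum is_cring) auto
      have "pair_iso R (pair_sum V (pair_list_sum (ys @ zs))) (pair_list_sum Us)"
        using pair_iso_trans[OF pair_iso_sym[OF pair_list_sum_extract[of R ys V zs]] pair_iso_sym[OF less.prems(3)[unfolded Vs']]] .
      then obtain U where "U \<in> set Us" "pair_iso R V U"
        using exchange_local[OF loc m less.prems(1)] by (metis in_set_conv_decomp)
      then have "retract R V U" "type_free R U" using Us pair_iso_retract by blast+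
      then show False using local_torsion_not_retract_of_free[OF loc] by blast
    qed
    have "length Us = length Vs"
    proof (rule antisym)
      show "length Us \<le> length Vs"
        by (rule pair_iso_inj[OF less.prems(3)]) (rule free_rank_mono[OF Us Vs])
      show "length Vs \<le> length Us"
        by (rule pair_iso_inj[OF pair_iso_sym[OF less.prems(3)]]) (rule free_rank_mono[OF Vs Us])
    qed
    have "list_all2 (pair_iso R) Us Vs"
    proof (rule list_all2_all_nthI[OF \<open>length Us = length Vs\<close>])
      fix i assume "i < length Us"
      then have "Us ! i \<in> set Us" "Vs ! i \<in> set Vs" using \<open>length Us = length Vs\<close> by auto
      then show "pair_iso R (Us ! i) (Vs ! i)"
        using Us Vs pair_iso_trans pair_iso_sym unfolding type_free_def by blast
    qed
    then show ?thesis unfolding rel_mset_def by blast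
  qed
qed

end

lemma same_up_to_iso_and_order_if_rel_mset:
  assumes "rel_mset (pair_iso R) (mset Us) (mset Vs)"
  shows "same_up_to_iso_and_order R Us Vs"
proof -
  obtain xs ys where xy: "mset xs = mset Us" "mset ys = mset Vs" "list_all2 (pair_iso R) xs ys"
    using assms unfolding rel_mset_def by blast
  obtain f where f: "bij_betw f {..<length Us} {..<length xs}" "\<forall>i<length Us. Us ! i = xs ! f i"
    using permutation_Ex_bij[of Us xs] xy(1) by metis
  obtain g where g: "bij_betw g {..<length ys} {..<length Vs}" "\<forall>i<length ys. ys ! i = Vs ! g i"
    using permutation_Ex_bij[of ys Vs] xy(2) by metis
  have l: "length xs = length ys" using xy(3) by (rule list_all2_lengthD)
  show ?thesis unfolding same_up_to_iso_and_order_def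
  proof (intro exI conjI allI impI)
    show "bij_betw (g \<circ> f) {..<length Us} {..<length Vs}"
      using bij_betw_trans[OF f(1)] g(1) l by simp
    fix i assume "i < length Us"
    then have "f i < length xs" using f(1) by (auto dest: bij_betwE)
    then show "pair_iso R (Us ! i) (Vs ! (g \<circ> f) i)"
      using f(2) g(2) l xy(3) \<open>i < length Us\<close> by (auto simp: list_all2_conv_all_nth)
  qed
qed

section \<open>Arithmetic in a principal ideal domain\<close>

lemma (in cring) idealI':
  assumes "I \<subseteq> carrier R" "\<zero> \<in> I" "\<And>a b. \<lbrakk>a \<in> I; b \<in> I\<rbrakk> \<Longrightarrow> a \<oplus> b \<in> I"
    and "\<And>r a. \<lbrakk>r \<in> carrier R; a \<in> I\<rbrakk> \<Longrightarrow> r \<otimes> a \<in> I"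
  shows "ideal I R"
proof (rule idealI[OF ring_axioms])
  show "subgroup I (add_monoid R)"
  proof (rule add.subgroupI)
    fix a assume a: "a \<in> I"
    then have "\<ominus> a = (\<ominus> \<one>) \<otimes> a" using assms(1) by (simp add: l_minus subset_iff)
    then show "\<ominus> a \<in> I" using assms(4) a by simp
  qed (use assms in auto)
  show "a \<otimes> x \<in> I" if "a \<in> I" "x \<in> carrier R" for a x
    using assms(1,4) that by (metis m_comm subsetD)
qed (use assms in auto)

context principal_domain
begin

lemma prime_divides_mult:
  assumes "q \<in> carrier R" "ring_prime q" "a \<in> carrier R" "b \<in> carrier R" "q divides (a \<otimes> b)"
  shows "q divides a \<or> q divides b"
  using ring_primeE(3)[OF assms(1,2)] assms(3-5) by (auto simp: prime_def)

lemma prime_coprime: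
  assumes q: "q \<in> carrier R" "ring_prime q" and r: "r \<in> carrier R" "\<not> q divides r"
  obtains u v where "u \<in> carrier R" "v \<in> carrier R" "u \<otimes> r \<oplus> v \<otimes> q = \<one>"
proof -
  obtain d where d: "d \<in> carrier R" "PIdl r <+>\<^bsub>R\<^esub> PIdl q = PIdl d"
    using exists_gen[OF add_ideals[OF cgenideal_ideal[OF r(1)] cgenideal_ideal[OF q(1)]]] by blast
  then have g: "d gcdof r q" using ideal_sum_iff_gcd[OF r(1) q(1) d(1)] by simp
  then obtain c where c: "c \<in> carrier R" "q = d \<otimes> c" by (auto simp: isgcd_def factor_def)
  have p: "prime R q" "q \<noteq> \<zero>" using ring_primeE[OF q] by auto
  have "\<not> q divides d" using g r d q by (meson isgcd_def divides_trans)
  moreover have "q divides (d \<otimes> c)" using c q divides_refl by simp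
  ultimately have "q divides c" using prime_divides_mult[OF q d(1) c(1)] by blast
  then obtain e where e: "e \<in> carrier R" "c = q \<otimes> e" by (auto simp: factor_def)
  have "q = d \<otimes> (q \<otimes> e)" by (rule trans[OF c(2)]) (simp only: e(2))
  also have "\<dots> = q \<otimes> (d \<otimes> e)" using d(1) q(1) e(1) by (rule m_lcomm)
  finally have "q \<otimes> \<one> = q \<otimes> (d \<otimes> e)" by (rule trans[OF r_one[OF q(1)]])
  then have "\<one> = d \<otimes> e" using m_lcancel[OF p(2) q(1), of \<one> "d \<otimes> e"] d(1) e(1) by simp
  then have "\<one> = e \<otimes> d" using m_comm[OF d(1) e(1)] by (rule trans)
  then have "\<one> \<in> PIdl d" using e(1) unfolding cgenideal_def by blast
  then have "\<one> \<in> PIdl r <+>\<^bsub>R\<^esub> PIdl q" unfolding d(2) .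
  then show ?thesis using that by (auto simp: set_add_def' cgenideal_def)
qed

lemma prime_pow_coprime:
  assumes q: "q \<in> carrier R" "ring_prime q" and r: "r \<in> carrier R" "\<not> q divides r"
  obtains u v where "u \<in> carrier R" "v \<in> carrier R" "u \<otimes> r \<oplus> v \<otimes> q [^] (n::nat) = \<one>"
proof -
  have "\<exists>u \<in> carrier R. \<exists>v \<in> carrier R. u \<otimes> r \<oplus> v \<otimes> q [^] n = \<one>"
  proof (induction n)
    case 0
    show ?case by (intro bexI[of _ \<zero>] bexI[of _ \<one>]) (use r in auto)
  next
    case (Suc n)
    then obtain u v where uv: "u \<in> carrier R" "v \<in> carrier R" "u \<otimes> r \<oplus> v \<otimes> q [^] n = \<one>" by blast
    obtain s t where st: "s \<in> carrier R" "t \<in> carrier R" "s \<otimes> r \<oplus> t \<otimes> q = \<one>"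
      using prime_coprime[OF q r] by blast
    let ?Q = "q [^] n"
    have Q: "?Q \<in> carrier R" using q by simp
    have "\<one> = u \<otimes> r \<oplus> v \<otimes> ?Q \<otimes> (s \<otimes> r \<oplus> t \<otimes> q)" using uv st q Q by simp
    also have "\<dots> = (u \<oplus> v \<otimes> ?Q \<otimes> s) \<otimes> r \<oplus> (v \<otimes> t) \<otimes> (?Q \<otimes> q)"
      using uv(1,2) st(1,2) q(1) r(1) Q by algebra
    finally have "\<one> = (u \<oplus> v \<otimes> ?Q \<otimes> s) \<otimes> r \<oplus> (v \<otimes> t) \<otimes> q [^] Suc n" by simp
    then show ?case
      by (intro bexI[of _ "u \<oplus> v \<otimes> ?Q \<otimes> s"] bexI[of _ "v \<otimes> t"]) (use uv st Q in auto)
  qed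
  then show ?thesis using that by blast
qed

lemma prime_power_nonzero: "q \<in> carrier R \<Longrightarrow> ring_prime q \<Longrightarrow> q [^] (n::nat) \<noteq> \<zero>"
  by (induction n) (auto simp: integral_iff ring_prime_def)

lemma exists_prime_divisor:
  assumes "a \<in> carrier R" "a \<noteq> \<zero>" "a \<notin> Units R"
  obtains q where "q \<in> carrier R" "ring_prime q" "q divides a"
  using exists_irreducible_divisor[of a] assms primeness_condition by blast

lemma extract_prime_power:
  assumes q: "q \<in> carrier R" "ring_prime q" and c: "c \<in> carrier R" "c \<noteq> \<zero>"
  obtains n m where "m \<in> carrier R" "\<not> q divides m" "c = q [^] (n::nat) \<otimes> m"
proof -
  have "\<exists>n::nat. \<exists>m \<in> carrier R. \<not> q divides m \<and> c = q [^] n \<otimes> m"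
    using c
  proof (induction c rule: wf_induct_rule[OF mult_of.division_wellfounded])
    case (1 c)
    show ?case
    proof (cases "q divides c")
      case False
      then show ?thesis using 1(2) by (intro exI[of _ 0] bexI[of _ c]) auto
    next
      case True
      then obtain d where d: "d \<in> carrier R" "c = q \<otimes> d" by (auto simp: factor_def)
      then have d0: "d \<noteq> \<zero>" using 1(3) q by auto
      have "properfactor (mult_of R) d c"
      proof (rule properfactorI)
        show "d divides\<^bsub>mult_of R\<^esub> c" using d q(1) ring_primeE(1)[OF q]
          unfolding factor_def by (intro bexI[of _ q]) (simp_all add: m_comm)
        show "\<not> c divides\<^bsub>mult_of R\<^esub> d"
        proof
          assume "c divides\<^bsub>mult_of R\<^esub> d"
          then obtain e where e: "e \<in> carrier R" "d = c \<otimes> e" by (auto simp: factor_def)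
          have "d = q \<otimes> d \<otimes> e" by (rule trans[OF e(2)]) (simp only: d(2))
          also have "\<dots> = d \<otimes> (q \<otimes> e)" using m_assoc[OF q(1) d(1) e(1)] m_lcomm[OF q(1) d(1) e(1)] by simp
          finally have "d \<otimes> \<one> = d \<otimes> (q \<otimes> e)" by (rule trans[OF r_one[OF d(1)]])
          then have "\<one> = q \<otimes> e" using m_lcancel[OF d0 d(1), of \<one> "q \<otimes> e"] q(1) e(1) by simp
          then have "q \<in> Units R" using e q by (metis divides_one dividesI)
          then show False using ring_primeE(3)[OF q] by (simp add: prime_def)
        qed
      qed
      then have "(d, c) \<in> {(x, y). x \<in> carrier (mult_of R) \<and> y \<in> carrier (mult_of R) \<and> properfactor (mult_of R) x y}"
        using d(1) d0 1(2,3) by simp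
      from 1(1)[OF this d(1) d0]
      obtain n m where "m \<in> carrier R" "\<not> q divides m" "d = q [^] (n::nat) \<otimes> m" by blast
      note m = this
      have "c = q \<otimes> (q [^] n \<otimes> m)" by (rule trans[OF d(2)]) (simp only: m(3))
      also have "\<dots> = q [^] Suc n \<otimes> m" using q(1) m(1) by (simp add: m_ac)
      finally show ?thesis using m(1,2) by blast
    qed
  qed
  then show ?thesis using that by blast
qed

end

section \<open>Finitely generated modules over a principal ideal domain\<close>

lemma (in module) submodule_multiples:
  assumes "x \<in> carrier M" shows "submodule ((\<lambda>r. r \<odot>\<^bsub>M\<^esub> x) ` carrier R) R M"
proof (rule submoduleI')
  show "\<zero>\<^bsub>M\<^esub> \<in> (\<lambda>r. r \<odot>\<^bsub>M\<^esub> x) ` carrier R" using assms by (metis R.zero_closed imageI smult_l_null)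
qed (use assms in \<open>auto simp: smult_l_distr[symmetric] smult_assoc1[symmetric]\<close>)

lemma generated_submodule_singleton:
  fixes M :: "('a, 'c) module"
  assumes "module R M" "x \<in> carrier M"
  shows "generated_submodule R M {x} = (\<lambda>r. r \<odot>\<^bsub>M\<^esub> x) ` carrier R"
proof
  interpret module R M by fact
  have "\<one>\<^bsub>R\<^esub> \<odot>\<^bsub>M\<^esub> x \<in> (\<lambda>r. r \<odot>\<^bsub>M\<^esub> x) ` carrier R" by (rule imageI[OF R.one_closed])
  then have "x \<in> (\<lambda>r. r \<odot>\<^bsub>M\<^esub> x) ` carrier R" using assms(2) by simp
  then show "generated_submodule R M {x} \<subseteq> (\<lambda>r. r \<odot>\<^bsub>M\<^esub> x) ` carrier R"
    unfolding generated_submodule_def using submodule_multiples[OF assms(2)] by blast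
  show "(\<lambda>r. r \<odot>\<^bsub>M\<^esub> x) ` carrier R \<subseteq> generated_submodule R M {x}"
    unfolding generated_submodule_def using submoduleE(4) by auto
qed

locale pid_module = R?: principal_domain R + module R M
  for R :: "('a, 'r) ring_scheme" (structure) and M :: "('a, 'c) module" (structure)
begin

abbreviation module_smult (infixl "*\<^sub>M" 70) where "r *\<^sub>M x \<equiv> r \<odot>\<^bsub>M\<^esub> x"
abbreviation module_add (infixl "+\<^sub>M" 65) where "x +\<^sub>M y \<equiv> x \<oplus>\<^bsub>M\<^esub> y"
abbreviation module_minus (infixl "-\<^sub>M" 65) where "x -\<^sub>M y \<equiv> x \<ominus>\<^bsub>M\<^esub> y"
abbreviation module_zero ("\<zero>\<^sub>M") where "\<zero>\<^sub>M \<equiv> \<zero>\<^bsub>M\<^esub>"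
abbreviation module_set_add (infixl "+\<^sub>S" 65) where "N +\<^sub>S L \<equiv> N <+>\<^bsub>M\<^esub> L"

lemma submoduleD:
  assumes "submodule N R M"
  shows "\<And>x. x \<in> N \<Longrightarrow> x \<in> carrier M" "\<zero>\<^sub>M \<in> N"
    "\<And>x y. \<lbrakk>x \<in> N; y \<in> N\<rbrakk> \<Longrightarrow> x +\<^sub>M y \<in> N"
    "\<And>r x. \<lbrakk>r \<in> carrier R; x \<in> N\<rbrakk> \<Longrightarrow> r *\<^sub>M x \<in> N"
    "\<And>x. x \<in> N \<Longrightarrow> \<ominus>\<^bsub>M\<^esub> x \<in> N"
    "\<And>x y. \<lbrakk>x \<in> N; y \<in> N\<rbrakk> \<Longrightarrow> x -\<^sub>M y \<in> N"
  using submoduleE[OF assms] submodule_zero[OF assms] by (auto simp: a_minus_def)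

lemma add_mem_cancel_left:
  assumes "submodule N R M" "x +\<^sub>M y \<in> N" "x \<in> N" "y \<in> carrier M" shows "y \<in> N"
proof -
  have "\<ominus>\<^bsub>M\<^esub> x +\<^sub>M (x +\<^sub>M y) = y" using assms submoduleD(1)[OF assms(1)] by (simp add: M.r_neg1)
  then show ?thesis using submoduleD[OF assms(1)] assms by metis
qed

lemma add_mem_cancel_right:
  assumes "submodule N R M" "x +\<^sub>M y \<in> N" "y \<in> N" "x \<in> carrier M" shows "x \<in> N"
  using add_mem_cancel_left[OF assms(1), of y x] assms submoduleD(1)[OF assms(1)] by (simp add: M.a_comm)

lemma diff_eqI: "\<lbrakk>a = b +\<^sub>M c; b \<in> carrier M; c \<in> carrier M\<rbrakk> \<Longrightarrow> a -\<^sub>M c = b"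
  by (simp add: a_minus_def M.a_assoc M.r_neg)

lemma diff_add_cancel: "\<lbrakk>a \<in> carrier M; b \<in> carrier M\<rbrakk> \<Longrightarrow> (a -\<^sub>M b) +\<^sub>M b = a"
  by (simp add: a_minus_def M.a_assoc M.l_neg)

lemma smult_diff:
  "\<lbrakk>r \<in> carrier R; x \<in> carrier M; y \<in> carrier M\<rbrakk> \<Longrightarrow> r *\<^sub>M (x -\<^sub>M y) = r *\<^sub>M x -\<^sub>M r *\<^sub>M y"
  by (simp add: a_minus_def smult_r_distr smult_r_minus)

lemma mem_set_add: "z \<in> N +\<^sub>S L \<longleftrightarrow> (\<exists>x \<in> N. \<exists>y \<in> L. z = x +\<^sub>M y)"
  by (auto simp: set_add_def')

lemma submodule_set_add:
  assumes "submodule N R M" "submodule L R M" shows "submodule (N +\<^sub>S L) R M"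
proof (rule submoduleI')
  note N = submoduleD[OF assms(1)] and L = submoduleD[OF assms(2)]
  show "N +\<^sub>S L \<subseteq> carrier M" using N L by (auto simp: mem_set_add)
  show "\<zero>\<^sub>M \<in> N +\<^sub>S L" using N(2) L(2) by (auto simp: mem_set_add intro!: bexI[of _ "\<zero>\<^sub>M"])
next
  note N = submoduleD[OF assms(1)] and L = submoduleD[OF assms(2)]
  fix a b assume "a \<in> N +\<^sub>S L" "b \<in> N +\<^sub>S L"
  then obtain x y x' y' where *: "x \<in> N" "y \<in> L" "x' \<in> N" "y' \<in> L" "a = x +\<^sub>M y" "b = x' +\<^sub>M y'"
    by (auto simp: mem_set_add)
  then have "a +\<^sub>M b = (x +\<^sub>M x') +\<^sub>M (y +\<^sub>M y')" using N(1) L(1) by (simp add: M.a_ac)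
  then show "a +\<^sub>M b \<in> N +\<^sub>S L" using * N(3) L(3) unfolding mem_set_add by blast
next
  note N = submoduleD[OF assms(1)] and L = submoduleD[OF assms(2)]
  fix r x assume "r \<in> carrier R" "x \<in> N +\<^sub>S L"
  then show "r *\<^sub>M x \<in> N +\<^sub>S L"
    using N(1,4) L(1,4) by (auto simp: mem_set_add smult_r_distr) (metis smult_r_distr)
qed

lemma set_add_upper:
  assumes "submodule N R M" "submodule L R M"
  shows "N \<subseteq> N +\<^sub>S L" "L \<subseteq> N +\<^sub>S L"
  using submoduleD[OF assms(1)] submoduleD[OF assms(2)] unfolding subset_iff mem_set_add
  by (metis M.r_zero, metis M.l_zero)

lemma set_add_least:
  assumes "submodule K R M" "N \<subseteq> K" "L \<subseteq> K" shows "N +\<^sub>S L \<subseteq> K"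
  using submoduleD(3)[OF assms(1)] assms(2,3) by (force simp: mem_set_add)

definition cyc :: "'c \<Rightarrow> 'c set" where "cyc x = (\<lambda>r. r *\<^sub>M x) ` carrier R"

lemma submodule_cyc: "x \<in> carrier M \<Longrightarrow> submodule (cyc x) R M"
  unfolding cyc_def by (rule submodule_multiples)

lemma cyc_self: "x \<in> carrier M \<Longrightarrow> x \<in> cyc x"
  unfolding cyc_def by (metis R.one_closed imageI smult_one)

lemma cyc_least: "submodule K R M \<Longrightarrow> x \<in> K \<Longrightarrow> cyc x \<subseteq> K"
  using submoduleD(4) by (auto simp: cyc_def)

lemma submodule_zero_set: "submodule {\<zero>\<^sub>M} R M"
  by (rule submoduleI') auto

lemma submodule_Int: "submodule N R M \<Longrightarrow> submodule L R M \<Longrightarrow> submodule (N \<inter> L) R M"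
  by (rule submoduleI') (auto dest: submoduleD)

lemma submodule_image_smult:
  assumes "submodule N R M" "r \<in> carrier R" shows "submodule ((\<lambda>x. r *\<^sub>M x) ` N) R M"
proof (rule submoduleI')
  note N = submoduleD[OF assms(1)]
  show "\<zero>\<^sub>M \<in> (\<lambda>x. r *\<^sub>M x) ` N" using N(2) assms(2) by (metis image_eqI smult_r_null)
  show "s *\<^sub>M a \<in> (\<lambda>x. r *\<^sub>M x) ` N" if s: "s \<in> carrier R" and a: "a \<in> (\<lambda>x. r *\<^sub>M x) ` N" for s a
  proof -
    obtain x where x: "x \<in> N" "a = r *\<^sub>M x" using a by blast
    then have "s *\<^sub>M a = r *\<^sub>M (s *\<^sub>M x)"
      using s assms(2) N(1) by (simp add: smult_assoc1[symmetric] R.m_comm)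
    then show ?thesis using x N(4) s by blast
  qed
qed (use submoduleD[OF assms(1)] assms(2) in \<open>auto simp: smult_r_distr[symmetric]\<close>)

lemma submodule_generated: "S \<subseteq> carrier M \<Longrightarrow> submodule (generated_submodule R M S) R M"
  unfolding generated_submodule_def using carrier_is_submodule
  by (intro submoduleI') (auto dest: submoduleD(1,2,4) intro: submoduleD(3))

lemma generated_least: "submodule N R M \<Longrightarrow> S \<subseteq> N \<Longrightarrow> generated_submodule R M S \<subseteq> N"
  by (auto simp: generated_submodule_def)

lemma generated_self: "S \<subseteq> generated_submodule R M S"
  by (auto simp: generated_submodule_def)

text \<open>
  Finite generation of a submodule, expressed by the submodules of \<open>M\<close> alone: the module
  structure on \<open>N\<close> is not mentioned.
\<close>

definition fin_gen :: "'c set \<Rightarrow> bool" where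
  "fin_gen N \<longleftrightarrow> (\<exists>S. finite S \<and> S \<subseteq> N \<and> (\<forall>L. submodule L R M \<longrightarrow> S \<subseteq> L \<longrightarrow> N \<subseteq> L))"

text \<open>
  Induction on the number of generators. The coefficients of the new generator \<open>x\<close> in the elements of
  \<open>N\<close> form an ideal. An element of \<open>N\<close> in which \<open>x\<close> has a generator of this ideal as its coefficient,
  together with generators of the elements of \<open>N\<close> that do not involve \<open>x\<close>, generates \<open>N\<close>.
\<close>

lemma fin_gen_submodule_of_generated:
  assumes "finite S" "S \<subseteq> carrier M" "submodule N R M" "N \<subseteq> generated_submodule R M S"
  shows "fin_gen N"
  using assms
proof (induction S arbitrary: N rule: finite_induct)
  case empty
  then have "N \<subseteq> {\<zero>\<^sub>M}" using generated_least[OF submodule_zero_set, of "{}"] by blast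
  then show ?case unfolding fin_gen_def by (intro exI[of _ "{}"]) (auto dest: submoduleD)
next
  case (insert x S)
  let ?G = "generated_submodule R M S"
  have x: "x \<in> carrier M" and S: "S \<subseteq> carrier M" using insert.prems by auto
  note G = submodule_generated[OF S] and N = insert.prems(2)
  have "generated_submodule R M (insert x S) \<subseteq> cyc x +\<^sub>S ?G"
    using set_add_upper[OF submodule_cyc[OF x] G] cyc_self[OF x] generated_self[of S]
    by (intro generated_least submodule_set_add submodule_cyc G x) auto
  then have dec: "\<exists>r \<in> carrier R. \<exists>y \<in> ?G. z = r *\<^sub>M x +\<^sub>M y" if "z \<in> N" for z
    using that insert.prems(3) by (auto simp: mem_set_add cyc_def subset_iff)
  define I where "I = {r \<in> carrier R. \<exists>y \<in> ?G. r *\<^sub>M x +\<^sub>M y \<in> N}"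
  note Gd = submoduleD[OF G] and Nd = submoduleD[OF N]
  have "ideal I R"
  proof (rule idealI')
    show "\<zero> \<in> I" using x Gd(2) Nd(2) by (auto simp: I_def intro!: bexI[of _ "\<zero>\<^sub>M"])
    fix a b assume "a \<in> I" "b \<in> I"
    then obtain y z where *: "a \<in> carrier R" "b \<in> carrier R" "y \<in> ?G" "z \<in> ?G"
      "a *\<^sub>M x +\<^sub>M y \<in> N" "b *\<^sub>M x +\<^sub>M z \<in> N" by (auto simp: I_def)
    have "(a \<oplus> b) *\<^sub>M x +\<^sub>M (y +\<^sub>M z) = (a *\<^sub>M x +\<^sub>M y) +\<^sub>M (b *\<^sub>M x +\<^sub>M z)"
      using * x Gd(1) by (simp add: smult_l_distr M.a_ac)
    then have "(a \<oplus> b) *\<^sub>M x +\<^sub>M (y +\<^sub>M z) \<in> N" using Nd(3)[OF *(5,6)] by simp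
    then show "a \<oplus> b \<in> I" using *(1,2) Gd(3)[OF *(3,4)] unfolding I_def by blast
  next
    fix r a assume r: "r \<in> carrier R" and "a \<in> I"
    then obtain y where *: "a \<in> carrier R" "y \<in> ?G" "a *\<^sub>M x +\<^sub>M y \<in> N" by (auto simp: I_def)
    have "(r \<otimes> a) *\<^sub>M x +\<^sub>M r *\<^sub>M y = r *\<^sub>M (a *\<^sub>M x +\<^sub>M y)"
      using * r x Gd(1) by (simp add: smult_assoc1 smult_r_distr)
    then have "(r \<otimes> a) *\<^sub>M x +\<^sub>M r *\<^sub>M y \<in> N" using Nd(4)[OF r *(3)] by simp
    then show "r \<otimes> a \<in> I" using *(1) r Gd(4)[OF r *(2)] unfolding I_def by blast
  qed (auto simp: I_def)
  then obtain d where d: "d \<in> carrier R" "I = PIdl d" using exists_gen by blast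
  then have "d \<in> I" using cgenideal_self by simp
  then obtain y0 where y0: "y0 \<in> ?G" "d *\<^sub>M x +\<^sub>M y0 \<in> N" by (auto simp: I_def)
  have "fin_gen (N \<inter> ?G)" using insert.IH[OF S submodule_Int[OF N G]] by blast
  then obtain T where T: "finite T" "T \<subseteq> N \<inter> ?G" "\<And>L. submodule L R M \<Longrightarrow> T \<subseteq> L \<Longrightarrow> N \<inter> ?G \<subseteq> L"
    unfolding fin_gen_def by blast
  let ?n = "d *\<^sub>M x +\<^sub>M y0"
  show ?case unfolding fin_gen_def
  proof (intro exI[of _ "insert ?n T"] conjI allI impI subsetI)
    fix L z assume L: "submodule L R M" and sub: "insert ?n T \<subseteq> L" and z: "z \<in> N"
    obtain r y where ry: "r \<in> carrier R" "y \<in> ?G" "z = r *\<^sub>M x +\<^sub>M y" using dec[OF z] by blast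
    then have "r \<in> I" using z by (auto simp: I_def)
    then obtain t where t: "t \<in> carrier R" "r = t \<otimes> d" using d by (auto simp: cgenideal_def)
    let ?w = "y -\<^sub>M t *\<^sub>M y0"
    have y: "y \<in> carrier M" "y0 \<in> carrier M" using ry y0 Gd(1) by auto
    have eq: "z = t *\<^sub>M ?n +\<^sub>M ?w"
    proof -
      have "t *\<^sub>M ?n +\<^sub>M ?w = r *\<^sub>M x +\<^sub>M (?w +\<^sub>M t *\<^sub>M y0)"
        using t d x y by (simp add: smult_r_distr smult_assoc1 M.a_ac)
      also have "?w +\<^sub>M t *\<^sub>M y0 = y" using diff_add_cancel t y by simp
      finally show ?thesis using ry(3) by simp
    qed
    have "?w \<in> ?G" using ry y0 Gd(4,6) t by blast
    moreover have "?w \<in> N"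
      using add_mem_cancel_left[OF N, of "t *\<^sub>M ?n" ?w] z y0(2) Nd(4) t y eq by auto
    ultimately have "?w \<in> L" using T(3)[OF L] sub by blast
    then show "z \<in> L" unfolding eq using submoduleD[OF L] sub t by auto
  qed (use T y0 in auto)
qed

end

locale fg_pid_module = pid_module +
  assumes fin_gen_carrier: "finitely_generated R M"
begin

lemma fin_gen: assumes "submodule N R M" shows "fin_gen N"
proof -
  obtain S where "finite S" "S \<subseteq> carrier M" "generated_submodule R M S = carrier M"
    using fin_gen_carrier unfolding finitely_generated_def by blast
  then show ?thesis using fin_gen_submodule_of_generated[of S N] assms submoduleD(1)[OF assms] by blast
qed

lemma submodule_Union_chain:
  assumes "\<C> \<noteq> {}" "subset.chain \<F> \<C>" "\<And>N. N \<in> \<F> \<Longrightarrow> submodule N R M"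
  shows "submodule (\<Union>\<C>) R M"
proof (rule submoduleI')
  have C: "submodule N R M" if "N \<in> \<C>" for N using that assms(2,3) by (auto simp: subset.chain_def)
  show "\<Union>\<C> \<subseteq> carrier M" using C submoduleD(1) by blast
  show "\<zero>\<^sub>M \<in> \<Union>\<C>" using C submoduleD(2) assms(1) by blast
  show "r *\<^sub>M x \<in> \<Union>\<C>" if "r \<in> carrier R" "x \<in> \<Union>\<C>" for r x using C submoduleD(4) that by blast
  show "x +\<^sub>M y \<in> \<Union>\<C>" if xy: "x \<in> \<Union>\<C>" "y \<in> \<Union>\<C>" for x y
  proof -
    obtain N L where NL: "N \<in> \<C>" "L \<in> \<C>" "x \<in> N" "y \<in> L" using xy by blast
    then have "N \<subseteq> L \<or> L \<subseteq> N" using assms(2) by (auto simp: subset.chain_def)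
    then show ?thesis using NL C submoduleD(3) by blast
  qed
qed

text \<open>
  The union of a chain of submodules is finitely generated and hence a member of the chain, so that
  Zorn's lemma applies to every family of submodules.
\<close>

lemma maximal_submodule:
  assumes "\<F> \<noteq> {}" "\<And>N. N \<in> \<F> \<Longrightarrow> submodule N R M"
  obtains N where "N \<in> \<F>" "\<And>L. \<lbrakk>L \<in> \<F>; N \<subseteq> L\<rbrakk> \<Longrightarrow> L = N"
proof -
  have "\<exists>N \<in> \<F>. \<forall>L \<in> \<F>. N \<subseteq> L \<longrightarrow> L = N"
  proof (rule subset_Zorn_nonempty[OF assms(1)])
    fix \<C> assume C: "\<C> \<noteq> {}" "subset.chain \<F> \<C>"
    note U = submodule_Union_chain[OF C assms(2)]
    obtain S where S: "finite S" "S \<subseteq> \<Union>\<C>" "\<And>L. submodule L R M \<Longrightarrow> S \<subseteq> L \<Longrightarrow> \<Union>\<C> \<subseteq> L"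
      using fin_gen[OF U] unfolding fin_gen_def by blast
    then obtain N where N: "N \<in> \<C>" "S \<subseteq> N"
      using finite_subset_Union_chain[of S \<C> \<F>] C by blast
    then have "N \<in> \<F>" using C by (auto simp: subset.chain_def)
    then have "\<Union>\<C> = N" using S(3)[OF assms(2) N(2)] N(1) by blast
    then show "\<Union>\<C> \<in> \<F>" using \<open>N \<in> \<F>\<close> by simp
  qed
  then show ?thesis using that by blast
qed

end

section \<open>Complements of cyclic submodules\<close>

context principal_domain begin

lemma prime_power_dichotomy:
  assumes q: "q \<in> carrier R" "ring_prime q" and s: "s \<in> carrier R"
  shows "q [^] (n::nat) divides s \<or> (\<exists>i<n. \<exists>t \<in> carrier R. s = q [^] i \<otimes> t \<and> \<not> q divides t)"
proof (induction n)
  case 0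
  then show ?case using s by (simp add: one_divides)
next
  case (Suc n)
  then consider "\<exists>i<n. \<exists>t \<in> carrier R. s = q [^] i \<otimes> t \<and> \<not> q divides t"
    | "q [^] n divides s" by blast
  then show ?case
  proof cases
    case 1 then show ?thesis using less_Suc_eq by blast
  next
    case 2
    then obtain t where t: "t \<in> carrier R" "s = q [^] n \<otimes> t" by (auto simp: factor_def)
    show ?thesis
    proof (cases "q divides t")
      case True
      then obtain t' where "t' \<in> carrier R" "t = q \<otimes> t'" by (auto simp: factor_def)
      then have "q [^] Suc n divides s" using t q by (auto simp: factor_def m_assoc)
      then show ?thesis by blast
    qed (use t in blast)
  qed
qed

lemma prime_not_divides_one: "q \<in> carrier R \<Longrightarrow> ring_prime q \<Longrightarrow> \<not> q divides \<one>"
  using ring_primeE(3)[of q] by (simp add: divides_one prime_def)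

end

context pid_module
begin

abbreviation scaled :: "'a \<Rightarrow> 'c set \<Rightarrow> 'c set" where
  "scaled r N \<equiv> (\<lambda>x. r *\<^sub>M x) ` N"

text \<open>An \<open>r\<close> not divisible by \<open>q\<close> acts invertibly on what \<open>q\<close> annihilates, here on elements modulo \<open>N\<close>.\<close>

lemma prime_combination:
  assumes q: "q \<in> carrier R" "ring_prime q" and r: "r \<in> carrier R" "\<not> q divides r"
    and N: "submodule N R M" and z: "z \<in> carrier M" "q *\<^sub>M z \<in> N" "r *\<^sub>M z \<in> N"
  shows "z \<in> N"
proof -
  obtain u v where uv: "u \<in> carrier R" "v \<in> carrier R" "u \<otimes> r \<oplus> v \<otimes> q = \<one>"
    using prime_coprime[OF q r] by blast
  have "z = (u \<otimes> r \<oplus> v \<otimes> q) *\<^sub>M z" using uv z by simp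
  also have "\<dots> = u *\<^sub>M (r *\<^sub>M z) +\<^sub>M v *\<^sub>M (q *\<^sub>M z)"
    using uv(1,2) q r z(1) by (simp add: smult_l_distr smult_assoc1)
  finally have z_eq: "z = \<dots>" .
  show ?thesis by (subst z_eq) (use submoduleD(3,4)[OF N] uv z in blast)
qed

lemma smult_commute:
  "\<lbrakk>r \<in> carrier R; s \<in> carrier R; x \<in> carrier M\<rbrakk> \<Longrightarrow> r *\<^sub>M (s *\<^sub>M x) = s *\<^sub>M (r *\<^sub>M x)"
  by (simp flip: smult_assoc1 add: R.m_comm)

text \<open>
  Every nonzero submodule of the cyclic module generated by \<open>x\<close> contains its socle element \<open>q\<^sup>e x\<close>, so
  avoiding this single element keeps \<open>N\<close> from meeting the cyclic module.
\<close>

lemma multiple_in_imp_divides: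
  assumes q: "q \<in> carrier R" "ring_prime q" and x: "x \<in> carrier M" "q [^] Suc e *\<^sub>M x = \<zero>\<^sub>M"
    and N: "submodule N R M" "q [^] e *\<^sub>M x \<notin> N"
    and r: "r \<in> carrier R" "r *\<^sub>M x \<in> N"
  shows "q [^] Suc e divides r"
proof (rule ccontr)
  assume "\<not> q [^] Suc e divides r"
  then obtain i t where t: "i < Suc e" "t \<in> carrier R" "r = q [^] i \<otimes> t" "\<not> q divides t"
    using prime_power_dichotomy[OF q r(1), of "Suc e"] by blast
  have "t *\<^sub>M (q [^] e *\<^sub>M x) = q [^] (e - i) *\<^sub>M (r *\<^sub>M x)"
  proof -
    have "q [^] (e - i) \<otimes> q [^] i = q [^] e" using t(1) q by (simp add: nat_pow_mult)
    then have "q [^] (e - i) \<otimes> (q [^] i \<otimes> t) = q [^] e \<otimes> t"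
      using q(1) t(2) R.m_assoc[of "q [^] (e - i)" "q [^] i" t] by simp
    also have "\<dots> = t \<otimes> q [^] e" using q(1) t(2) by (simp add: R.m_comm)
    finally have "q [^] (e - i) \<otimes> (q [^] i \<otimes> t) = t \<otimes> q [^] e" .
    then show ?thesis using q t x by (simp flip: smult_assoc1)
  qed
  then have "t *\<^sub>M (q [^] e *\<^sub>M x) \<in> N" using submoduleD(4)[OF N(1)] r q by simp
  moreover have "q *\<^sub>M (q [^] e *\<^sub>M x) = \<zero>\<^sub>M"
    using x q by (simp flip: smult_assoc1 add: R.m_comm)
  then have "q *\<^sub>M (q [^] e *\<^sub>M x) \<in> N" using submoduleD(2)[OF N(1)] by simp
  ultimately have "q [^] e *\<^sub>M x \<in> N" using prime_combination[OF q t(2,4) N(1)] x q by simp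
  with N(2) show False by blast
qed

end

context fg_pid_module
begin

text \<open>
  This is where summands come from. A submodule \<open>C \<supseteq> C0\<close> of \<open>D\<close> maximal among those that avoid the
  socle element \<open>q\<^sup>e x\<close> of the cyclic module generated by \<open>x\<close> is a complement of that cyclic module,
  because \<open>D / C\<close> is annihilated by \<open>q\<^sup>e\<^sup>+\<^sup>1\<close>. The freedom in \<open>C0\<close> lets complements contain
  prescribed submodules.
\<close>

lemma split_cyclic:
  assumes D: "submodule D R M" and C0: "submodule C0 R M" "C0 \<subseteq> D"
    and q: "q \<in> carrier R" "ring_prime q" and x: "x \<in> D" "q [^] Suc e *\<^sub>M x = \<zero>\<^sub>M"
    and bound: "scaled (q [^] Suc e) D \<subseteq> C0" and socle: "q [^] e *\<^sub>M x \<notin> C0"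
  obtains C where "submodule C R M" "C0 \<subseteq> C" "C \<subseteq> D" "D = cyc x +\<^sub>S C"
    "\<And>r. \<lbrakk>r \<in> carrier R; r *\<^sub>M x \<in> C\<rbrakk> \<Longrightarrow> q [^] Suc e divides r"
proof -
  let ?F = "{C. submodule C R M \<and> C0 \<subseteq> C \<and> C \<subseteq> D \<and> q [^] e *\<^sub>M x \<notin> C}"
  have "?F \<noteq> {}" using C0 socle by blast
  then obtain C where CF: "C \<in> ?F" and max: "\<And>L. L \<in> ?F \<Longrightarrow> C \<subseteq> L \<Longrightarrow> L = C"
    using maximal_submodule[of ?F] by blast
  then have C: "submodule C R M" "C0 \<subseteq> C" "C \<subseteq> D" "q [^] e *\<^sub>M x \<notin> C" by auto
  have xc: "x \<in> carrier M" using submoduleD(1)[OF D x(1)] .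
  have divs: "q [^] Suc e divides r" if "r \<in> carrier R" "r *\<^sub>M x \<in> C" for r
    by (rule multiple_in_imp_divides[OF q xc x(2) C(1,4) that])
  let ?K = "cyc x +\<^sub>S C"
  have K: "submodule ?K R M" using submodule_set_add submodule_cyc xc C by blast
  have KD: "?K \<subseteq> D" using set_add_least[OF D cyc_least[OF D x(1)] C(3)] .
  have up: "cyc x \<subseteq> ?K" "C \<subseteq> ?K" using set_add_upper[OF submodule_cyc[OF xc] C(1)] .
  \<comment> \<open>An element outside \<open>?K\<close> whose \<open>q\<close>-multiple lies in \<open>?K\<close> can be changed by a multiple of
     \<open>x\<close> so that its \<open>q\<close>-multiple lies in \<open>C\<close>; adjoining it to \<open>C\<close> would not bring in the socle.\<close>
  have step: "y \<in> ?K" if y: "y \<in> D" "q *\<^sub>M y \<in> ?K" for y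
  proof (rule ccontr)
    assume "y \<notin> ?K"
    have yc: "y \<in> carrier M" using submoduleD(1)[OF D y(1)] .
    obtain r z where rz: "r \<in> carrier R" "z \<in> C" "q *\<^sub>M y = r *\<^sub>M x +\<^sub>M z"
      using y(2) by (auto simp: mem_set_add cyc_def)
    have zc: "z \<in> carrier M" using submoduleD(1)[OF C(1) rz(2)] .
    have "q [^] Suc e *\<^sub>M y \<in> C" using bound y C by auto
    also have "q [^] Suc e *\<^sub>M y = q [^] e *\<^sub>M (q *\<^sub>M y)" using q yc by (simp add: smult_assoc1)
    also have "\<dots> = (q [^] e \<otimes> r) *\<^sub>M x +\<^sub>M q [^] e *\<^sub>M z"
      using q rz xc zc by (simp add: smult_r_distr smult_assoc1)
    finally have "(q [^] e \<otimes> r) *\<^sub>M x \<in> C"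
      using add_mem_cancel_right[OF C(1)] submoduleD(4)[OF C(1) _ rz(2)] q rz xc by simp
    then have "q [^] Suc e divides (q [^] e \<otimes> r)" using divs q rz by simp
    then have "(q [^] e \<otimes> q) divides (q [^] e \<otimes> r)" by simp
    then have "q divides r" using mult_divides[OF q(1) rz(1), of "q [^] e"] q prime_power_nonzero by simp
    then obtain r' where r': "r' \<in> carrier R" "r = q \<otimes> r'" by (auto simp: factor_def)
    define y' where "y' = y -\<^sub>M r' *\<^sub>M x"
    have y'c: "y' \<in> carrier M" using yc xc r' by (simp add: y'_def)
    have yy': "y = y' +\<^sub>M r' *\<^sub>M x" using diff_add_cancel yc xc r' by (simp add: y'_def)
    have qy': "q *\<^sub>M y' = z"
      unfolding y'_def using q yc xc r' rz zc
      by (simp add: smult_diff smult_assoc1[symmetric]) (rule diff_eqI, auto simp: M.a_comm)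
    have y'K: "y' \<notin> ?K"
      using \<open>y \<notin> ?K\<close> yy' submoduleD(3)[OF K] up(1) r' by (auto simp: cyc_def image_subset_iff)
    have y'D: "y' \<in> D" using submoduleD(4,6)[OF D] y(1) x(1) r' by (simp add: y'_def)
    let ?L = "cyc y' +\<^sub>S C"
    have L: "submodule ?L R M" using submodule_set_add submodule_cyc y'c C by blast
    have Lup: "cyc y' \<subseteq> ?L" "C \<subseteq> ?L" using set_add_upper[OF submodule_cyc[OF y'c] C(1)] .
    have "y' \<in> ?L" using Lup cyc_self[OF y'c] by blast
    moreover have "y' \<notin> C" using y'K up by blast
    ultimately have "?L \<noteq> C" by blast
    moreover have "?L \<subseteq> D" by (rule set_add_least[OF D cyc_least[OF D y'D] C(3)])
    ultimately have "q [^] e *\<^sub>M x \<in> ?L" using max[of ?L] L Lup C by blast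
    then obtain s c where sc: "s \<in> carrier R" "c \<in> C" "q [^] e *\<^sub>M x = s *\<^sub>M y' +\<^sub>M c"
      by (auto simp: mem_set_add cyc_def)
    have "q [^] e *\<^sub>M x \<in> ?K" using up(1) q by (auto simp: cyc_def)
    then have sK: "s *\<^sub>M y' \<in> ?K"
      using add_mem_cancel_right[OF K, of "s *\<^sub>M y'" c] sc up y'c by auto
    have "q *\<^sub>M y' \<in> ?K" using qy' rz up by auto
    then have "q divides s" using prime_combination[OF q sc(1) _ K y'c _ sK] y'K by blast
    then obtain s' where s': "s' \<in> carrier R" "s = q \<otimes> s'" by (auto simp: factor_def)
    then have "s *\<^sub>M y' = s' *\<^sub>M z" using qy' q y'c by (simp add: smult_assoc1 smult_commute[of q s'])
    then have "s *\<^sub>M y' \<in> C" using submoduleD(4)[OF C(1)] s' rz by simp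
    then show False using sc submoduleD(3)[OF C(1)] C(4) by simp
  qed
  have reduce: "y \<in> ?K" if "y \<in> D" "q [^] n *\<^sub>M y \<in> ?K" for n :: nat and y
    using that
  proof (induction n arbitrary: y)
    case 0 then show ?case using submoduleD(1)[OF D] by simp
  next
    case (Suc n)
    have "q [^] n *\<^sub>M (q *\<^sub>M y) \<in> ?K"
      using Suc.prems q submoduleD(1)[OF D] by (simp add: smult_assoc1)
    then have "q *\<^sub>M y \<in> ?K" using Suc.IH submoduleD(4)[OF D] Suc.prems q by simp
    then show ?case using step Suc.prems by blast
  qed
  have "D \<subseteq> ?K"
  proof
    fix y assume y: "y \<in> D"
    then have "q [^] Suc e *\<^sub>M y \<in> ?K" using bound C(2) up(2) by blast
    then show "y \<in> ?K" using reduce[OF y] by blast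
  qed
  with that[OF C(1-3) _ divs] KD show ?thesis by blast
qed

text \<open>The product of denominators for finitely many generators of \<open>D\<close> serves all elements.\<close>

lemma common_denominator:
  assumes D: "submodule D R M" and N: "submodule N R M"
    and ex: "\<And>y. y \<in> D \<Longrightarrow> \<exists>c \<in> carrier R. c \<noteq> \<zero> \<and> c *\<^sub>M y \<in> N"
  obtains c where "c \<in> carrier R" "c \<noteq> \<zero>" "\<And>y. y \<in> D \<Longrightarrow> c *\<^sub>M y \<in> N"
proof -
  obtain S where S: "finite S" "S \<subseteq> D" "\<And>L. submodule L R M \<Longrightarrow> S \<subseteq> L \<Longrightarrow> D \<subseteq> L"
    using fin_gen[OF D] unfolding fin_gen_def by blast
  have "\<exists>c \<in> carrier R. c \<noteq> \<zero> \<and> (\<forall>y \<in> S. c *\<^sub>M y \<in> N)"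
    using S(1,2)
  proof (induction S rule: finite_induct)
    case empty
    then show ?case by (intro bexI[of _ \<one>]) auto
  next
    case (insert x S)
    then obtain c where c: "c \<in> carrier R" "c \<noteq> \<zero>" "\<forall>y \<in> S. c *\<^sub>M y \<in> N" by auto
    obtain d where d: "d \<in> carrier R" "d \<noteq> \<zero>" "d *\<^sub>M x \<in> N" using ex insert.prems by blast
    have "(c \<otimes> d) *\<^sub>M y \<in> N" if "y \<in> insert x S" for y
    proof (cases "y = x")
      case True
      then show ?thesis using c d submoduleD(1)[OF D] submoduleD(4)[OF N] insert.prems by (simp add: smult_assoc1)
    next
      case False
      then have y: "y \<in> S" "y \<in> carrier M" using that insert.prems submoduleD(1)[OF D] by auto
      have "(c \<otimes> d) *\<^sub>M y = d *\<^sub>M (c *\<^sub>M y)" using c d y by (simp add: smult_assoc1 smult_commute[of c d])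
      then show ?thesis using c d y submoduleD(4)[OF N] by simp
    qed
    then show ?case using c d by (intro bexI[of _ "c \<otimes> d"]) (auto simp: integral_iff)
  qed
  then obtain c where c: "c \<in> carrier R" "c \<noteq> \<zero>" "\<forall>y \<in> S. c *\<^sub>M y \<in> N" by blast
  have "submodule {y \<in> D. c *\<^sub>M y \<in> N} R M"
  proof (rule submoduleI')
    fix r x assume r: "r \<in> carrier R" and x: "x \<in> {y \<in> D. c *\<^sub>M y \<in> N}"
    then have "c *\<^sub>M (r *\<^sub>M x) = r *\<^sub>M (c *\<^sub>M x)"
      using c submoduleD(1)[OF D] by (simp flip: smult_assoc1 add: R.m_comm)
    then show "r *\<^sub>M x \<in> {y \<in> D. c *\<^sub>M y \<in> N}" using submoduleD(4)[OF D] submoduleD(4)[OF N] r x by simp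
  qed (use c submoduleD(1-3)[OF D] submoduleD(2,3)[OF N] in \<open>auto simp: smult_r_distr\<close>)
  then have "D \<subseteq> {y \<in> D. c *\<^sub>M y \<in> N}" using S(2,3) c by blast
  then show ?thesis using that c by blast
qed

text \<open>
  Let \<open>N \<subseteq> D\<close> be maximal such that \<open>D / N\<close> has an element \<open>x\<close> that is not torsion. Then all elements of
  \<open>D / N\<close> have nonzero multiples in the span of \<open>x\<close>, and a common denominator \<open>c\<close> provides a nonzero
  homomorphism from \<open>D\<close> to \<open>R\<close>. Its image is a principal ideal and thus free, whence it splits.
\<close>

lemma split_free:
  assumes D: "submodule D R M" and w: "w \<in> D" "\<And>r. \<lbrakk>r \<in> carrier R; r *\<^sub>M w = \<zero>\<^sub>M\<rbrakk> \<Longrightarrow> r = \<zero>"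
  obtains x C where "x \<in> D" "submodule C R M" "C \<subseteq> D" "D = cyc x +\<^sub>S C"
    "\<And>r. \<lbrakk>r \<in> carrier R; r *\<^sub>M x \<in> C\<rbrakk> \<Longrightarrow> r = \<zero>"
    "\<And>r y. \<lbrakk>r \<in> carrier R; r \<noteq> \<zero>; y \<in> D; r *\<^sub>M y = \<zero>\<^sub>M\<rbrakk> \<Longrightarrow> y \<in> C"
proof -
  let ?F = "{N. submodule N R M \<and> N \<subseteq> D \<and> (\<exists>x \<in> D. \<forall>r \<in> carrier R. r *\<^sub>M x \<in> N \<longrightarrow> r = \<zero>)}"
  have "{\<zero>\<^sub>M} \<in> ?F" using submodule_zero_set submoduleD(2)[OF D] w by auto
  then obtain N where NF: "N \<in> ?F" and max: "\<And>L. L \<in> ?F \<Longrightarrow> N \<subseteq> L \<Longrightarrow> L = N"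
    using maximal_submodule[of ?F] by blast
  then obtain x where N: "submodule N R M" "N \<subseteq> D" and x: "x \<in> D" "\<And>r. r \<in> carrier R \<Longrightarrow> r *\<^sub>M x \<in> N \<Longrightarrow> r = \<zero>"
    by blast
  have xc: "x \<in> carrier M" using submoduleD(1)[OF D x(1)] .
  let ?K = "cyc x +\<^sub>S N"
  have K: "submodule ?K R M" using submodule_set_add submodule_cyc xc N by blast
  have up: "cyc x \<subseteq> ?K" "N \<subseteq> ?K" using set_add_upper[OF submodule_cyc[OF xc] N(1)] .
  \<comment> \<open>By maximality every proper enlargement of \<open>N\<close> makes \<open>x\<close> torsion.\<close>
  have denom: "\<exists>c \<in> carrier R. c \<noteq> \<zero> \<and> c *\<^sub>M y \<in> ?K" if y: "y \<in> D" for y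
  proof (cases "y \<in> N")
    case True
    then show ?thesis using up submoduleD(1)[OF N(1)] by (intro bexI[of _ \<one>]) auto
  next
    case False
    have yc: "y \<in> carrier M" using submoduleD(1)[OF D y] .
    let ?L = "cyc y +\<^sub>S N"
    have L: "submodule ?L R M" "cyc y \<subseteq> ?L" "N \<subseteq> ?L" "?L \<subseteq> D"
      using submodule_set_add[OF submodule_cyc[OF yc] N(1)] set_add_upper[OF submodule_cyc[OF yc] N(1)]
        set_add_least[OF D cyc_least[OF D y] N(2)] by auto
    have "?L \<noteq> N" using L False cyc_self[OF yc] by blast
    then have "?L \<notin> ?F" using max L(3) by blast
    then obtain r where r: "r \<in> carrier R" "r *\<^sub>M x \<in> ?L" "r \<noteq> \<zero>" using L x(1) by blast
    then obtain s z where sz: "s \<in> carrier R" "z \<in> N" "r *\<^sub>M x = s *\<^sub>M y +\<^sub>M z"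
      by (auto simp: mem_set_add cyc_def)
    have "s \<noteq> \<zero>"
    proof
      assume "s = \<zero>"
      then have "r *\<^sub>M x \<in> N" using sz yc submoduleD(1)[OF N(1)] by simp
      then show False using x(2) r by blast
    qed
    moreover have "r *\<^sub>M x \<in> ?K" using up r by (auto simp: cyc_def)
    then have "s *\<^sub>M y \<in> ?K" using add_mem_cancel_right[OF K, of "s *\<^sub>M y" z] sz up yc by auto
    ultimately show ?thesis using sz by blast
  qed
  obtain c where c: "c \<in> carrier R" "c \<noteq> \<zero>" "\<And>y. y \<in> D \<Longrightarrow> c *\<^sub>M y \<in> ?K"
    using common_denominator[OF D K denom] by blast
  \<comment> \<open>\<open>I\<close> is the image of the homomorphism \<open>D \<rightarrow> R\<close> with kernel \<open>C\<close> that sends \<open>y\<close> to the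
     coefficient of \<open>x\<close> in \<open>c y\<close> modulo \<open>N\<close>; a preimage of its generator spans the free summand.\<close>
  define I where "I = {r \<in> carrier R. \<exists>y \<in> D. \<exists>z \<in> N. c *\<^sub>M y = r *\<^sub>M x +\<^sub>M z}"
  note Nc = submoduleD(1)[OF N(1)] and Dc = submoduleD(1)[OF D]
  have "ideal I R"
  proof (rule idealI')
    show "\<zero> \<in> I" unfolding I_def using xc c submoduleD(2)[OF N(1)] submoduleD(2)[OF D]
      by (auto intro!: bexI[of _ "\<zero>\<^sub>M"])
    fix a b assume "a \<in> I" "b \<in> I"
    then obtain y z y' z' where *: "a \<in> carrier R" "b \<in> carrier R" "y \<in> D" "y' \<in> D" "z \<in> N" "z' \<in> N"
      "c *\<^sub>M y = a *\<^sub>M x +\<^sub>M z" "c *\<^sub>M y' = b *\<^sub>M x +\<^sub>M z'" unfolding I_def by blast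
    have "c *\<^sub>M (y +\<^sub>M y') = (a \<oplus> b) *\<^sub>M x +\<^sub>M (z +\<^sub>M z')"
      using * xc c(1) Nc Dc by (simp add: smult_l_distr smult_r_distr M.a_ac)
    then show "a \<oplus> b \<in> I" unfolding I_def using * submoduleD(3)[OF N(1)] submoduleD(3)[OF D] by blast
  next
    fix r a assume r: "r \<in> carrier R" and "a \<in> I"
    then obtain y z where *: "a \<in> carrier R" "y \<in> D" "z \<in> N" "c *\<^sub>M y = a *\<^sub>M x +\<^sub>M z" unfolding I_def by blast
    have "c *\<^sub>M (r *\<^sub>M y) = r *\<^sub>M (c *\<^sub>M y)" by (rule smult_commute[OF c(1) r Dc[OF *(2)]])
    also have "\<dots> = (r \<otimes> a) *\<^sub>M x +\<^sub>M r *\<^sub>M z" using r * xc Nc by (simp add: smult_r_distr smult_assoc1)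
    finally show "r \<otimes> a \<in> I" unfolding I_def using r * submoduleD(4)[OF N(1)] submoduleD(4)[OF D] by blast
  qed (auto simp: I_def)
  then obtain g where g: "g \<in> carrier R" "I = PIdl g" using exists_gen by blast
  have "c \<in> I" unfolding I_def using c x(1) xc submoduleD(2)[OF N(1)] by force
  then have g0: "g \<noteq> \<zero>" using g c by (auto simp: cgenideal_def)
  have "g \<in> I" using g cgenideal_self by simp
  then obtain x0 z0 where x0: "x0 \<in> D" "z0 \<in> N" "c *\<^sub>M x0 = g *\<^sub>M x +\<^sub>M z0" unfolding I_def by blast
  define C where "C = {y \<in> D. c *\<^sub>M y \<in> N}"
  have C: "submodule C R M" unfolding C_def
  proof (rule submoduleI')
    fix r x assume r: "r \<in> carrier R" and x: "x \<in> {y \<in> D. c *\<^sub>M y \<in> N}"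
    then have "c *\<^sub>M (r *\<^sub>M x) = r *\<^sub>M (c *\<^sub>M x)"
      using c submoduleD(1)[OF D] by (simp flip: smult_assoc1 add: R.m_comm)
    then show "r *\<^sub>M x \<in> {y \<in> D. c *\<^sub>M y \<in> N}" using submoduleD(4)[OF D] submoduleD(4)[OF N(1)] r x by simp
  qed (use c submoduleD(1-3)[OF D] submoduleD(2,3)[OF N(1)] in \<open>auto simp: smult_r_distr\<close>)
  have x0c: "x0 \<in> carrier M" using Dc[OF x0(1)] .
  show ?thesis
  proof (rule that[OF x0(1) C])
    show CD: "C \<subseteq> D" by (auto simp: C_def)
    show "D = cyc x0 +\<^sub>S C"
    proof
      show "cyc x0 +\<^sub>S C \<subseteq> D" by (rule set_add_least[OF D cyc_least[OF D x0(1)] CD])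
      show "D \<subseteq> cyc x0 +\<^sub>S C"
      proof
        fix y assume y: "y \<in> D"
        obtain r z where rz: "r \<in> carrier R" "z \<in> N" "c *\<^sub>M y = r *\<^sub>M x +\<^sub>M z"
          using c(3)[OF y] by (auto simp: mem_set_add cyc_def)
        then have "r \<in> I" using y unfolding I_def by blast
        then obtain t where t: "t \<in> carrier R" "r = t \<otimes> g" using g by (auto simp: cgenideal_def)
        let ?y = "y -\<^sub>M t *\<^sub>M x0"
        have yc: "y \<in> carrier M" using Dc[OF y] .
        have "c *\<^sub>M ?y = c *\<^sub>M y -\<^sub>M t *\<^sub>M (c *\<^sub>M x0)"
          using c(1) t yc x0c by (simp add: smult_diff) (simp flip: smult_assoc1 add: R.m_comm)
        also have "t *\<^sub>M (c *\<^sub>M x0) = r *\<^sub>M x +\<^sub>M t *\<^sub>M z0"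
          using x0 t g xc Nc by (simp add: smult_r_distr smult_assoc1)
        also have "c *\<^sub>M y -\<^sub>M (r *\<^sub>M x +\<^sub>M t *\<^sub>M z0) = z -\<^sub>M t *\<^sub>M z0"
          using rz t xc Nc[OF rz(2)] Nc[OF x0(2)]
          by (simp add: a_minus_def M.minus_add M.a_ac M.r_neg2 M.r_neg)
        also have "\<dots> \<in> N" using submoduleD(4,6)[OF N(1)] rz x0 t by blast
        finally have "?y \<in> C" using submoduleD(4,6)[OF D] y x0 t by (simp add: C_def)
        moreover have "y = t *\<^sub>M x0 +\<^sub>M ?y" using diff_add_cancel[OF yc, of "t *\<^sub>M x0"] t x0c yc by (simp add: M.a_comm)
        ultimately show "y \<in> cyc x0 +\<^sub>S C" using t by (auto simp: mem_set_add cyc_def)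
      qed
    qed
    show "s = \<zero>" if s: "s \<in> carrier R" "s *\<^sub>M x0 \<in> C" for s
    proof -
      have "c *\<^sub>M (s *\<^sub>M x0) = s *\<^sub>M (c *\<^sub>M x0)" using s c x0c by (simp flip: smult_assoc1 add: R.m_comm)
      also have "\<dots> = (s \<otimes> g) *\<^sub>M x +\<^sub>M s *\<^sub>M z0"
        using x0 s g xc Nc by (simp add: smult_r_distr smult_assoc1)
      finally have "(s \<otimes> g) *\<^sub>M x +\<^sub>M s *\<^sub>M z0 \<in> N" using s(2) by (simp add: C_def)
      then have "(s \<otimes> g) *\<^sub>M x \<in> N"
        using add_mem_cancel_right[OF N(1)] submoduleD(4)[OF N(1) s(1) x0(2)] s g xc by simp
      then have "s \<otimes> g = \<zero>" using x(2) s g by simp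
      then show ?thesis using s g g0 by (simp add: integral_iff)
    qed
    show "y \<in> C" if y: "r \<in> carrier R" "r \<noteq> \<zero>" "y \<in> D" "r *\<^sub>M y = \<zero>\<^sub>M" for r y
    proof -
      obtain s z where sz: "s \<in> carrier R" "z \<in> N" "c *\<^sub>M y = s *\<^sub>M x +\<^sub>M z"
        using c(3)[OF y(3)] by (auto simp: mem_set_add cyc_def)
      have yc: "y \<in> carrier M" using Dc[OF y(3)] .
      have "r *\<^sub>M (c *\<^sub>M y) = c *\<^sub>M (r *\<^sub>M y)" using y(1) c yc by (simp flip: smult_assoc1 add: R.m_comm)
      then have "(r \<otimes> s) *\<^sub>M x +\<^sub>M r *\<^sub>M z = \<zero>\<^sub>M"
        using sz y c xc Nc by (simp add: smult_r_distr smult_assoc1)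
      then have "(r \<otimes> s) *\<^sub>M x \<in> N"
        using add_mem_cancel_right[OF N(1), of "(r \<otimes> s) *\<^sub>M x" "r *\<^sub>M z"] submoduleD(2)[OF N(1)] submoduleD(4)[OF N(1) y(1) sz(2)] y(1) sz(1) xc by simp
      then have "r \<otimes> s = \<zero>" using x(2) y sz by simp
      then have "s = \<zero>" using y sz by (simp add: integral_iff)
      then show ?thesis using sz xc y Nc by (simp add: C_def)
    qed
  qed
qed

end

section \<open>Standard pairs\<close>

text \<open>
  The pair \<open>(R/d \<oplus> R/e; R (a, b))\<close> up to isomorphism. With \<open>e = 1\<close> the module is cyclic, and \<open>d = 0\<close>
  gives the free module, so that all indecomposable pairs in question are instances.
\<close>

definition presented ::
  "('a, 'r) ring_scheme \<Rightarrow> 'a \<Rightarrow> 'a \<Rightarrow> 'a \<Rightarrow> 'a \<Rightarrow> ('a, 'b) mod_pair \<Rightarrow> bool" where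
  "presented R d e a b U \<longleftrightarrow> module R (fst U) \<and>
     (\<exists>u \<in> carrier (fst U). \<exists>v \<in> carrier (fst U).
        (\<forall>x \<in> carrier (fst U). \<exists>r \<in> carrier R. \<exists>s \<in> carrier R. x = r \<odot>\<^bsub>fst U\<^esub> u \<oplus>\<^bsub>fst U\<^esub> s \<odot>\<^bsub>fst U\<^esub> v) \<and>
        (\<forall>r \<in> carrier R. \<forall>s \<in> carrier R.
           r \<odot>\<^bsub>fst U\<^esub> u \<oplus>\<^bsub>fst U\<^esub> s \<odot>\<^bsub>fst U\<^esub> v = \<zero>\<^bsub>fst U\<^esub> \<longleftrightarrow> d divides\<^bsub>R\<^esub> r \<and> e divides\<^bsub>R\<^esub> s) \<and>
        snd U = (\<lambda>r. r \<odot>\<^bsub>fst U\<^esub> (a \<odot>\<^bsub>fst U\<^esub> u \<oplus>\<^bsub>fst U\<^esub> b \<odot>\<^bsub>fst U\<^esub> v)) ` carrier R)"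

definition presented_free :: "('a, 'r) ring_scheme \<Rightarrow> ('a, 'b) mod_pair \<Rightarrow> bool" where
  "presented_free R U \<longleftrightarrow> presented R \<zero>\<^bsub>R\<^esub> \<one>\<^bsub>R\<^esub> \<zero>\<^bsub>R\<^esub> \<zero>\<^bsub>R\<^esub> U"

definition presented_prime :: "('a, 'r) ring_scheme \<Rightarrow> 'a \<Rightarrow> ('a, 'b) mod_pair \<Rightarrow> bool" where
  "presented_prime R p U \<longleftrightarrow> (\<exists>q (k::nat). q \<in> carrier R \<and> ring_prime\<^bsub>R\<^esub> q \<and> \<not> q divides\<^bsub>R\<^esub> p \<and>
     presented R (q [^]\<^bsub>R\<^esub> Suc k) \<one>\<^bsub>R\<^esub> \<zero>\<^bsub>R\<^esub> \<zero>\<^bsub>R\<^esub> U)"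

definition presented_picket :: "('a, 'r) ring_scheme \<Rightarrow> 'a \<Rightarrow> ('a, 'b) mod_pair \<Rightarrow> bool" where
  "presented_picket R p U \<longleftrightarrow> (\<exists>(l::nat) m. m \<le> 2 \<and> 1 \<le> l \<and> m \<le> l \<and>
     presented R (p [^]\<^bsub>R\<^esub> l) \<one>\<^bsub>R\<^esub> (p [^]\<^bsub>R\<^esub> (l - m)) \<zero>\<^bsub>R\<^esub> U)"

definition presented_bipicket :: "('a, 'r) ring_scheme \<Rightarrow> 'a \<Rightarrow> ('a, 'b) mod_pair \<Rightarrow> bool" where
  "presented_bipicket R p U \<longleftrightarrow> (\<exists>(s::nat) t. 1 \<le> s \<and> s < t - 1 \<and>
     presented R (p [^]\<^bsub>R\<^esub> t) (p [^]\<^bsub>R\<^esub> s) (p [^]\<^bsub>R\<^esub> (t - 2)) (p [^]\<^bsub>R\<^esub> (s - 1)) U)"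

definition standard_pair :: "('a, 'r) ring_scheme \<Rightarrow> 'a \<Rightarrow> ('a, 'b) mod_pair \<Rightarrow> bool" where
  "standard_pair R p U \<longleftrightarrow> presented_free R U \<or> presented_prime R p U \<or>
     presented_picket R p U \<or> presented_bipicket R p U"

context pid_module
begin

abbreviation sub_pair :: "'c set \<Rightarrow> 'c set \<Rightarrow> ('a, 'c) mod_pair" where
  "sub_pair E A \<equiv> (M\<lparr>carrier := E\<rparr>, A)"

definition pair_split :: "'c set \<Rightarrow> 'c set \<Rightarrow> 'c set \<Rightarrow> 'c set \<Rightarrow> 'c set \<Rightarrow> 'c set \<Rightarrow> bool" where
  "pair_split D A E A1 C A2 \<longleftrightarrow>
     submodule E R M \<and> submodule A1 R M \<and> A1 \<subseteq> E \<and> submodule C R M \<and> submodule A2 R M \<and> A2 \<subseteq> C \<and>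
     D = E +\<^sub>S C \<and> A = A1 +\<^sub>S A2 \<and> E \<inter> C = {\<zero>\<^sub>M}"

lemma presented_sub_pairI:
  assumes E: "submodule E R M" "u \<in> E" "v \<in> E"
    and gen: "\<And>x. x \<in> E \<Longrightarrow> \<exists>r \<in> carrier R. \<exists>s \<in> carrier R. x = r *\<^sub>M u +\<^sub>M s *\<^sub>M v"
    and rel: "\<And>r s. \<lbrakk>r \<in> carrier R; s \<in> carrier R\<rbrakk> \<Longrightarrow>
      r *\<^sub>M u +\<^sub>M s *\<^sub>M v = \<zero>\<^sub>M \<longleftrightarrow> d divides r \<and> e divides s"
    and A: "A = cyc (a *\<^sub>M u +\<^sub>M b *\<^sub>M v)"
  shows "presented R d e a b (sub_pair E A)"
proof -
  have m: "module R (M\<lparr>carrier := E\<rparr>)"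
    by (rule submodule.submodule_is_module[OF E(1) module_axioms])
  have eqs: "carrier (M\<lparr>carrier := E\<rparr>) = E" "add (M\<lparr>carrier := E\<rparr>) = add M"
    "ring.zero (M\<lparr>carrier := E\<rparr>) = ring.zero M" "smult (M\<lparr>carrier := E\<rparr>) = smult M" by simp_all
  show ?thesis unfolding presented_def fst_conv snd_conv eqs
    by (intro conjI m bexI[OF _ E(2)] bexI[OF _ E(3)] ballI gen rel A[unfolded cyc_def])
qed

lemma presented_cyclic:
  assumes x: "x \<in> carrier M" and d: "\<And>r. r \<in> carrier R \<Longrightarrow> r *\<^sub>M x = \<zero>\<^sub>M \<longleftrightarrow> d divides r"
    and a: "a \<in> carrier R"
  shows "presented R d \<one> a \<zero> (sub_pair (cyc x) (cyc (a *\<^sub>M x)))"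
proof -
  note cx = submodule_cyc[OF x]
  have z: "\<zero>\<^sub>M \<in> cyc x" using submoduleD(2)[OF cx] .
  have gen: "\<exists>r \<in> carrier R. \<exists>s \<in> carrier R. y = r *\<^sub>M x +\<^sub>M s *\<^sub>M \<zero>\<^sub>M" if y: "y \<in> cyc x" for y
  proof -
    obtain r where r: "r \<in> carrier R" "y = r *\<^sub>M x" using y by (auto simp: cyc_def)
    then have "y = r *\<^sub>M x +\<^sub>M \<zero> *\<^sub>M \<zero>\<^sub>M" using x by simp
    then show ?thesis using r(1) R.zero_closed by blast
  qed
  have rel: "r *\<^sub>M x +\<^sub>M s *\<^sub>M \<zero>\<^sub>M = \<zero>\<^sub>M \<longleftrightarrow> d divides r \<and> \<one> divides s"
    if "r \<in> carrier R" "s \<in> carrier R" for r s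
    using d[OF that(1)] that x by (simp add: one_divides)
  have sub: "cyc (a *\<^sub>M x) = cyc (a *\<^sub>M x +\<^sub>M \<zero> *\<^sub>M \<zero>\<^sub>M)"
    using x a by simp
  show ?thesis by (rule presented_sub_pairI[OF cx cyc_self[OF x] z gen rel sub])
qed

lemma sum_inter_trivial:
  assumes x: "x \<in> carrier M" and C: "submodule C R M"
    and d: "\<And>r. \<lbrakk>r \<in> carrier R; r *\<^sub>M x \<in> C\<rbrakk> \<Longrightarrow> r *\<^sub>M x = \<zero>\<^sub>M"
  shows "cyc x \<inter> C = {\<zero>\<^sub>M}"
  using submoduleD(2)[OF C] submoduleD(2)[OF submodule_cyc[OF x]] d by (auto simp: cyc_def)

lemma annihilator_of_divides:
  assumes "x \<in> carrier M" "d \<in> carrier R" "d *\<^sub>M x = \<zero>\<^sub>M" "d divides r"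
  shows "r *\<^sub>M x = \<zero>\<^sub>M"
  using assms by (auto simp: factor_def smult_assoc1 smult_commute[of d])

lemma set_add_zero: "submodule N R M \<Longrightarrow> {\<zero>\<^sub>M} +\<^sub>S N = N"
  using submoduleD(1) by (auto simp: mem_set_add)

lemma cyc_zero: "cyc \<zero>\<^sub>M = {\<zero>\<^sub>M}"
  unfolding cyc_def using smult_r_null by force

text \<open>All summands split off below, except for the bipickets, are cyclic and arise from a complement like this one.\<close>

lemma pair_split_cyclic:
  assumes x: "x \<in> carrier M" and a: "a \<in> carrier R" and C: "submodule C R M" and A2: "submodule A2 R M" "A2 \<subseteq> C"
    and D: "D = cyc x +\<^sub>S C" and A: "A = cyc (a *\<^sub>M x) +\<^sub>S A2"
    and d: "d \<in> carrier R" "d *\<^sub>M x = \<zero>\<^sub>M" "\<And>r. \<lbrakk>r \<in> carrier R; r *\<^sub>M x \<in> C\<rbrakk> \<Longrightarrow> d divides r"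
  shows "pair_split D A (cyc x) (cyc (a *\<^sub>M x)) C A2"
    and "presented R d \<one> a \<zero> (sub_pair (cyc x) (cyc (a *\<^sub>M x)))"
proof -
  have ax: "a *\<^sub>M x \<in> cyc x" using a by (auto simp: cyc_def)
  have axc: "a *\<^sub>M x \<in> carrier M" using a x by simp
  have zero: "r *\<^sub>M x = \<zero>\<^sub>M" if "r \<in> carrier R" "r *\<^sub>M x \<in> C" for r
    by (rule annihilator_of_divides[OF x d(1,2) d(3)[OF that]])
  show "pair_split D A (cyc x) (cyc (a *\<^sub>M x)) C A2"
    unfolding pair_split_def
    by (intro conjI submodule_cyc x axc C A2 D A cyc_least[OF submodule_cyc[OF x] ax]
        sum_inter_trivial[OF x C zero])
  have "r *\<^sub>M x = \<zero>\<^sub>M \<longleftrightarrow> d divides r" if r: "r \<in> carrier R" for r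
  proof
    assume "r *\<^sub>M x = \<zero>\<^sub>M"
    then have "r *\<^sub>M x \<in> C" by (simp only: submoduleD(2)[OF C])
    then show "d divides r" by (rule d(3)[OF r])
  qed (rule annihilator_of_divides[OF x d(1,2)])
  then show "presented R d \<one> a \<zero> (sub_pair (cyc x) (cyc (a *\<^sub>M x)))"
    by (rule presented_cyclic[OF x _ a])
qed

end

section \<open>Existence of a standard summand\<close>

context fg_pid_module
begin

text \<open>As \<open>A\<close> is torsion, it lies in the kernel of the projection onto a free summand.\<close>

lemma split_non_torsion:
  assumes D: "submodule D R M" and A: "submodule A R M" "A \<subseteq> D"
    and tor: "c \<in> carrier R" "c \<noteq> \<zero>" "\<And>a. a \<in> A \<Longrightarrow> c *\<^sub>M a = \<zero>\<^sub>M"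
    and w: "w \<in> D" "\<And>r. \<lbrakk>r \<in> carrier R; r *\<^sub>M w = \<zero>\<^sub>M\<rbrakk> \<Longrightarrow> r = \<zero>"
  shows "\<exists>E A1 C A2. pair_split D A E A1 C A2 \<and> presented_free R (sub_pair E A1)"
proof -
  obtain x C where x: "x \<in> D" and C: "submodule C R M" "C \<subseteq> D" "D = cyc x +\<^sub>S C"
    and ann: "\<And>r. \<lbrakk>r \<in> carrier R; r *\<^sub>M x \<in> C\<rbrakk> \<Longrightarrow> r = \<zero>"
    and tors: "\<And>r y. \<lbrakk>r \<in> carrier R; r \<noteq> \<zero>; y \<in> D; r *\<^sub>M y = \<zero>\<^sub>M\<rbrakk> \<Longrightarrow> y \<in> C"
    using split_free[OF D w] by blast
  have xc: "x \<in> carrier M" using submoduleD(1)[OF D x] .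
  have AC: "A \<subseteq> C" using tors tor A by blast
  have Aeq: "A = cyc (\<zero> *\<^sub>M x) +\<^sub>S A" using xc by (simp add: cyc_zero set_add_zero[OF A(1)])
  have dv: "\<zero> divides r" if "r \<in> carrier R" "r *\<^sub>M x \<in> C" for r using ann[OF that] by (simp add: divides_zero)
  show ?thesis unfolding presented_free_def
    using pair_split_cyclic[OF xc R.zero_closed C(1) A(1) AC C(3) Aeq R.zero_closed smult_l_null[OF xc] dv] by blast
qed

text \<open>
  If \<open>A = 0\<close> and \<open>D\<close> is bounded, an element of maximal order among those annihilated by powers of
  a prime spans a summand. The prime \<open>p\<close> itself is preferred in order that the other primes
  are not associated to it.
\<close>

lemma split_bounded_zero:
  assumes D: "submodule D R M" "D \<noteq> {\<zero>\<^sub>M}" and p: "p \<in> carrier R" "ring_prime p"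
    and bound: "c \<in> carrier R" "c \<noteq> \<zero>" "\<And>y. y \<in> D \<Longrightarrow> c *\<^sub>M y = \<zero>\<^sub>M"
  shows "\<exists>E A1 C A2. pair_split D {\<zero>\<^sub>M} E A1 C A2 \<and>
    (presented_prime R p (sub_pair E A1) \<or> presented_picket R p (sub_pair E A1))"
proof -
  note Dc = submoduleD(1)[OF D(1)]
  define I where "I = {r \<in> carrier R. \<forall>y \<in> D. r *\<^sub>M y = \<zero>\<^sub>M}"
  have "ideal I R" unfolding I_def
    by (rule idealI') (auto simp: Dc smult_l_distr smult_assoc1)
  then obtain g where g: "g \<in> carrier R" "I = PIdl g" using exists_gen by blast
  have "c \<in> I" using bound by (simp add: I_def)
  then have g0: "g \<noteq> \<zero>" using g bound by (auto simp: cgenideal_def)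
  have gI: "g \<in> I" using g cgenideal_self by simp
  have gU: "g \<notin> Units R"
  proof
    assume "g \<in> Units R"
    then obtain h where "h \<in> carrier R" "h \<otimes> g = \<one>" using R.Units_l_inv_ex by blast
    then have "\<one> \<in> I" unfolding g(2) cgenideal_def by (metis (mono_tags, lifting) mem_Collect_eq)
    then have "y = \<zero>\<^sub>M" if "y \<in> D" for y using that smult_one[OF Dc[OF that]] by (simp add: I_def)
    then show False using D(2) submoduleD(2)[OF D(1)] by blast
  qed
  obtain q where q: "q \<in> carrier R" "ring_prime q" "q divides g" and qp: "q = p \<or> \<not> q divides p"
  proof (cases "p divides g")
    case True then show ?thesis using that[of p] p by blast
  next
    case False
    obtain q where q: "q \<in> carrier R" "ring_prime q" "q divides g" using exists_prime_divisor[OF g(1) g0 gU] by blast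
    have "\<not> q divides p"
    proof
      assume "q divides p"
      then obtain w where w: "w \<in> carrier R" "p = q \<otimes> w" by (auto simp: factor_def)
      have "p divides (q \<otimes> w)" by (subst w(2)[symmetric]) (rule divides_refl[OF p(1)])
      moreover have "\<not> p divides q" using False q divides_trans p by blast
      ultimately obtain w' where w': "w' \<in> carrier R" "w = p \<otimes> w'"
        using prime_divides_mult[OF p q(1) w(1)] by (auto simp: factor_def)
      have "p = q \<otimes> (p \<otimes> w')" by (rule trans[OF w(2)]) (simp only: w'(2))
      also have "\<dots> = p \<otimes> (q \<otimes> w')" by (rule R.m_lcomm[OF q(1) p(1) w'(1)])
      finally have "p \<otimes> \<one> = p \<otimes> (q \<otimes> w')" by (rule trans[OF r_one[OF p(1)]])
      then have "\<one> = q \<otimes> w'" using R.m_lcancel[OF ring_primeE(1)[OF p] p(1), of \<one> "q \<otimes> w'"] q w' by simp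
      then have "q divides \<one>" using w'(1) unfolding factor_def by blast
      then show False using prime_not_divides_one q by blast
    qed
    then show ?thesis using that[of q] q by blast
  qed
  obtain n m where m: "m \<in> carrier R" "\<not> q divides m" "g = q [^] (n::nat) \<otimes> m"
    using extract_prime_power[OF q(1,2) g(1) g0] by blast
  have "n \<noteq> 0"
  proof
    assume "n = 0"
    then have "g = m" using m by simp
    then show False using q m by blast
  qed
  then obtain e where e: "n = Suc e" using not0_implies_Suc by blast
  let ?k = "q [^] e \<otimes> m"
  have kc: "?k \<in> carrier R" using q m by simp
  have gk: "g = q \<otimes> ?k" using m e q by (simp add: R.m_ac)
  have k0: "?k \<noteq> \<zero>" using gk g0 q by auto
  have "?k \<notin> I"
  proof
    assume "?k \<in> I"
    then obtain t where t: "t \<in> carrier R" "?k = t \<otimes> g" using g by (auto simp: cgenideal_def)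
    have "?k = t \<otimes> (q \<otimes> ?k)" by (rule trans[OF t(2)]) (simp only: gk)
    also have "\<dots> = ?k \<otimes> (q \<otimes> t)" using t(1) q(1) kc by algebra
    finally have "?k \<otimes> \<one> = ?k \<otimes> (q \<otimes> t)" by (rule trans[OF r_one[OF kc]])
    then have "\<one> = q \<otimes> t" using R.m_lcancel[OF k0 kc, of \<one> "q \<otimes> t"] q t by simp
    then have "q divides \<one>" using t(1) unfolding factor_def by blast
    then show False using prime_not_divides_one q by blast
  qed
  then obtain x0 where x0: "x0 \<in> D" "?k *\<^sub>M x0 \<noteq> \<zero>\<^sub>M" using kc by (auto simp: I_def)
  define x where "x = m *\<^sub>M x0"
  have x: "x \<in> D" using submoduleD(4)[OF D(1)] m x0 by (simp add: x_def)
  have xc: "x \<in> carrier M" using Dc x .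
  have gz: "g *\<^sub>M y = \<zero>\<^sub>M" if "y \<in> D" for y using gI that by (simp add: I_def)
  have qx: "q [^] Suc e *\<^sub>M x = \<zero>\<^sub>M"
    using gz[OF x0(1)] q m e x0 Dc by (simp add: x_def smult_assoc1)
  have qex: "q [^] e *\<^sub>M x \<noteq> \<zero>\<^sub>M" using x0 q m Dc by (simp add: x_def smult_assoc1)
  let ?C0 = "scaled (q [^] Suc e) D"
  have C0: "submodule ?C0 R M" "?C0 \<subseteq> D" using submodule_image_smult[OF D(1)] submoduleD(4)[OF D(1)] q by auto
  have socle: "q [^] e *\<^sub>M x \<notin> ?C0"
  proof
    assume "q [^] e *\<^sub>M x \<in> ?C0"
    then obtain d where d: "d \<in> D" "q [^] e *\<^sub>M x = q [^] Suc e *\<^sub>M d" by blast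
    have "m *\<^sub>M (q [^] Suc e *\<^sub>M d) = g *\<^sub>M d"
      using m e q d Dc by (simp add: smult_assoc1[symmetric] R.m_comm[of m])
    then have 1: "m *\<^sub>M (q [^] e *\<^sub>M x) \<in> {\<zero>\<^sub>M}" using d gz by simp
    have 2: "q *\<^sub>M (q [^] e *\<^sub>M x) \<in> {\<zero>\<^sub>M}"
      using qx q xc by (simp add: smult_assoc1[symmetric] R.m_comm[of q])
    show False
      using prime_combination[OF q(1,2) m(1,2) submodule_zero_set _ 2 1] q xc qex by simp
  qed
  obtain C where C: "submodule C R M" "?C0 \<subseteq> C" "C \<subseteq> D" "D = cyc x +\<^sub>S C"
    "\<And>r. \<lbrakk>r \<in> carrier R; r *\<^sub>M x \<in> C\<rbrakk> \<Longrightarrow> q [^] Suc e divides r"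
    using split_cyclic[OF D(1) C0 q(1,2) x qx _ socle] by blast
  have zC: "{\<zero>\<^sub>M} \<subseteq> C" using submoduleD(2)[OF C(1)] by simp
  have qc: "q [^] Suc e \<in> carrier R" using q by simp
  show ?thesis
    using qp
  proof
    assume "\<not> q divides p"
    have Aeq: "{\<zero>\<^sub>M} = cyc (\<zero> *\<^sub>M x) +\<^sub>S {\<zero>\<^sub>M}"
      using xc by (simp add: cyc_zero set_add_zero[OF submodule_zero_set])
    then show ?thesis
      using pair_split_cyclic[OF xc R.zero_closed C(1) submodule_zero_set zC C(4) Aeq qc qx C(5)] q \<open>\<not> q divides p\<close>
      unfolding presented_prime_def by blast
  next
    assume "q = p"
    have Aeq: "{\<zero>\<^sub>M} = cyc (q [^] Suc e *\<^sub>M x) +\<^sub>S {\<zero>\<^sub>M}"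
      unfolding qx by (simp add: cyc_zero set_add_zero[OF submodule_zero_set])
    have "presented_picket R p (sub_pair (cyc x) (cyc (q [^] Suc e *\<^sub>M x)))"
      unfolding presented_picket_def
      using pair_split_cyclic(2)[OF xc qc C(1) submodule_zero_set zC C(4) Aeq qc qx C(5)] \<open>q = p\<close>
      by (intro exI[of _ "Suc e"] exI[of _ 0]) simp
    then show ?thesis
      using pair_split_cyclic(1)[OF xc qc C(1) submodule_zero_set zC C(4) Aeq qc qx C(5)] by blast
  qed
qed

end

context fg_pid_module
begin

lemma scaled_mono:
  assumes "submodule D R M" "q \<in> carrier R" "i \<le> (j::nat)"
  shows "scaled (q [^] j) D \<subseteq> scaled (q [^] i) D"
proof
  fix x assume "x \<in> scaled (q [^] j) D"
  then obtain y where y: "y \<in> D" "x = q [^] j *\<^sub>M y" by blast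
  have "q [^] j = q [^] i \<otimes> q [^] (j - i)" using assms(2,3) by (simp add: nat_pow_mult)
  then have "x = q [^] i *\<^sub>M (q [^] (j - i) *\<^sub>M y)"
    using y assms(2) submoduleD(1)[OF assms(1)] by (simp add: smult_assoc1)
  then show "x \<in> scaled (q [^] i) D" using submoduleD(4)[OF assms(1)] y assms(2) by blast
qed

lemma scaled_add:
  assumes "submodule D R M" "q \<in> carrier R" "x \<in> scaled (q [^] (i::nat)) D"
  shows "q [^] (j::nat) *\<^sub>M x \<in> scaled (q [^] (i + j)) D"
proof -
  obtain y where y: "y \<in> D" "x = q [^] i *\<^sub>M y" using assms(3) by blast
  have "q [^] (i + j) = q [^] j \<otimes> q [^] i" using assms(2) by (simp add: nat_pow_mult add.commute)
  then have "q [^] j *\<^sub>M x = q [^] (i + j) *\<^sub>M y"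
    using y assms(2) submoduleD(1)[OF assms(1)] by (simp add: smult_assoc1)
  then show ?thesis using y by blast
qed

lemma p_square_zero:
  assumes p: "p \<in> carrier R" "ring_prime p" and m: "m \<in> carrier R" "\<not> p divides m"
    and a: "a \<in> carrier M" "p *\<^sub>M (p *\<^sub>M a) = \<zero>\<^sub>M" "m *\<^sub>M a = \<zero>\<^sub>M"
  shows "a = \<zero>\<^sub>M"
proof -
  have pa: "p *\<^sub>M a \<in> carrier M" using p a by simp
  have "m *\<^sub>M (p *\<^sub>M a) = p *\<^sub>M (m *\<^sub>M a)" by (rule smult_commute[OF m(1) p(1) a(1)])
  also have "\<dots> = \<zero>\<^sub>M" unfolding a(3) by (rule smult_r_null[OF p(1)])
  finally have "m *\<^sub>M (p *\<^sub>M a) \<in> {\<zero>\<^sub>M}" by simp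
  moreover have "p *\<^sub>M (p *\<^sub>M a) \<in> {\<zero>\<^sub>M}" using a(2) by simp
  ultimately have "p *\<^sub>M a \<in> {\<zero>\<^sub>M}" using prime_combination[OF p m submodule_zero_set pa] by blast
  moreover have "m *\<^sub>M a \<in> {\<zero>\<^sub>M}" using a(3) by simp
  ultimately show ?thesis using prime_combination[OF p m submodule_zero_set a(1)] by blast
qed

text \<open>
  If \<open>c = p\<^sup>n m\<close> with \<open>m\<close> not divisible by \<open>p\<close>, then \<open>m\<close> annihilates \<open>p\<^sup>n D\<close>, but no nonzero element that
  \<open>p\<^sup>2\<close> annihilates. The number \<open>k\<close> is the height of \<open>a\<close> in \<open>D\<close>.
\<close>

lemma height_exists:
  assumes D: "submodule D R M" and p: "p \<in> carrier R" "ring_prime p"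
    and bound: "c \<in> carrier R" "c \<noteq> \<zero>" "\<And>y. y \<in> D \<Longrightarrow> c *\<^sub>M y = \<zero>\<^sub>M"
    and a: "a \<in> D" "a \<noteq> \<zero>\<^sub>M" "p *\<^sub>M (p *\<^sub>M a) = \<zero>\<^sub>M"
  obtains k :: nat where "a \<in> scaled (p [^] k) D" "a \<notin> scaled (p [^] Suc k) D"
proof -
  note Dc = submoduleD(1)[OF D]
  obtain n m where m: "m \<in> carrier R" "\<not> p divides m" "c = p [^] (n::nat) \<otimes> m"
    using extract_prime_power[OF p bound(1,2)] by blast
  have "a \<notin> scaled (p [^] n) D"
  proof
    assume "a \<in> scaled (p [^] n) D"
    then obtain d where d: "d \<in> D" "a = p [^] n *\<^sub>M d" by blast
    have "m *\<^sub>M a = c *\<^sub>M d"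
      unfolding d(2) m(3) using m(1) p d(1) Dc by (simp flip: smult_assoc1 add: R.m_comm)
    then have "m *\<^sub>M a = \<zero>\<^sub>M" using bound(3) d by simp
    then show False using p_square_zero[OF p m(1,2)] a Dc by blast
  qed
  moreover have "\<not> a \<notin> scaled (p [^] (0::nat)) D" using a(1) Dc by (force simp: image_iff)
  ultimately obtain k where k: "\<forall>i\<le>k. \<not> a \<notin> scaled (p [^] i) D" "a \<notin> scaled (p [^] Suc k) D"
    using ex_least_nat_less[of "\<lambda>n. a \<notin> scaled (p [^] n) D" n] by blast
  then show ?thesis using that by blast
qed

lemma sum_mem_imp:
  assumes "submodule N R M" "x \<in> carrier M" "x \<in> N +\<^sub>S L" "L \<subseteq> carrier M"
  obtains y z where "y \<in> N" "z \<in> L" "x = y +\<^sub>M z" "z = x -\<^sub>M y"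
proof -
  obtain y z where yz: "y \<in> N" "z \<in> L" "x = y +\<^sub>M z" using assms(3) by (auto simp: mem_set_add)
  then have "x = z +\<^sub>M y" using submoduleD(1)[OF assms(1)] assms(4) by (simp add: M.a_comm subset_iff)
  then have "x -\<^sub>M y = z" using diff_eqI submoduleD(1)[OF assms(1)] assms(4) yz by blast
  then show ?thesis using that yz by blast
qed

text \<open>
  An element \<open>a\<close> of \<open>A\<close> of order \<open>p\<close> and height \<open>h\<close>: a complement \<open>A'\<close> of \<open>a\<close> in the vector space
  \<open>A\<close> that contains all elements of greater height consists of elements that do not
  increase the height of \<open>a\<close>, hence \<open>a\<close> remains outside \<open>A' + p\<^sup>h\<^sup>+\<^sup>1 D\<close>.
\<close>

lemma split_bounded_elementary:
  assumes D: "submodule D R M" and A: "submodule A R M" "A \<subseteq> D" and p: "p \<in> carrier R" "ring_prime p"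
    and bound: "c \<in> carrier R" "c \<noteq> \<zero>" "\<And>y. y \<in> D \<Longrightarrow> c *\<^sub>M y = \<zero>\<^sub>M"
    and pA: "\<And>a. a \<in> A \<Longrightarrow> p *\<^sub>M a = \<zero>\<^sub>M" and a: "a \<in> A" "a \<noteq> \<zero>\<^sub>M"
  shows "\<exists>E A1 C A2. pair_split D A E A1 C A2 \<and> presented_picket R p (sub_pair E A1)"
proof -
  note Dc = submoduleD(1)[OF D]
  have aD: "a \<in> D" using a A by blast
  have ac: "a \<in> carrier M" using Dc aD .
  have pp: "p [^] n \<in> carrier R" for n :: nat using p by simp
  obtain h :: nat where h: "a \<in> scaled (p [^] h) D" "a \<notin> scaled (p [^] Suc h) D"
    using height_exists[OF D p bound aD a(2)] pA[OF a(1)] p by auto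
  note sD = submodule_image_smult[OF D pp]
  let ?A1 = "A \<inter> scaled (p [^] Suc h) D"
  have A1: "submodule ?A1 R M" using submodule_Int[OF A(1) sD] .
  have pa: "p [^] Suc 0 *\<^sub>M a = \<zero>\<^sub>M" using pA[OF a(1)] p by simp
  have sc: "scaled (p [^] Suc 0) A \<subseteq> ?A1" using pA p submoduleD(2)[OF A1] by auto
  have so: "p [^] (0::nat) *\<^sub>M a \<notin> ?A1" using h ac by simp
  obtain A' where A': "submodule A' R M" "?A1 \<subseteq> A'" "A' \<subseteq> A" "A = cyc a +\<^sub>S A'"
    "\<And>r. \<lbrakk>r \<in> carrier R; r *\<^sub>M a \<in> A'\<rbrakk> \<Longrightarrow> p [^] Suc 0 divides r"
    using split_cyclic[OF A(1) A1 _ p a(1) pa sc so] by blast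
  have aA': "a \<notin> A'" using A'(5)[of \<one>] prime_not_divides_one[OF p] p ac by auto
  obtain v where v: "v \<in> D" "a = p [^] h *\<^sub>M v" using h(1) by blast
  have vc: "v \<in> carrier M" using Dc v by blast
  let ?C0 = "A' +\<^sub>S scaled (p [^] Suc h) D"
  have C0: "submodule ?C0 R M" using submodule_set_add[OF A'(1) sD] .
  have sub: "scaled (p [^] n) D \<subseteq> D" for n :: nat using submoduleD(4)[OF D] pp by auto
  have C0D: "?C0 \<subseteq> D" by (rule set_add_least[OF D subset_trans[OF A'(3) A(2)] sub])
  have pv: "p [^] Suc h *\<^sub>M v = \<zero>\<^sub>M"
  proof -
    have "p [^] Suc h *\<^sub>M v = p *\<^sub>M a" unfolding v(2) using p vc by (simp flip: smult_assoc1 add: R.m_comm)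
    then show ?thesis using pA a by simp
  qed
  have aC0: "a \<notin> ?C0"
  proof
    assume aC: "a \<in> ?C0"
    have Hc: "scaled (p [^] Suc h) D \<subseteq> carrier M" using sub Dc by blast
    obtain a' y where y: "a' \<in> A'" "y \<in> scaled (p [^] Suc h) D" "a = a' +\<^sub>M y" "y = a -\<^sub>M a'"
      by (rule sum_mem_imp[OF A'(1) ac aC Hc])
    have "y \<in> A" using y(1,4) submoduleD(6)[OF A(1)] a A' by blast
    then have "y \<in> A'" using A'(2) y by blast
    then have "a' +\<^sub>M y \<in> A'" by (rule submoduleD(3)[OF A'(1) y(1)])
    then show False using aA' unfolding y(3)[symmetric] by blast
  qed
  obtain C where C: "submodule C R M" "?C0 \<subseteq> C" "C \<subseteq> D" "D = cyc v +\<^sub>S C"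
    "\<And>r. \<lbrakk>r \<in> carrier R; r *\<^sub>M v \<in> C\<rbrakk> \<Longrightarrow> p [^] Suc h divides r"
    using split_cyclic[OF D C0 C0D p v(1) pv set_add_upper(2)[OF A'(1) sD] aC0[unfolded v(2)]] by blast
  have A'C: "A' \<subseteq> C" using C(2) set_add_upper(1)[OF A'(1) sD] by blast
  note fin = pair_split_cyclic[OF vc pp[of h] C(1) A'(1) A'C C(4) A'(4)[unfolded v(2)] pp pv C(5)]
  have "presented_picket R p (sub_pair (cyc v) (cyc (p [^] h *\<^sub>M v)))"
    unfolding presented_picket_def by (rule exI[of _ "Suc h"], rule exI[of _ 1]) (use fin(2) in simp)
  then show ?thesis using fin(1) by blast
qed

text \<open>
  The general case. Among the elements \<open>b \<in> A\<close> whose multiple \<open>p b\<close> has a fixed height \<open>k\<close>, choose \<open>a\<close>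
  of maximal height \<open>h\<close>. This choice is exactly what is needed for a complement \<open>A'\<close> of \<open>R a\<close> in \<open>A\<close>
  that contains all elements of height greater than \<open>k\<close> and, up to multiples of \<open>p a\<close>, all elements of
  height greater than \<open>h\<close>: in \<open>A \<inter> p\<^sup>h\<^sup>+\<^sup>1 D\<close> the element \<open>p a\<close> is not congruent to a
  multiple \<open>p b\<close> modulo elements of greater height.
  If \<open>k = h + 1\<close>, then \<open>a = p\<^sup>h v\<close> and \<open>v\<close> spans a picket. Otherwise \<open>p a = p\<^sup>k u\<close> with
  \<open>a \<noteq> p\<^sup>k\<^sup>-\<^sup>1 u\<close>, and the difference \<open>p\<^sup>h v\<close> gives the second generator of a bipicket.
\<close>

lemma split_bounded_square:
  assumes D: "submodule D R M" and A: "submodule A R M" "A \<subseteq> D" and p: "p \<in> carrier R" "ring_prime p"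
    and bound: "c \<in> carrier R" "c \<noteq> \<zero>" "\<And>y. y \<in> D \<Longrightarrow> c *\<^sub>M y = \<zero>\<^sub>M"
    and ppA: "\<And>a. a \<in> A \<Longrightarrow> p *\<^sub>M (p *\<^sub>M a) = \<zero>\<^sub>M" and b0: "b0 \<in> A" "p *\<^sub>M b0 \<noteq> \<zero>\<^sub>M"
  shows "\<exists>E A1 C A2. pair_split D A E A1 C A2 \<and>
    (presented_picket R p (sub_pair E A1) \<or> presented_bipicket R p (sub_pair E A1))"
proof -
  note Dc = submoduleD(1)[OF D]
  have pp: "p [^] n \<in> carrier R" for n :: nat using p by simp
  note sD = submodule_image_smult[OF D pp]
  let ?H = "\<lambda>n::nat. scaled (p [^] n) D"
  have sub: "?H n \<subseteq> D" for n :: nat using submoduleD(4)[OF D] pp by auto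
  have Hc: "?H n \<subseteq> carrier M" for n using sub Dc by blast
  have HS: "p *\<^sub>M x \<in> ?H (Suc n)" if "x \<in> ?H n" for x n
    using scaled_add[OF D p(1) that, of 1] p by simp
  have pA: "p *\<^sub>M b \<in> A" if "b \<in> A" for b using submoduleD(4)[OF A(1)] that p by blast
  have "p *\<^sub>M (p *\<^sub>M (p *\<^sub>M b0)) = \<zero>\<^sub>M" using ppA[OF b0(1)] p by simp
  then obtain k :: nat where k: "p *\<^sub>M b0 \<in> ?H k" "p *\<^sub>M b0 \<notin> ?H (Suc k)"
    using height_exists[OF D p bound _ b0(2)] pA[OF b0(1)] A(2) by blast
  define good where "good b \<longleftrightarrow> b \<in> A \<and> p *\<^sub>M b \<in> ?H k \<and> p *\<^sub>M b \<notin> ?H (Suc k)" for b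
  define P where "P h \<longleftrightarrow> (\<exists>b. good b \<and> b \<in> ?H h)" for h
  have P0: "P 0" unfolding P_def good_def
    using b0 k A(2) Dc by (intro exI[of _ b0]) (force simp: image_iff)
  have Pk: "h < k" if "P h" for h
  proof (rule ccontr)
    assume "\<not> h < k"
    obtain b where b: "good b" "b \<in> ?H h" using \<open>P h\<close> unfolding P_def by blast
    have "p *\<^sub>M b \<in> ?H (Suc h)" using HS b by blast
    also have "\<dots> \<subseteq> ?H (Suc k)" by (rule scaled_mono[OF D p(1)]) (use \<open>\<not> h < k\<close> in simp)
    finally show False using b unfolding good_def by blast
  qed
  obtain h where h: "P h" "\<And>h'. P h' \<Longrightarrow> h' \<le> h"
    using ex_has_greatest_nat[of P 0 "\<lambda>x. x" k] P0 Pk by (metis less_imp_le)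
  have hk: "h < k" using Pk h by blast
  obtain a where a: "good a" "a \<in> ?H h" using h unfolding P_def by blast
  have max: "b \<notin> ?H (Suc h)" if "good b" for b
    using h(2)[of "Suc h"] that unfolding P_def by auto
  have aA: "a \<in> A" and pak: "p *\<^sub>M a \<in> ?H k" "p *\<^sub>M a \<notin> ?H (Suc k)" using a unfolding good_def by auto
  have ac: "a \<in> carrier M" using aA A Dc by blast
  have pac: "p *\<^sub>M a \<in> carrier M" using ac p by simp
  have Ac: "x \<in> carrier M" if "x \<in> A" for x using that A Dc by blast

  let ?A1 = "A \<inter> ?H (Suc h)"
  have A1: "submodule ?A1 R M" using submodule_Int[OF A(1) sD] .
  have Ak: "submodule (A \<inter> ?H (Suc k)) R M" using submodule_Int[OF A(1) sD] .
  let ?C00 = "(A \<inter> ?H (Suc k)) +\<^sub>S scaled p ?A1"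
  have pA1: "submodule (scaled p ?A1) R M" using submodule_image_smult[OF A1 p(1)] .
  have C00: "submodule ?C00 R M" using submodule_set_add[OF Ak pA1] .
  have C00A1: "?C00 \<subseteq> ?A1"
  proof (rule set_add_least[OF A1])
    show "A \<inter> ?H (Suc k) \<subseteq> ?A1" using scaled_mono[OF D p(1), of "Suc h" "Suc k"] hk by auto
    show "scaled p ?A1 \<subseteq> ?A1" using submoduleD(4)[OF A1] p by blast
  qed
  have paA1: "p *\<^sub>M a \<in> ?A1"
    using pA[OF aA] pak(1) scaled_mono[OF D p(1), of "Suc h" k] hk by auto
  have paC00: "p [^] (0::nat) *\<^sub>M (p *\<^sub>M a) \<notin> ?C00"
  proof
    assume "p [^] (0::nat) *\<^sub>M (p *\<^sub>M a) \<in> ?C00"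
    then have paC: "p *\<^sub>M a \<in> ?C00" using pac by simp
    have pA1c: "scaled p ?A1 \<subseteq> carrier M" using submoduleD(1)[OF pA1] by blast
    obtain y z where yz: "y \<in> A \<inter> ?H (Suc k)" "z \<in> scaled p ?A1" "p *\<^sub>M a = y +\<^sub>M z" "z = p *\<^sub>M a -\<^sub>M y"
      by (rule sum_mem_imp[OF Ak pac paC pA1c])
    obtain b where b: "b \<in> ?A1" "z = p *\<^sub>M b" using yz(2) by blast
    have "y \<in> ?H k" using yz(1) scaled_mono[OF D p(1), of k "Suc k"] by auto
    then have 1: "z \<in> ?H k" unfolding yz(4) using submoduleD(6)[OF sD] pak by blast
    have 2: "z \<notin> ?H (Suc k)"
    proof
      assume "z \<in> ?H (Suc k)"
      then have "p *\<^sub>M a \<in> ?H (Suc k)" unfolding yz(3) using submoduleD(3)[OF sD] yz(1) by blast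
      then show False using pak by blast
    qed
    have "good b" unfolding good_def using b 1 2 by blast
    then show False using max b by blast
  qed
  have ppa: "p [^] Suc 0 *\<^sub>M (p *\<^sub>M a) = \<zero>\<^sub>M" using ppA[OF aA] p by simp
  have sc1: "scaled (p [^] Suc 0) ?A1 \<subseteq> ?C00" using set_add_upper(2)[OF Ak pA1] p by simp
  obtain A2 where A2: "submodule A2 R M" "?C00 \<subseteq> A2" "A2 \<subseteq> ?A1" "?A1 = cyc (p *\<^sub>M a) +\<^sub>S A2"
    "\<And>r. \<lbrakk>r \<in> carrier R; r *\<^sub>M (p *\<^sub>M a) \<in> A2\<rbrakk> \<Longrightarrow> p [^] Suc 0 divides r"
    using split_cyclic[OF A1 C00 C00A1 p paA1 ppa sc1 paC00] by blast
  have n1: "\<not> p divides \<one>" using prime_not_divides_one[OF p] .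
  have paA2: "p [^] Suc 0 *\<^sub>M a \<notin> A2" using A2(5)[of \<one>] n1 p pac by auto
  have pp2: "p [^] Suc (Suc 0) *\<^sub>M x = p *\<^sub>M (p *\<^sub>M x)" if "x \<in> carrier M" for x
    using p that by (simp add: smult_assoc1)
  have ppa2: "p [^] Suc (Suc 0) *\<^sub>M a = \<zero>\<^sub>M" using ppA[OF aA] pp2[OF ac] by simp
  have sc2: "scaled (p [^] Suc (Suc 0)) A \<subseteq> A2" using ppA pp2 Ac submoduleD(2)[OF A2(1)] by auto
  obtain A' where A': "submodule A' R M" "A2 \<subseteq> A'" "A' \<subseteq> A" "A = cyc a +\<^sub>S A'"
    "\<And>r. \<lbrakk>r \<in> carrier R; r *\<^sub>M a \<in> A'\<rbrakk> \<Longrightarrow> p [^] Suc (Suc 0) divides r"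
    using split_cyclic[OF A(1) A2(1) _ p aA ppa2 sc2 paA2] A2(3) by blast
  have highk: "A \<inter> ?H (Suc k) \<subseteq> A'"
    using set_add_upper(1)[OF Ak pA1] A2(2) A'(2) by blast
  have pdiv: "p divides r" if "p [^] Suc (Suc 0) divides r" "r \<in> carrier R" for r
    using that p by (auto simp: factor_def m_assoc)
  have paA': "p *\<^sub>M a \<notin> A'"
  proof
    assume "p *\<^sub>M a \<in> A'"
    then have "(p \<otimes> p) divides (p \<otimes> \<one>)" using A'(5)[OF p(1)] p by simp
    then show False using mult_divides[OF p(1) R.one_closed, of p] p ring_primeE(1)[OF p] n1 by simp
  qed
  have highh: "False" if w: "w \<in> A'" "a -\<^sub>M w \<in> ?H (Suc h)" for w
  proof -
    have "a -\<^sub>M w \<in> ?A1" using w submoduleD(6)[OF A(1)] aA A'(3) by blast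
    then obtain r y where ry: "r \<in> carrier R" "y \<in> A2" "a -\<^sub>M w = r *\<^sub>M (p *\<^sub>M a) +\<^sub>M y"
      unfolding A2(4) by (auto simp: mem_set_add cyc_def)
    have wc: "w \<in> carrier M" "y \<in> carrier M" using submoduleD(1)[OF A'(1)] w ry A'(2) by auto
    have "a = (r \<otimes> p) *\<^sub>M a +\<^sub>M (y +\<^sub>M w)"
    proof -
      have "a = (a -\<^sub>M w) +\<^sub>M w" using diff_add_cancel ac wc by simp
      also have "\<dots> = (r \<otimes> p) *\<^sub>M a +\<^sub>M (y +\<^sub>M w)"
        unfolding ry(3) using ry(1) p ac wc by (simp add: smult_assoc1 M.a_assoc)
      finally show ?thesis .
    qed
    then have "(\<one> \<ominus> r \<otimes> p) *\<^sub>M a = y +\<^sub>M w"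
      using ry(1) p ac wc
      by (simp add: R.minus_eq smult_l_distr smult_l_minus) (metis M.add.inv_solve_right' M.a_comm M.a_closed smult_closed R.m_closed)
    then have "(\<one> \<ominus> r \<otimes> p) *\<^sub>M a \<in> A'" using submoduleD(3)[OF A'(1)] ry w A'(2) by auto
    then have "p divides (\<one> \<ominus> r \<otimes> p)" using A'(5) pdiv ry p by simp
    then obtain t where t: "t \<in> carrier R" "\<one> \<ominus> r \<otimes> p = p \<otimes> t" by (auto simp: factor_def)
    have "\<one> = (\<one> \<ominus> r \<otimes> p) \<oplus> r \<otimes> p" using ry p by algebra
    also have "\<dots> = p \<otimes> (t \<oplus> r)" unfolding t(2) using t(1) ry(1) p(1) by algebra
    finally show False using n1 t ry unfolding factor_def by blast
  qed

  obtain u where u: "u \<in> D" "p *\<^sub>M a = p [^] k *\<^sub>M u" using pak(1) by blast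
  obtain v1 where v1: "v1 \<in> D" "a = p [^] h *\<^sub>M v1" using a(2) by blast
  have uc: "u \<in> carrier M" and v1c: "v1 \<in> carrier M" using u v1 Dc by auto
  have outside: "p *\<^sub>M a \<notin> A' +\<^sub>S L" if L: "L \<subseteq> ?H (Suc k)" for L
  proof
    assume paL: "p *\<^sub>M a \<in> A' +\<^sub>S L"
    obtain y z where yz: "y \<in> A'" "z \<in> L" "p *\<^sub>M a = y +\<^sub>M z" "z = p *\<^sub>M a -\<^sub>M y"
      by (rule sum_mem_imp[OF A'(1) pac paL subset_trans[OF L Hc]])
    have "z \<in> A" unfolding yz(4) using submoduleD(6)[OF A(1)] pA[OF aA] yz(1) A'(3) by blast
    then have "z \<in> A'" using highk yz(2) L by blast
    then have "y +\<^sub>M z \<in> A'" by (rule submoduleD(3)[OF A'(1) yz(1)])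
    then show False using paA' unfolding yz(3)[symmetric] by blast
  qed
  have pS: "p [^] Suc n *\<^sub>M x = p *\<^sub>M (p [^] n *\<^sub>M x)" if "x \<in> carrier M" for n :: nat and x
    using p that by (simp flip: smult_assoc1 add: R.m_comm)
  have pu: "p [^] Suc k *\<^sub>M u = \<zero>\<^sub>M" unfolding pS[OF uc] u(2)[symmetric] by (rule ppA[OF aA])
  show ?thesis
  proof (cases "k = Suc h")
    case True
    have kv: "p [^] k *\<^sub>M v1 = p *\<^sub>M a" unfolding True pS[OF v1c] v1(2)[symmetric] ..
    have pv: "p [^] Suc k *\<^sub>M v1 = \<zero>\<^sub>M" unfolding pS[OF v1c] kv by (rule ppA[OF aA])
    let ?C0 = "A' +\<^sub>S ?H (Suc k)"
    have C0: "submodule ?C0 R M" using submodule_set_add[OF A'(1) sD] .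
    have C0D: "?C0 \<subseteq> D" by (rule set_add_least[OF D subset_trans[OF A'(3) A(2)] sub])
    have so: "p [^] k *\<^sub>M v1 \<notin> ?C0" unfolding kv using outside by blast
    obtain C where C: "submodule C R M" "?C0 \<subseteq> C" "C \<subseteq> D" "D = cyc v1 +\<^sub>S C"
      "\<And>r. \<lbrakk>r \<in> carrier R; r *\<^sub>M v1 \<in> C\<rbrakk> \<Longrightarrow> p [^] Suc k divides r"
      using split_cyclic[OF D C0 C0D p v1(1) pv set_add_upper(2)[OF A'(1) sD] so] by blast
    have A'C: "A' \<subseteq> C" using C(2) set_add_upper(1)[OF A'(1) sD] by blast
    note fin = pair_split_cyclic[OF v1c pp[of h] C(1) A'(1) A'C C(4) A'(4)[unfolded v1(2)] pp pv C(5)]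
    have "presented_picket R p (sub_pair (cyc v1) (cyc (p [^] h *\<^sub>M v1)))"
      unfolding presented_picket_def by (rule exI[of _ "Suc k"], rule exI[of _ 2]) (use fin(2) True in simp)
    then show ?thesis using fin(1) by blast
  next
    case False
    then have hk2: "Suc h < k" using hk by simp
    define j where "j = k - Suc h"
    define v where "v = v1 -\<^sub>M p [^] j *\<^sub>M u"
    have vD: "v \<in> D" unfolding v_def using submoduleD(4,6)[OF D] v1 u pp by blast
    have vc: "v \<in> carrier M" using Dc vD .
    have hj: "h + j = k - 1" unfolding j_def using hk2 by simp
    have hv: "p [^] h *\<^sub>M v = a -\<^sub>M p [^] (k - 1) *\<^sub>M u"
      unfolding v_def using p v1c uc v1(2)
      by (simp add: smult_diff) (simp flip: smult_assoc1 add: nat_pow_mult hj)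
    have a_eq: "a = p [^] (k - 1) *\<^sub>M u +\<^sub>M p [^] h *\<^sub>M v"
      unfolding hv using diff_add_cancel[OF ac, of "p [^] (k - 1) *\<^sub>M u"] uc pp ac by (simp add: M.a_comm)
    have pk1: "p *\<^sub>M (p [^] (k - 1) *\<^sub>M u) = p *\<^sub>M a"
      using pS[OF uc, of "k - 1"] hk2 u(2) by simp
    have pv: "p [^] Suc h *\<^sub>M v = \<zero>\<^sub>M"
      unfolding pS[OF vc] hv using smult_diff[OF p(1) ac, of "p [^] (k - 1) *\<^sub>M u"] pk1 uc pp pac
      by (simp add: a_minus_def M.r_neg)
    let ?K = "cyc u +\<^sub>S ?H (Suc h)"
    have cu: "submodule (cyc u) R M" using submodule_cyc[OF uc] .
    have K: "submodule ?K R M" using submodule_set_add[OF cu sD] .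
    have KD: "?K \<subseteq> D" by (rule set_add_least[OF D cyc_least[OF D u(1)] sub])
    let ?C0 = "A' +\<^sub>S ?K"
    have C0: "submodule ?C0 R M" using submodule_set_add[OF A'(1) K] .
    have C0D: "?C0 \<subseteq> D" by (rule set_add_least[OF D subset_trans[OF A'(3) A(2)] KD])
    have sc: "?H (Suc h) \<subseteq> ?C0" using set_add_upper(2)[OF A'(1) K] set_add_upper(2)[OF cu sD] by blast
    have so: "p [^] h *\<^sub>M v \<notin> ?C0"
    proof
      assume "p [^] h *\<^sub>M v \<in> ?C0"
      then obtain w z where w: "w \<in> A'" and z: "z \<in> ?K" "p [^] h *\<^sub>M v = w +\<^sub>M z"
        unfolding mem_set_add[of _ A' ?K] by blast
      obtain s y where s: "s \<in> carrier R" and y: "y \<in> ?H (Suc h)" and sy: "z = s *\<^sub>M u +\<^sub>M y"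
        using z(1) unfolding mem_set_add cyc_def by blast
      have eq: "p [^] h *\<^sub>M v = w +\<^sub>M (s *\<^sub>M u +\<^sub>M y)" using z(2) unfolding sy .
      have wc: "w \<in> carrier M" and yc: "y \<in> carrier M" using submoduleD(1)[OF A'(1)] w y Hc by blast+
      define s' where "s' = p [^] (k - 1) \<oplus> s"
      have s': "s' \<in> carrier R" using s pp by (simp add: s'_def)
      have "a = (s' *\<^sub>M u +\<^sub>M y) +\<^sub>M w"
      proof -
        have "a = p [^] (k - 1) *\<^sub>M u +\<^sub>M (w +\<^sub>M (s *\<^sub>M u +\<^sub>M y))" using a_eq unfolding eq .
        also have "\<dots> = (s' *\<^sub>M u +\<^sub>M y) +\<^sub>M w"
          using s pp uc wc yc by (simp add: s'_def smult_l_distr M.a_ac)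
        finally show ?thesis .
      qed
      then have aw: "a -\<^sub>M w = s' *\<^sub>M u +\<^sub>M y" using diff_eqI s' uc yc wc by simp
      show False
        using prime_power_dichotomy[OF p s', of "Suc h"]
      proof
        assume "p [^] Suc h divides s'"
        then obtain t where t: "t \<in> carrier R" "s' = p [^] Suc h \<otimes> t" by (auto simp: factor_def)
        have "s' *\<^sub>M u = p [^] Suc h *\<^sub>M (t *\<^sub>M u)" unfolding t(2) by (rule smult_assoc1[OF pp t(1) uc])
        then have "s' *\<^sub>M u \<in> ?H (Suc h)" using submoduleD(4)[OF D t(1) u(1)] by blast
        then have "a -\<^sub>M w \<in> ?H (Suc h)" unfolding aw using submoduleD(3)[OF sD] y by blast
        then show False using highh w by blast
      next
        assume "\<exists>i<Suc h. \<exists>t \<in> carrier R. s' = p [^] i \<otimes> t \<and> \<not> p divides t"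
        then obtain i t where t: "i < Suc h" "t \<in> carrier R" "s' = p [^] i \<otimes> t" "\<not> p divides t" by blast
        let ?l = "k - i"
        \<comment> \<open>\<open>l \<ge> 2\<close>, so \<open>p\<^sup>l\<close> annihilates \<open>a - w \<in> A\<close>.\<close>
        have l: "Suc (Suc (?l - 2)) = ?l" "?l + i = k" "Suc k \<le> Suc h + ?l" using t(1) hk2 by auto
        have awA: "a -\<^sub>M w \<in> A" using submoduleD(6)[OF A(1)] aA w A'(3) by blast
        have "p [^] ?l *\<^sub>M (a -\<^sub>M w) = p [^] (?l - 2) *\<^sub>M (p [^] Suc (Suc 0) *\<^sub>M (a -\<^sub>M w))"
        proof -
          have "?l - 2 + Suc (Suc 0) = ?l" using l(1) by simp
          then have "p [^] ?l = p [^] (?l - 2) \<otimes> p [^] Suc (Suc 0)"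
            using nat_pow_mult[OF p(1), of "?l - 2" "Suc (Suc 0)"] by simp
          then show ?thesis using smult_assoc1[OF pp pp Ac[OF awA], of "?l - 2" "Suc (Suc 0)"] by simp
        qed
        also have "\<dots> = \<zero>\<^sub>M" using ppA[OF awA] pp2[OF Ac[OF awA]] pp by simp
        finally have z: "p [^] ?l *\<^sub>M (s' *\<^sub>M u) +\<^sub>M p [^] ?l *\<^sub>M y = \<zero>\<^sub>M"
          unfolding aw using smult_r_distr pp s' uc yc by simp
        have "p [^] ?l *\<^sub>M y \<in> ?H (Suc h + ?l)" using scaled_add[OF D p(1) y] .
        then have yk: "p [^] ?l *\<^sub>M y \<in> ?H (Suc k)" using scaled_mono[OF D p(1) l(3)] by blast
        have "p [^] ?l *\<^sub>M (s' *\<^sub>M u) +\<^sub>M p [^] ?l *\<^sub>M y \<in> ?H (Suc k)"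
          unfolding z by (rule submoduleD(2)[OF sD])
        then have "p [^] ?l *\<^sub>M (s' *\<^sub>M u) \<in> ?H (Suc k)"
          by (rule add_mem_cancel_right[OF sD _ yk]) (use s' uc pp in simp)
        also have "p [^] ?l *\<^sub>M (s' *\<^sub>M u) = t *\<^sub>M (p *\<^sub>M a)"
        proof -
          have "p [^] ?l \<otimes> s' = (p [^] ?l \<otimes> p [^] i) \<otimes> t" unfolding t(3) by (rule R.m_assoc[symmetric, OF pp pp t(2)])
          also have "p [^] ?l \<otimes> p [^] i = p [^] k" using nat_pow_mult[OF p(1), of ?l i] l(2) by simp
          also have "p [^] k \<otimes> t = t \<otimes> p [^] k" by (rule R.m_comm[OF pp t(2)])
          finally show ?thesis
            unfolding u(2) smult_assoc1[OF pp s' uc, symmetric] by (simp add: smult_assoc1[OF t(2) pp uc])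
        qed
        finally have "t *\<^sub>M (p *\<^sub>M a) \<in> ?H (Suc k)" .
        moreover have "p *\<^sub>M (p *\<^sub>M a) \<in> ?H (Suc k)" unfolding ppA[OF aA] by (rule submoduleD(2)[OF sD])
        ultimately show False using prime_combination[OF p t(2,4) sD pac] pak(2) by blast
      qed
    qed
    obtain C where C: "submodule C R M" "?C0 \<subseteq> C" "C \<subseteq> D" "D = cyc v +\<^sub>S C"
      "\<And>r. \<lbrakk>r \<in> carrier R; r *\<^sub>M v \<in> C\<rbrakk> \<Longrightarrow> p [^] Suc h divides r"
      using split_cyclic[OF D C0 C0D p vD pv sc so] by blast
    have uC: "u \<in> C"
      using C(2) set_add_upper(2)[OF A'(1) K] set_add_upper(1)[OF cu sD] cyc_self[OF uc] by blast
    have A'C: "A' \<subseteq> C" using C(2) set_add_upper(1)[OF A'(1) K] by blast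
    let ?HC = "scaled (p [^] Suc k) C"
    have HC: "submodule ?HC R M" using submodule_image_smult[OF C(1) pp] .
    have HCC: "?HC \<subseteq> C" using submoduleD(4)[OF C(1) pp] by blast
    let ?C1 = "A' +\<^sub>S ?HC"
    have C1: "submodule ?C1 R M" using submodule_set_add[OF A'(1) HC] .
    have C1C: "?C1 \<subseteq> C" by (rule set_add_least[OF C(1) A'C HCC])
    have so1: "p [^] k *\<^sub>M u \<notin> ?C1" unfolding u(2)[symmetric] by (rule outside) (use C(3) in blast)
    obtain C2 where C2: "submodule C2 R M" "?C1 \<subseteq> C2" "C2 \<subseteq> C" "C = cyc u +\<^sub>S C2"
      "\<And>r. \<lbrakk>r \<in> carrier R; r *\<^sub>M u \<in> C2\<rbrakk> \<Longrightarrow> p [^] Suc k divides r"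
      using split_cyclic[OF C(1) C1 C1C p uC pu set_add_upper(2)[OF A'(1) HC] so1] by blast
    have A'C2: "A' \<subseteq> C2" using C2(2) set_add_upper(1)[OF A'(1) HC] by blast
    let ?E = "cyc u +\<^sub>S cyc v"
    have cv: "submodule (cyc v) R M" using submodule_cyc[OF vc] .
    have E: "submodule ?E R M" using submodule_set_add[OF cu cv] .
    note Eup = set_add_upper[OF cu cv]
    have Egen: "\<exists>r \<in> carrier R. \<exists>s \<in> carrier R. x = r *\<^sub>M u +\<^sub>M s *\<^sub>M v" if "x \<in> ?E" for x
      using that by (auto simp: mem_set_add cyc_def)
    have ru0: "r *\<^sub>M u = \<zero>\<^sub>M" if "p [^] Suc k divides r" for r
      by (rule annihilator_of_divides[OF uc pp pu that])
    have sv0: "s *\<^sub>M v = \<zero>\<^sub>M" if "p [^] Suc h divides s" for s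
      by (rule annihilator_of_divides[OF vc pp pv that])
    have indep: "p [^] Suc k divides r \<and> p [^] Suc h divides s"
      if r: "r \<in> carrier R" and s: "s \<in> carrier R" and mem: "r *\<^sub>M u +\<^sub>M s *\<^sub>M v \<in> C2" for r s
    proof -
      have "s *\<^sub>M v \<in> C"
        by (rule add_mem_cancel_left[OF C(1) _ submoduleD(4)[OF C(1) r uC]]) (use mem C2(3) s vc in auto)
      then have d: "p [^] Suc h divides s" using C(5)[OF s] by blast
      then have "r *\<^sub>M u \<in> C2" using mem sv0[OF d] r uc by simp
      then show ?thesis using C2(5)[OF r] d by blast
    qed
    have rel: "r *\<^sub>M u +\<^sub>M s *\<^sub>M v = \<zero>\<^sub>M \<longleftrightarrow> p [^] Suc k divides r \<and> p [^] Suc h divides s"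
      if r: "r \<in> carrier R" and s: "s \<in> carrier R" for r s
    proof
      assume "r *\<^sub>M u +\<^sub>M s *\<^sub>M v = \<zero>\<^sub>M"
      then show "p [^] Suc k divides r \<and> p [^] Suc h divides s"
        using indep[OF r s] submoduleD(2)[OF C2(1)] by metis
    qed (simp add: ru0 sv0)
    have aE: "a \<in> ?E" unfolding a_eq mem_set_add cyc_def using pp by blast
    have "presented R (p [^] Suc k) (p [^] Suc h) (p [^] (k - 1)) (p [^] h) (sub_pair ?E (cyc a))"
    proof (rule presented_sub_pairI[OF E _ _ Egen rel])
      show "u \<in> ?E" "v \<in> ?E" using Eup cyc_self uc vc by auto
      show "cyc a = cyc (p [^] (k - 1) *\<^sub>M u +\<^sub>M p [^] h *\<^sub>M v)" unfolding a_eq[symmetric] ..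
    qed
    then have "presented_bipicket R p (sub_pair ?E (cyc a))"
      unfolding presented_bipicket_def using hk2
      by (intro exI[of _ "Suc h"] exI[of _ "Suc k"]) simp
    moreover have "pair_split D A ?E (cyc a) C2 A'"
      unfolding pair_split_def
    proof (intro conjI E submodule_cyc ac cyc_least[OF E aE] C2(1) A'(1) A'C2 A'(4))
      show "D = ?E +\<^sub>S C2"
      proof
        have EC: "submodule (?E +\<^sub>S C2) R M" using submodule_set_add[OF E C2(1)] .
        note up = set_add_upper[OF E C2(1)]
        show "?E +\<^sub>S C2 \<subseteq> D"
          by (intro set_add_least[OF D] cyc_least[OF D] u vD) (use C2 C in blast)
        have "C \<subseteq> ?E +\<^sub>S C2" unfolding C2(4) by (rule set_add_least[OF EC]) (use up Eup in blast)+
        moreover have "cyc v \<subseteq> ?E +\<^sub>S C2" using up Eup by blast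
        ultimately show "D \<subseteq> ?E +\<^sub>S C2" unfolding C(4) using set_add_least[OF EC] by blast
      qed
      show "?E \<inter> C2 = {\<zero>\<^sub>M}"
      proof
        show "{\<zero>\<^sub>M} \<subseteq> ?E \<inter> C2" using submoduleD(2)[OF E] submoduleD(2)[OF C2(1)] by simp
        show "?E \<inter> C2 \<subseteq> {\<zero>\<^sub>M}"
        proof
          fix x assume x: "x \<in> ?E \<inter> C2"
          then obtain r s where rs: "r \<in> carrier R" "s \<in> carrier R" "x = r *\<^sub>M u +\<^sub>M s *\<^sub>M v"
            using Egen by blast
          have "p [^] Suc k divides r \<and> p [^] Suc h divides s"
            by (rule indep[OF rs(1,2)]) (use x in \<open>simp only: rs(3)[symmetric] Int_iff\<close>)
          then show "x \<in> {\<zero>\<^sub>M}" unfolding rs(3) by (simp only: ru0 sv0) simp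
        qed
      qed
    qed
    ultimately show ?thesis by blast
  qed
qed

lemma split_standard_summand:
  assumes D: "submodule D R M" "D \<noteq> {\<zero>\<^sub>M}" and A: "submodule A R M" "A \<subseteq> D"
    and p: "p \<in> carrier R" "ring_prime p" and ppA: "\<And>a. a \<in> A \<Longrightarrow> p *\<^sub>M (p *\<^sub>M a) = \<zero>\<^sub>M"
  shows "\<exists>E A1 C A2. pair_split D A E A1 C A2 \<and> standard_pair R p (sub_pair E A1)"
proof (cases "\<exists>w \<in> D. \<forall>r \<in> carrier R. r *\<^sub>M w = \<zero>\<^sub>M \<longrightarrow> r = \<zero>")
  case True
  then obtain w where w: "w \<in> D" "\<And>r. \<lbrakk>r \<in> carrier R; r *\<^sub>M w = \<zero>\<^sub>M\<rbrakk> \<Longrightarrow> r = \<zero>" by blast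
  have "(p \<otimes> p) *\<^sub>M a = \<zero>\<^sub>M" if "a \<in> A" for a
    using ppA[OF that] submoduleD(1)[OF A(1) that] p by (simp add: smult_assoc1)
  moreover have "p \<otimes> p \<noteq> \<zero>" using p ring_primeE(1)[OF p] by (simp add: integral_iff)
  ultimately show ?thesis
    using split_non_torsion[OF D(1) A _ _ _ w, of "p \<otimes> p"] p unfolding standard_pair_def by blast
next
  case False
  then have "\<exists>c \<in> carrier R. c \<noteq> \<zero> \<and> c *\<^sub>M y \<in> {\<zero>\<^sub>M}" if "y \<in> D" for y using that by auto
  then obtain c where c: "c \<in> carrier R" "c \<noteq> \<zero>" "\<And>y. y \<in> D \<Longrightarrow> c *\<^sub>M y = \<zero>\<^sub>M"
    using common_denominator[OF D(1) submodule_zero_set] by (metis singletonD)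
  consider "A = {\<zero>\<^sub>M}" | a where "a \<in> A" "a \<noteq> \<zero>\<^sub>M" "\<And>a. a \<in> A \<Longrightarrow> p *\<^sub>M a = \<zero>\<^sub>M"
    | b where "b \<in> A" "p *\<^sub>M b \<noteq> \<zero>\<^sub>M" using submoduleD(2)[OF A(1)] by blast
  then show ?thesis
  proof cases
    case 1
    then show ?thesis using split_bounded_zero[OF D p c] unfolding standard_pair_def by blast
  next
    case 2
    then show ?thesis using split_bounded_elementary[OF D(1) A p c 2(3,1,2)] unfolding standard_pair_def by blast
  next
    case 3
    then show ?thesis using split_bounded_square[OF D(1) A p c ppA 3] unfolding standard_pair_def by blast
  qed
qed

end

section \<open>Standard pairs are determined by their presentation\<close>

text \<open>
  An element may have several pairs of coefficients. The hypothesis on relations says that the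
  choice made for \<open>f\<close> does not matter.
\<close>

lemma presented_map:
  assumes M: "module R M" and N: "module R N"
    and u: "u \<in> carrier M" "v \<in> carrier M" and w: "u' \<in> carrier N" "v' \<in> carrier N"
    and gen: "\<And>x. x \<in> carrier M \<Longrightarrow> \<exists>r \<in> carrier R. \<exists>s \<in> carrier R. x = r \<odot>\<^bsub>M\<^esub> u \<oplus>\<^bsub>M\<^esub> s \<odot>\<^bsub>M\<^esub> v"
    and rel: "\<And>r s. \<lbrakk>r \<in> carrier R; s \<in> carrier R; r \<odot>\<^bsub>M\<^esub> u \<oplus>\<^bsub>M\<^esub> s \<odot>\<^bsub>M\<^esub> v = \<zero>\<^bsub>M\<^esub>\<rbrakk> \<Longrightarrow>
      r \<odot>\<^bsub>N\<^esub> u' \<oplus>\<^bsub>N\<^esub> s \<odot>\<^bsub>N\<^esub> v' = \<zero>\<^bsub>N\<^esub>"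
  obtains f where "f \<in> mod_hom R M N"
    "\<forall>r \<in> carrier R. \<forall>s \<in> carrier R. f (r \<odot>\<^bsub>M\<^esub> u \<oplus>\<^bsub>M\<^esub> s \<odot>\<^bsub>M\<^esub> v) = r \<odot>\<^bsub>N\<^esub> u' \<oplus>\<^bsub>N\<^esub> s \<odot>\<^bsub>N\<^esub> v'"
proof -
  interpret M: module R M by fact
  interpret N: module R N by fact
  let ?m = "\<lambda>r s. r \<odot>\<^bsub>M\<^esub> u \<oplus>\<^bsub>M\<^esub> s \<odot>\<^bsub>M\<^esub> v" and ?n = "\<lambda>r s. r \<odot>\<^bsub>N\<^esub> u' \<oplus>\<^bsub>N\<^esub> s \<odot>\<^bsub>N\<^esub> v'"
  have m_add: "?m r s \<oplus>\<^bsub>M\<^esub> ?m r' s' = ?m (r \<oplus>\<^bsub>R\<^esub> r') (s \<oplus>\<^bsub>R\<^esub> s')"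
    and n_add: "?n r s \<oplus>\<^bsub>N\<^esub> ?n r' s' = ?n (r \<oplus>\<^bsub>R\<^esub> r') (s \<oplus>\<^bsub>R\<^esub> s')"
    if "r \<in> carrier R" "s \<in> carrier R" "r' \<in> carrier R" "s' \<in> carrier R" for r s r' s'
    using that u w by (simp_all add: M.smult_l_distr N.smult_l_distr M.M.a_ac N.M.a_ac)
  have m_smult: "t \<odot>\<^bsub>M\<^esub> ?m r s = ?m (t \<otimes>\<^bsub>R\<^esub> r) (t \<otimes>\<^bsub>R\<^esub> s)"
    and n_smult: "t \<odot>\<^bsub>N\<^esub> ?n r s = ?n (t \<otimes>\<^bsub>R\<^esub> r) (t \<otimes>\<^bsub>R\<^esub> s)"
    if "r \<in> carrier R" "s \<in> carrier R" "t \<in> carrier R" for r s t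
    using that u w by (simp_all add: M.smult_r_distr N.smult_r_distr M.smult_assoc1 N.smult_assoc1)
  have mc: "?m r s \<in> carrier M" and nc: "?n r s \<in> carrier N" if "r \<in> carrier R" "s \<in> carrier R" for r s
    using that u w by simp_all
  have wd: "?n r s = ?n r' s'" if c: "r \<in> carrier R" "s \<in> carrier R" "r' \<in> carrier R" "s' \<in> carrier R"
    and e: "?m r s = ?m r' s'" for r s r' s'
  proof -
    let ?i = "\<ominus>\<^bsub>R\<^esub> \<one>\<^bsub>R\<^esub>"
    have i: "?i \<in> carrier R" by simp
    have "?m (r \<oplus>\<^bsub>R\<^esub> ?i \<otimes>\<^bsub>R\<^esub> r') (s \<oplus>\<^bsub>R\<^esub> ?i \<otimes>\<^bsub>R\<^esub> s') = ?m r' s' \<oplus>\<^bsub>M\<^esub> ?i \<odot>\<^bsub>M\<^esub> ?m r' s'"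
      using m_add[of r s "?i \<otimes>\<^bsub>R\<^esub> r'" "?i \<otimes>\<^bsub>R\<^esub> s'"] m_smult[of r' s' ?i] c i e by simp
    also have "\<dots> = \<zero>\<^bsub>M\<^esub>" using mc[OF c(3,4)] by (simp add: M.smult_l_minus M.M.r_neg)
    finally have "?n (r \<oplus>\<^bsub>R\<^esub> ?i \<otimes>\<^bsub>R\<^esub> r') (s \<oplus>\<^bsub>R\<^esub> ?i \<otimes>\<^bsub>R\<^esub> s') = \<zero>\<^bsub>N\<^esub>"
      using rel[of "r \<oplus>\<^bsub>R\<^esub> ?i \<otimes>\<^bsub>R\<^esub> r'" "s \<oplus>\<^bsub>R\<^esub> ?i \<otimes>\<^bsub>R\<^esub> s'"] c i by simp
    then have "?n r s \<oplus>\<^bsub>N\<^esub> ?i \<odot>\<^bsub>N\<^esub> ?n r' s' = \<zero>\<^bsub>N\<^esub>"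
      using n_add[of r s "?i \<otimes>\<^bsub>R\<^esub> r'" "?i \<otimes>\<^bsub>R\<^esub> s'"] n_smult[of r' s' ?i] c i by simp
    then have "?n r s \<oplus>\<^bsub>N\<^esub> \<ominus>\<^bsub>N\<^esub> ?n r' s' = \<zero>\<^bsub>N\<^esub>"
      using nc[OF c(3,4)] by (simp add: N.smult_l_minus)
    then show ?thesis
      using N.M.minus_equality[of "?n r s" "\<ominus>\<^bsub>N\<^esub> ?n r' s'"] nc[OF c(1,2)] nc[OF c(3,4)] by simp
  qed
  define f where "f x = (SOME y. \<exists>r \<in> carrier R. \<exists>s \<in> carrier R. x = ?m r s \<and> y = ?n r s)" for x
  have f: "f (?m r s) = ?n r s" if c: "r \<in> carrier R" "s \<in> carrier R" for r s
  proof -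
    have "\<exists>r' \<in> carrier R. \<exists>s' \<in> carrier R. ?m r s = ?m r' s' \<and> f (?m r s) = ?n r' s'"
      unfolding f_def by (rule someI_ex) (use c in blast)
    then show ?thesis using wd c by metis
  qed
  have "f \<in> mod_hom R M N"
    unfolding mod_hom_def hom_def
  proof (intro CollectI conjI ballI)
    show "f \<in> carrier (add_monoid M) \<rightarrow> carrier (add_monoid N)"
      using gen f nc by (auto simp: Pi_def) metis
    fix x y assume "x \<in> carrier (add_monoid M)" "y \<in> carrier (add_monoid M)"
    then obtain r s r' s' where *: "r \<in> carrier R" "s \<in> carrier R" "r' \<in> carrier R" "s' \<in> carrier R"
      "x = ?m r s" "y = ?m r' s'" using gen by (metis partial_object.select_convs(1))
    then show "f (x \<otimes>\<^bsub>add_monoid M\<^esub> y) = f x \<otimes>\<^bsub>add_monoid N\<^esub> f y"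
      using m_add[OF *(1-4)] n_add[OF *(1-4)] f[OF *(1,2)] f[OF *(3,4)] f[of "r \<oplus>\<^bsub>R\<^esub> r'" "s \<oplus>\<^bsub>R\<^esub> s'"] by simp
  next
    fix t x assume t: "t \<in> carrier R" and "x \<in> carrier M"
    then obtain r s where *: "r \<in> carrier R" "s \<in> carrier R" "x = ?m r s" using gen by blast
    then show "f (t \<odot>\<^bsub>M\<^esub> x) = t \<odot>\<^bsub>N\<^esub> f x"
      using m_smult[OF *(1,2) t] n_smult[OF *(1,2) t] f[OF *(1,2)] f[of "t \<otimes>\<^bsub>R\<^esub> r" "t \<otimes>\<^bsub>R\<^esub> s"] t by simp
  qed
  with f that show ?thesis by blast
qed

lemma presentedE:
  assumes "presented R d e a b U"
  obtains u v where "module R (fst U)" "u \<in> carrier (fst U)" "v \<in> carrier (fst U)"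
    "\<forall>x \<in> carrier (fst U). \<exists>r \<in> carrier R. \<exists>s \<in> carrier R. x = r \<odot>\<^bsub>fst U\<^esub> u \<oplus>\<^bsub>fst U\<^esub> s \<odot>\<^bsub>fst U\<^esub> v"
    "\<forall>r \<in> carrier R. \<forall>s \<in> carrier R.
       r \<odot>\<^bsub>fst U\<^esub> u \<oplus>\<^bsub>fst U\<^esub> s \<odot>\<^bsub>fst U\<^esub> v = \<zero>\<^bsub>fst U\<^esub> \<longleftrightarrow> d divides\<^bsub>R\<^esub> r \<and> e divides\<^bsub>R\<^esub> s"
    "snd U = (\<lambda>r. r \<odot>\<^bsub>fst U\<^esub> (a \<odot>\<^bsub>fst U\<^esub> u \<oplus>\<^bsub>fst U\<^esub> b \<odot>\<^bsub>fst U\<^esub> v)) ` carrier R"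
  using assms unfolding presented_def by (elim conjE bexE) (rule that)

lemma presented_iso:
  assumes U: "presented R d e a b U" and V: "presented R d e a b V"
    and ab: "a \<in> carrier R" "b \<in> carrier R"
  shows "pair_iso R U V"
proof -
  obtain u v where u: "module R (fst U)" "u \<in> carrier (fst U)" "v \<in> carrier (fst U)"
    "\<forall>x \<in> carrier (fst U). \<exists>r \<in> carrier R. \<exists>s \<in> carrier R. x = r \<odot>\<^bsub>fst U\<^esub> u \<oplus>\<^bsub>fst U\<^esub> s \<odot>\<^bsub>fst U\<^esub> v"
    "\<forall>r \<in> carrier R. \<forall>s \<in> carrier R.
       r \<odot>\<^bsub>fst U\<^esub> u \<oplus>\<^bsub>fst U\<^esub> s \<odot>\<^bsub>fst U\<^esub> v = \<zero>\<^bsub>fst U\<^esub> \<longleftrightarrow> d divides\<^bsub>R\<^esub> r \<and> e divides\<^bsub>R\<^esub> s"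
    "snd U = (\<lambda>r. r \<odot>\<^bsub>fst U\<^esub> (a \<odot>\<^bsub>fst U\<^esub> u \<oplus>\<^bsub>fst U\<^esub> b \<odot>\<^bsub>fst U\<^esub> v)) ` carrier R"
    by (rule presentedE[OF U])
  obtain u' v' where u': "module R (fst V)" "u' \<in> carrier (fst V)" "v' \<in> carrier (fst V)"
    "\<forall>x \<in> carrier (fst V). \<exists>r \<in> carrier R. \<exists>s \<in> carrier R. x = r \<odot>\<^bsub>fst V\<^esub> u' \<oplus>\<^bsub>fst V\<^esub> s \<odot>\<^bsub>fst V\<^esub> v'"
    "\<forall>r \<in> carrier R. \<forall>s \<in> carrier R.
       r \<odot>\<^bsub>fst V\<^esub> u' \<oplus>\<^bsub>fst V\<^esub> s \<odot>\<^bsub>fst V\<^esub> v' = \<zero>\<^bsub>fst V\<^esub> \<longleftrightarrow> d divides\<^bsub>R\<^esub> r \<and> e divides\<^bsub>R\<^esub> s"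
    "snd V = (\<lambda>r. r \<odot>\<^bsub>fst V\<^esub> (a \<odot>\<^bsub>fst V\<^esub> u' \<oplus>\<^bsub>fst V\<^esub> b \<odot>\<^bsub>fst V\<^esub> v')) ` carrier R"
    by (rule presentedE[OF V])
  interpret U: module R "fst U" by (rule u(1))
  interpret V: module R "fst V" by (rule u'(1))
  have rel: "r \<odot>\<^bsub>fst U\<^esub> u \<oplus>\<^bsub>fst U\<^esub> s \<odot>\<^bsub>fst U\<^esub> v = \<zero>\<^bsub>fst U\<^esub> \<longleftrightarrow>
      r \<odot>\<^bsub>fst V\<^esub> u' \<oplus>\<^bsub>fst V\<^esub> s \<odot>\<^bsub>fst V\<^esub> v' = \<zero>\<^bsub>fst V\<^esub>"
    if "r \<in> carrier R" "s \<in> carrier R" for r s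
    unfolding u(5)[rule_format, OF that] u'(5)[rule_format, OF that] ..
  obtain f where f: "f \<in> mod_hom R (fst U) (fst V)"
    "\<forall>r \<in> carrier R. \<forall>s \<in> carrier R.
       f (r \<odot>\<^bsub>fst U\<^esub> u \<oplus>\<^bsub>fst U\<^esub> s \<odot>\<^bsub>fst U\<^esub> v) = r \<odot>\<^bsub>fst V\<^esub> u' \<oplus>\<^bsub>fst V\<^esub> s \<odot>\<^bsub>fst V\<^esub> v'"
    by (rule presented_map[OF u(1) u'(1) u(2,3) u'(2,3) u(4)[rule_format] rel[THEN iffD1]])
  obtain g where g: "g \<in> mod_hom R (fst V) (fst U)"
    "\<forall>r \<in> carrier R. \<forall>s \<in> carrier R.
       g (r \<odot>\<^bsub>fst V\<^esub> u' \<oplus>\<^bsub>fst V\<^esub> s \<odot>\<^bsub>fst V\<^esub> v') = r \<odot>\<^bsub>fst U\<^esub> u \<oplus>\<^bsub>fst U\<^esub> s \<odot>\<^bsub>fst U\<^esub> v"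
    by (rule presented_map[OF u'(1) u(1) u'(2,3) u(2,3) u'(4)[rule_format] rel[THEN iffD2]])
  have "f x \<in> snd V" if x: "x \<in> snd U" for x
  proof -
    obtain r where r: "r \<in> carrier R" "x = r \<odot>\<^bsub>fst U\<^esub> (a \<odot>\<^bsub>fst U\<^esub> u \<oplus>\<^bsub>fst U\<^esub> b \<odot>\<^bsub>fst U\<^esub> v)" using x unfolding u(6) by blast
    have "f x = r \<odot>\<^bsub>fst V\<^esub> (a \<odot>\<^bsub>fst V\<^esub> u' \<oplus>\<^bsub>fst V\<^esub> b \<odot>\<^bsub>fst V\<^esub> v')"
      unfolding r(2) using f(2)[rule_format, OF ab] mod_homD(3)[OF f(1) r(1)] ab u by simp
    then show ?thesis using r(1) unfolding u'(6) by blast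
  qed
  then have f': "f \<in> pair_hom R U V" using f(1) by (auto simp: pair_hom_def split: prod.splits)
  have "g x \<in> snd U" if x: "x \<in> snd V" for x
  proof -
    obtain r where r: "r \<in> carrier R" "x = r \<odot>\<^bsub>fst V\<^esub> (a \<odot>\<^bsub>fst V\<^esub> u' \<oplus>\<^bsub>fst V\<^esub> b \<odot>\<^bsub>fst V\<^esub> v')" using x unfolding u'(6) by blast
    have "g x = r \<odot>\<^bsub>fst U\<^esub> (a \<odot>\<^bsub>fst U\<^esub> u \<oplus>\<^bsub>fst U\<^esub> b \<odot>\<^bsub>fst U\<^esub> v)"
      unfolding r(2) using g(2)[rule_format, OF ab] mod_homD(3)[OF g(1) r(1)] ab u' by simp
    then show ?thesis using r(1) unfolding u(6) by blast
  qed
  then have g': "g \<in> pair_hom R V U" using g(1) by (auto simp: pair_hom_def split: prod.splits)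
  show ?thesis
  proof (rule pair_isoI[OF f' g'])
    fix x assume "x \<in> carrier (fst U)"
    then obtain r s where "r \<in> carrier R" "s \<in> carrier R" "x = r \<odot>\<^bsub>fst U\<^esub> u \<oplus>\<^bsub>fst U\<^esub> s \<odot>\<^bsub>fst U\<^esub> v" using u(4) by blast
    then show "g (f x) = x" by (simp add: f(2) g(2))
  next
    fix x assume "x \<in> carrier (fst V)"
    then obtain r s where "r \<in> carrier R" "s \<in> carrier R" "x = r \<odot>\<^bsub>fst V\<^esub> u' \<oplus>\<^bsub>fst V\<^esub> s \<odot>\<^bsub>fst V\<^esub> v'" using u'(4) by blast
    then show "f (g x) = x" by (simp add: f(2) g(2))
  qed
qed

lemma presented_iso_invariant:
  assumes U: "presented R d e a b U" and iso: "pair_iso R U V" and mV: "module R (fst V)"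
    and ab: "a \<in> carrier R" "b \<in> carrier R" and sV: "snd V \<subseteq> carrier (fst V)"
  shows "presented R d e a b V"
proof -
  obtain u v where u: "module R (fst U)" "u \<in> carrier (fst U)" "v \<in> carrier (fst U)"
    "\<forall>x \<in> carrier (fst U). \<exists>r \<in> carrier R. \<exists>s \<in> carrier R. x = r \<odot>\<^bsub>fst U\<^esub> u \<oplus>\<^bsub>fst U\<^esub> s \<odot>\<^bsub>fst U\<^esub> v"
    "\<forall>r \<in> carrier R. \<forall>s \<in> carrier R.
       r \<odot>\<^bsub>fst U\<^esub> u \<oplus>\<^bsub>fst U\<^esub> s \<odot>\<^bsub>fst U\<^esub> v = \<zero>\<^bsub>fst U\<^esub> \<longleftrightarrow> d divides\<^bsub>R\<^esub> r \<and> e divides\<^bsub>R\<^esub> s"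
    "snd U = (\<lambda>r. r \<odot>\<^bsub>fst U\<^esub> (a \<odot>\<^bsub>fst U\<^esub> u \<oplus>\<^bsub>fst U\<^esub> b \<odot>\<^bsub>fst U\<^esub> v)) ` carrier R"
    by (rule presentedE[OF U])
  interpret U: module R "fst U" by (rule u(1))
  interpret V: module R "fst V" by (rule mV)
  obtain f g where f: "f \<in> pair_hom R U V" and g: "g \<in> pair_hom R V U"
    and gf: "\<And>x. x \<in> carrier (fst U) \<Longrightarrow> g (f x) = x" and fg: "\<And>y. y \<in> carrier (fst V) \<Longrightarrow> f (g y) = y"
    using pair_isoE[OF iso] by metis
  note f' = pair_homD[OF f] and g' = pair_homD[OF g]
  have lin: "f (r \<odot>\<^bsub>fst U\<^esub> u \<oplus>\<^bsub>fst U\<^esub> s \<odot>\<^bsub>fst U\<^esub> v) = r \<odot>\<^bsub>fst V\<^esub> f u \<oplus>\<^bsub>fst V\<^esub> s \<odot>\<^bsub>fst V\<^esub> f v"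
    if "r \<in> carrier R" "s \<in> carrier R" for r s using that u(2,3) f'(2,3) by simp
  have z: "f x = \<zero>\<^bsub>fst V\<^esub> \<longleftrightarrow> x = \<zero>\<^bsub>fst U\<^esub>" if "x \<in> carrier (fst U)" for x
    using pair_hom_zero[OF f u(1) mV] pair_hom_zero[OF g mV u(1)] gf[OF that] by metis
  have gen: "\<exists>r \<in> carrier R. \<exists>s \<in> carrier R. y = r \<odot>\<^bsub>fst V\<^esub> f u \<oplus>\<^bsub>fst V\<^esub> s \<odot>\<^bsub>fst V\<^esub> f v"
    if y: "y \<in> carrier (fst V)" for y
  proof -
    obtain r s where rs: "r \<in> carrier R" "s \<in> carrier R" "g y = r \<odot>\<^bsub>fst U\<^esub> u \<oplus>\<^bsub>fst U\<^esub> s \<odot>\<^bsub>fst U\<^esub> v"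
      using u(4) g'(1)[OF y] by blast
    have "y = f (r \<odot>\<^bsub>fst U\<^esub> u \<oplus>\<^bsub>fst U\<^esub> s \<odot>\<^bsub>fst U\<^esub> v)" unfolding rs(3)[symmetric] fg[OF y] ..
    then show ?thesis using lin[OF rs(1,2)] rs(1,2) by auto
  qed
  have rel: "(r \<odot>\<^bsub>fst V\<^esub> f u \<oplus>\<^bsub>fst V\<^esub> s \<odot>\<^bsub>fst V\<^esub> f v = \<zero>\<^bsub>fst V\<^esub>) = (d divides\<^bsub>R\<^esub> r \<and> e divides\<^bsub>R\<^esub> s)"
    if rs: "r \<in> carrier R" "s \<in> carrier R" for r s
  proof -
    have c: "r \<odot>\<^bsub>fst U\<^esub> u \<oplus>\<^bsub>fst U\<^esub> s \<odot>\<^bsub>fst U\<^esub> v \<in> carrier (fst U)" using rs u by simp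
    show ?thesis unfolding lin[OF rs, symmetric] z[OF c] u(5)[rule_format, OF rs] ..
  qed
  let ?a = "a \<odot>\<^bsub>fst U\<^esub> u \<oplus>\<^bsub>fst U\<^esub> b \<odot>\<^bsub>fst U\<^esub> v"
  have ac: "?a \<in> carrier (fst U)" using ab u by simp
  have "snd V = f ` snd U"
  proof
    show "f ` snd U \<subseteq> snd V" using f'(4) by blast
    show "snd V \<subseteq> f ` snd U"
    proof
      fix y assume y: "y \<in> snd V"
      have "f (g y) = y" using fg sV y by blast
      then show "y \<in> f ` snd U" using imageI[OF g'(4)[OF y], of f] by simp
    qed
  qed
  also have "\<dots> = (\<lambda>r. r \<odot>\<^bsub>fst V\<^esub> f ?a) ` carrier R"
    unfolding u(6) image_image by (rule image_cong[OF refl f'(3)[OF _ ac]])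
  finally have sub: "snd V = (\<lambda>r. r \<odot>\<^bsub>fst V\<^esub> (a \<odot>\<^bsub>fst V\<^esub> f u \<oplus>\<^bsub>fst V\<^esub> b \<odot>\<^bsub>fst V\<^esub> f v)) ` carrier R"
    unfolding lin[OF ab] .
  show ?thesis unfolding presented_def
    by (intro conjI mV bexI[OF _ f'(1)[OF u(2)]] bexI[OF _ f'(1)[OF u(3)]] ballI gen rel sub)
qed

section \<open>Torsion standard pairs have local endomorphism rings\<close>

lemma (in abelian_group) a_inv_zero: "\<ominus> \<zero> = \<zero>"
  using minus_equality[of \<zero> \<zero>] by simp

lemma mod_hom_scale:
  assumes "module R M" "r \<in> carrier R" shows "(\<lambda>x. r \<odot>\<^bsub>M\<^esub> x) \<in> mod_hom R M M"
proof -
  interpret M: module R M by fact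
  show ?thesis using assms(2)
    by (auto simp: mod_hom_def hom_def M.smult_r_distr M.smult_assoc1[symmetric] M.R.m_comm)
qed

lemma mod_hom_funpow: "g \<in> mod_hom R M M \<Longrightarrow> x \<in> carrier M \<Longrightarrow> (g ^^ k) x \<in> carrier M"
  by (induction k) (auto intro: mod_homD(1))

text \<open>
  The homomorphism \<open>f\<close> differs from the multiplication by \<open>r\<close> by a nilpotent map \<open>g\<close>. Where
  \<open>r\<close> acts invertibly so does \<open>f\<close>, on the module as well as on every submodule stable
  under \<open>f\<close>: if \<open>s r = 1\<close>, then \<open>x = f(s x) - s g(x)\<close>, and \<open>g(x)\<close> is annihilated by a smaller power of \<open>g\<close>.
\<close>

lemma (in principal_domain) auto_if_unipotent:
  assumes U: "mpair R U" and q: "q \<in> carrier R" "ring_prime q" and r: "r \<in> carrier R" "\<not> q divides r"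
    and N: "\<And>x. x \<in> carrier (fst U) \<Longrightarrow> q [^] (N::nat) \<odot>\<^bsub>fst U\<^esub> x = \<zero>\<^bsub>fst U\<^esub>"
    and f: "f \<in> pair_hom R U U"
    and nil: "\<And>x. x \<in> carrier (fst U) \<Longrightarrow> ((\<lambda>x. f x \<ominus>\<^bsub>fst U\<^esub> r \<odot>\<^bsub>fst U\<^esub> x) ^^ k) x = \<zero>\<^bsub>fst U\<^esub>"
  shows "pair_auto R U f"
proof -
  interpret U: module R "fst U" by (rule mpairD(1)[OF U])
  interpret P: pid_module R "fst U" ..
  define g where "g x = f x \<ominus>\<^bsub>fst U\<^esub> r \<odot>\<^bsub>fst U\<^esub> x" for x
  have fm: "f \<in> mod_hom R (fst U) (fst U)" using pair_hom_mod_hom[OF f] .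
  have g: "g \<in> mod_hom R (fst U) (fst U)"
    using module_minus_hom[OF U.module_axioms U.module_axioms fm mod_hom_scale[OF U.module_axioms r(1)]]
    unfolding g_def .
  note f' = mod_homD[OF fm] and g' = mod_homD[OF g]
  have gg: "g = (\<lambda>x. f x \<ominus>\<^bsub>fst U\<^esub> r \<odot>\<^bsub>fst U\<^esub> x)" by (simp add: fun_eq_iff g_def)
  obtain s t where st: "s \<in> carrier R" "t \<in> carrier R" "s \<otimes> r \<oplus> t \<otimes> q [^] N = \<one>"
    using prime_pow_coprime[OF q r] by blast
  have sr: "s \<odot>\<^bsub>fst U\<^esub> (r \<odot>\<^bsub>fst U\<^esub> x) = x" if x: "x \<in> carrier (fst U)" for x
  proof -
    have "x = (s \<otimes> r \<oplus> t \<otimes> q [^] N) \<odot>\<^bsub>fst U\<^esub> x" using st(3) x by simp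
    also have "\<dots> = s \<odot>\<^bsub>fst U\<^esub> (r \<odot>\<^bsub>fst U\<^esub> x) \<oplus>\<^bsub>fst U\<^esub> t \<odot>\<^bsub>fst U\<^esub> (q [^] N \<odot>\<^bsub>fst U\<^esub> x)"
      using st(1,2) r q x by (simp add: U.smult_l_distr U.smult_assoc1)
    also have "\<dots> = s \<odot>\<^bsub>fst U\<^esub> (r \<odot>\<^bsub>fst U\<^esub> x)" using N[OF x] st(1,2) r x by simp
    finally show ?thesis by (rule sym)
  qed
  have fz: "f \<zero>\<^bsub>fst U\<^esub> = \<zero>\<^bsub>fst U\<^esub>" by (rule mod_hom_zero[OF fm U.module_axioms U.module_axioms])
  have f_eq: "f x = g x \<oplus>\<^bsub>fst U\<^esub> r \<odot>\<^bsub>fst U\<^esub> x" if "x \<in> carrier (fst U)" for x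
    unfolding g_def using P.diff_add_cancel f'(1)[OF that] r that by simp
  have onto: "x \<in> f ` C" if C: "submodule C R (fst U)" and fC: "f ` C \<subseteq> C"
    and x: "x \<in> C" "(g ^^ k) x = \<zero>\<^bsub>fst U\<^esub>" for C x k
    using x
  proof (induction k arbitrary: x)
    case 0
    then show ?case using fz P.submoduleD(2)[OF C] by (auto intro: image_eqI[of _ f "\<zero>\<^bsub>fst U\<^esub>"])
  next
    case (Suc k)
    note Cc = P.submoduleD(1)[OF C]
    have xc: "x \<in> carrier (fst U)" using Cc Suc.prems(1) .
    have "g x \<in> C" unfolding g_def using P.submoduleD(4,6)[OF C] fC Suc.prems(1) r by blast
    moreover have "(g ^^ k) (g x) = \<zero>\<^bsub>fst U\<^esub>" using Suc.prems(2) by (simp add: funpow_swap1)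
    ultimately obtain c where c: "c \<in> C" "g x = f c" using Suc.IH by blast
    have sx: "s \<odot>\<^bsub>fst U\<^esub> x \<in> C" "s \<odot>\<^bsub>fst U\<^esub> c \<in> C" using P.submoduleD(4)[OF C st(1)] Suc.prems(1) c by auto
    have "f (s \<odot>\<^bsub>fst U\<^esub> x) = s \<odot>\<^bsub>fst U\<^esub> g x \<oplus>\<^bsub>fst U\<^esub> x"
    proof -
      have "f (s \<odot>\<^bsub>fst U\<^esub> x) = s \<odot>\<^bsub>fst U\<^esub> (g x \<oplus>\<^bsub>fst U\<^esub> r \<odot>\<^bsub>fst U\<^esub> x)" using f'(3)[OF st(1) xc] f_eq[OF xc] by simp
      also have "\<dots> = s \<odot>\<^bsub>fst U\<^esub> g x \<oplus>\<^bsub>fst U\<^esub> s \<odot>\<^bsub>fst U\<^esub> (r \<odot>\<^bsub>fst U\<^esub> x)"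
        using g'(1)[OF xc] st r xc by (simp add: U.smult_r_distr)
      finally show ?thesis using sr[OF xc] by simp
    qed
    also have "s \<odot>\<^bsub>fst U\<^esub> g x = f (s \<odot>\<^bsub>fst U\<^esub> c)" using f'(3)[OF st(1) Cc[OF c(1)]] c(2) by simp
    finally have e: "f (s \<odot>\<^bsub>fst U\<^esub> x) = x \<oplus>\<^bsub>fst U\<^esub> f (s \<odot>\<^bsub>fst U\<^esub> c)"
      using f'(1)[OF Cc[OF sx(2)]] xc by (simp add: U.M.a_comm)
    have "f (s \<odot>\<^bsub>fst U\<^esub> x \<ominus>\<^bsub>fst U\<^esub> s \<odot>\<^bsub>fst U\<^esub> c) = f (s \<odot>\<^bsub>fst U\<^esub> x) \<ominus>\<^bsub>fst U\<^esub> f (s \<odot>\<^bsub>fst U\<^esub> c)"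
      unfolding a_minus_def
      using f'(2)[OF Cc[OF sx(1)] U.M.a_inv_closed[OF Cc[OF sx(2)]]]
        pair_hom_minus[OF f U.module_axioms U.module_axioms Cc[OF sx(2)]] by simp
    also have "\<dots> = x" by (rule P.diff_eqI[OF e xc f'(1)[OF Cc[OF sx(2)]]])
    finally show ?case using P.submoduleD(6)[OF C sx] by (metis image_eqI)
  qed
  have ker: "x = \<zero>\<^bsub>fst U\<^esub>" if "x \<in> carrier (fst U)" "f x = \<zero>\<^bsub>fst U\<^esub>" "(g ^^ k) x = \<zero>\<^bsub>fst U\<^esub>" for x k
    using that
  proof (induction k arbitrary: x)
    case (Suc k)
    have gx: "g x = \<ominus>\<^bsub>fst U\<^esub> (r \<odot>\<^bsub>fst U\<^esub> x)" unfolding g_def Suc.prems(2) a_minus_def using r Suc.prems(1) by simp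
    have rx: "r \<odot>\<^bsub>fst U\<^esub> x \<in> carrier (fst U)" using r Suc.prems(1) by simp
    have "f (g x) = \<zero>\<^bsub>fst U\<^esub>" unfolding gx
      using pair_hom_minus[OF f U.module_axioms U.module_axioms rx] f'(3)[OF r(1) Suc.prems(1)] Suc.prems(2) r by simp
    moreover have "(g ^^ k) (g x) = \<zero>\<^bsub>fst U\<^esub>" using Suc.prems(3) by (simp add: funpow_swap1)
    ultimately have "g x = \<zero>\<^bsub>fst U\<^esub>" using Suc.IH g'(1)[OF Suc.prems(1)] by blast
    then have "\<ominus>\<^bsub>fst U\<^esub> (\<ominus>\<^bsub>fst U\<^esub> (r \<odot>\<^bsub>fst U\<^esub> x)) = \<zero>\<^bsub>fst U\<^esub>" unfolding gx by (simp add: U.M.a_inv_zero)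
    then have "r \<odot>\<^bsub>fst U\<^esub> x = \<zero>\<^bsub>fst U\<^esub>" using rx by simp
    then show ?case using sr[OF Suc.prems(1)] st by simp
  qed simp
  have nil': "(g ^^ k) x = \<zero>\<^bsub>fst U\<^esub>" if "x \<in> carrier (fst U)" for x using nil[OF that] unfolding gg .
  have "inj_on f (carrier (fst U))"
  proof (rule inj_onI)
    fix x y assume xy: "x \<in> carrier (fst U)" "y \<in> carrier (fst U)" "f x = f y"
    have d: "x \<ominus>\<^bsub>fst U\<^esub> y \<in> carrier (fst U)" using xy by simp
    have "f (x \<ominus>\<^bsub>fst U\<^esub> y) = f x \<ominus>\<^bsub>fst U\<^esub> f y"
      unfolding a_minus_def using f'(2) pair_hom_minus[OF f U.module_axioms U.module_axioms xy(2)] xy by simp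
    also have "\<dots> = \<zero>\<^bsub>fst U\<^esub>" using xy f'(1) by (simp add: a_minus_def U.M.r_neg)
    finally have "x \<ominus>\<^bsub>fst U\<^esub> y = \<zero>\<^bsub>fst U\<^esub>" using ker[OF d _ nil'[OF d]] by blast
    then show "x = y" using P.diff_add_cancel[OF xy(1,2)] xy by simp
  qed
  moreover have "carrier (fst U) \<subseteq> f ` carrier (fst U)"
    using onto[OF U.carrier_is_submodule _ _ nil'] f'(1) by blast
  then have "f ` carrier (fst U) = carrier (fst U)" using f'(1) by blast
  ultimately have bij: "bij_betw f (carrier (fst U)) (carrier (fst U))" by (simp add: bij_betw_def)
  have "f ` snd U \<subseteq> snd U" using pair_homD(4)[OF f] by blast
  then have "snd U \<subseteq> f ` snd U" using onto[OF mpairD(2)[OF U] _ _ nil'] mpairD(3)[OF U] by blast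
  from pair_hom_inverse[OF f U.module_axioms mpairD(3)[OF U] bij this]
  show ?thesis unfolding pair_auto_def using f by blast
qed

lemma funpow_neg:
  assumes "module R M" "g \<in> mod_hom R M M" "x \<in> carrier M" "(g ^^ k) x = \<zero>\<^bsub>M\<^esub>"
  shows "((\<lambda>x. \<ominus>\<^bsub>M\<^esub> g x) ^^ k) x = \<zero>\<^bsub>M\<^esub>"
proof -
  interpret M: module R M by fact
  note g' = mod_homD[OF assms(2)]
  have neg: "g (\<ominus>\<^bsub>M\<^esub> y) = \<ominus>\<^bsub>M\<^esub> g y" if "y \<in> carrier M" for y
    using that g' by (simp add: M.minus_eq_smult)
  have "((\<lambda>x. \<ominus>\<^bsub>M\<^esub> g x) ^^ k) x = (g ^^ k) x \<or> ((\<lambda>x. \<ominus>\<^bsub>M\<^esub> g x) ^^ k) x = \<ominus>\<^bsub>M\<^esub> (g ^^ k) x" for k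
  proof (induction k)
    case (Suc k)
    have c: "(g ^^ k) x \<in> carrier M" by (rule mod_hom_funpow[OF assms(2,3)])
    show ?case using Suc neg[OF c] g'(1)[OF c] by auto
  qed simp
  from this[of k] show ?thesis unfolding assms(4) M.M.a_inv_zero by simp
qed

text \<open>As \<open>q\<close> cannot divide both \<open>r\<close> and \<open>1 - r\<close>, the previous lemma applies to \<open>f\<close> or to \<open>1 - f\<close>.\<close>

lemma (in principal_domain) local_pair_if_scalar_plus_nilpotent:
  assumes U: "mpair R U" "\<not> zero_pair U" and q: "q \<in> carrier R" "ring_prime q"
    and N: "\<And>x. x \<in> carrier (fst U) \<Longrightarrow> q [^] (N::nat) \<odot>\<^bsub>fst U\<^esub> x = \<zero>\<^bsub>fst U\<^esub>"
    and endo: "\<And>f. f \<in> pair_hom R U U \<Longrightarrow> \<exists>r \<in> carrier R. \<exists>k. \<forall>x \<in> carrier (fst U).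
      ((\<lambda>x. f x \<ominus>\<^bsub>fst U\<^esub> r \<odot>\<^bsub>fst U\<^esub> x) ^^ k) x = \<zero>\<^bsub>fst U\<^esub>"
  shows "local_pair R U"
proof -
  interpret U: module R "fst U" by (rule mpairD(1)[OF U(1)])
  have "pair_auto R U f \<or> pair_auto R U (\<lambda>x. x \<ominus>\<^bsub>fst U\<^esub> f x)" if f: "f \<in> pair_hom R U U" for f
  proof -
    obtain r k where r: "r \<in> carrier R"
      and nil: "\<And>x. x \<in> carrier (fst U) \<Longrightarrow> ((\<lambda>x. f x \<ominus>\<^bsub>fst U\<^esub> r \<odot>\<^bsub>fst U\<^esub> x) ^^ k) x = \<zero>\<^bsub>fst U\<^esub>"
      using endo[OF f] by blast
    show ?thesis
    proof (cases "q divides r")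
      case False
      then show ?thesis using auto_if_unipotent[OF U(1) q r False N f nil] by blast
    next
      case True
      define g where "g = (\<lambda>x. f x \<ominus>\<^bsub>fst U\<^esub> r \<odot>\<^bsub>fst U\<^esub> x)"
      have g: "g \<in> mod_hom R (fst U) (fst U)" unfolding g_def
        by (rule module_minus_hom[OF U.module_axioms U.module_axioms pair_hom_mod_hom[OF f] mod_hom_scale[OF U.module_axioms r]])
      have r1: "\<one> \<ominus> r \<in> carrier R" using r by simp
      have nd: "\<not> q divides (\<one> \<ominus> r)"
      proof
        assume "q divides (\<one> \<ominus> r)"
        then obtain a b where ab: "a \<in> carrier R" "b \<in> carrier R" "\<one> \<ominus> r = q \<otimes> a" "r = q \<otimes> b"
          using True unfolding factor_def by blast
        have "\<one> = (\<one> \<ominus> r) \<oplus> r" using r by algebra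
        also have "\<dots> = q \<otimes> a \<oplus> q \<otimes> b" by (rule arg_cong2[OF ab(3,4)])
        also have "\<dots> = q \<otimes> (a \<oplus> b)" using q(1) ab(1,2) by algebra
        finally have "q divides \<one>" unfolding factor_def using ab(1,2) by blast
        then show False using prime_not_divides_one q by blast
      qed
      have h: "(\<lambda>x. x \<ominus>\<^bsub>fst U\<^esub> f x) \<in> pair_hom R U U"
        by (rule pair_hom_minus_hom[OF U(1) U(1) pair_hom_id f])
      let ?h = "\<lambda>x. (x \<ominus>\<^bsub>fst U\<^esub> f x) \<ominus>\<^bsub>fst U\<^esub> (\<one> \<ominus> r) \<odot>\<^bsub>fst U\<^esub> x"
      have hg: "?h x = \<ominus>\<^bsub>fst U\<^esub> g x" if "x \<in> carrier (fst U)" for x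
        using pair_homD(1)[OF f that] that r
        by (simp add: g_def a_minus_def U.smult_l_distr U.smult_l_minus U.M.minus_add U.M.a_ac U.M.r_neg1 U.M.r_neg2)
      have "(?h ^^ j) x = ((\<lambda>x. \<ominus>\<^bsub>fst U\<^esub> g x) ^^ j) x \<and> (?h ^^ j) x \<in> carrier (fst U)"
        if "x \<in> carrier (fst U)" for x j
      proof (induction j)
        case (Suc j)
        let ?y = "((\<lambda>x. \<ominus>\<^bsub>fst U\<^esub> g x) ^^ j) x"
        have y: "(?h ^^ j) x = ?y" "?y \<in> carrier (fst U)" using Suc by auto
        have "(?h ^^ Suc j) x = ?h ((?h ^^ j) x)" by (simp only: funpow.simps o_apply)
        also have "\<dots> = \<ominus>\<^bsub>fst U\<^esub> g ?y" unfolding y(1) by (rule hg[OF y(2)])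
        finally have e: "(?h ^^ Suc j) x = ((\<lambda>x. \<ominus>\<^bsub>fst U\<^esub> g x) ^^ Suc j) x" by (simp only: funpow.simps o_apply)
        moreover have "((\<lambda>x. \<ominus>\<^bsub>fst U\<^esub> g x) ^^ Suc j) x \<in> carrier (fst U)"
          using mod_homD(1)[OF g y(2)] by simp
        ultimately show ?case by (simp only: simp_thms)
      qed (use that in simp)
      then have "(?h ^^ k) x = \<zero>\<^bsub>fst U\<^esub>" if "x \<in> carrier (fst U)" for x
        using funpow_neg[OF U.module_axioms g that] nil[OF that] that unfolding g_def by simp
      then show ?thesis using auto_if_unipotent[OF U(1) q r1 nd N h] by blast
    qed
  qed
  then show ?thesis using U unfolding local_pair_def by blast
qed


lemma funpow_square:
  assumes "module R M" "cring R" and g: "g \<in> mod_hom R M M" and p: "p \<in> carrier R"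
    and sq: "\<And>x. x \<in> carrier M \<Longrightarrow> \<exists>z \<in> carrier M. g (g x) = p \<odot>\<^bsub>M\<^esub> z" and x: "x \<in> carrier M"
  shows "\<exists>z \<in> carrier M. (g ^^ (2 * n)) x = p [^]\<^bsub>R\<^esub> n \<odot>\<^bsub>M\<^esub> z"
proof -
  interpret M: module R M by fact
  show ?thesis
  proof (induction n)
    case 0 then show ?case using x by (intro bexI[of _ x]) auto
  next
    case (Suc n)
    then obtain z where z: "z \<in> carrier M" "(g ^^ (2 * n)) x = p [^]\<^bsub>R\<^esub> n \<odot>\<^bsub>M\<^esub> z" by blast
    have pn: "p [^]\<^bsub>R\<^esub> n \<in> carrier R" using p by simp
    obtain w where w: "w \<in> carrier M" "g (g z) = p \<odot>\<^bsub>M\<^esub> w" using sq[OF z(1)] by blast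
    have "(g ^^ (2 * Suc n)) x = g (g (p [^]\<^bsub>R\<^esub> n \<odot>\<^bsub>M\<^esub> z))" using z(2) by simp
    also have "\<dots> = p [^]\<^bsub>R\<^esub> n \<odot>\<^bsub>M\<^esub> (p \<odot>\<^bsub>M\<^esub> w)"
      using mod_homD[OF g] pn z(1) w(2) by simp
    also have "\<dots> = p [^]\<^bsub>R\<^esub> Suc n \<odot>\<^bsub>M\<^esub> w" using pn p w(1) by (simp add: M.smult_assoc1)
    finally show ?case using w(1) by blast
  qed
qed

context principal_domain
begin

text \<open>Endomorphisms of cyclic modules are multiplications by scalars.\<close>

lemma presented_cyclic_local:
  assumes pr: "presented R (q [^] (n::nat)) \<one> a b U" and q: "q \<in> carrier R" "ring_prime q" and n: "n \<noteq> 0"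
    and U: "mpair R U"
  shows "local_pair R U" "torsion_pair R U"
proof -
  obtain u v where u: "module R (fst U)" "u \<in> carrier (fst U)" "v \<in> carrier (fst U)"
    "\<forall>x \<in> carrier (fst U). \<exists>r \<in> carrier R. \<exists>s \<in> carrier R. x = r \<odot>\<^bsub>fst U\<^esub> u \<oplus>\<^bsub>fst U\<^esub> s \<odot>\<^bsub>fst U\<^esub> v"
    "\<forall>r \<in> carrier R. \<forall>s \<in> carrier R.
       r \<odot>\<^bsub>fst U\<^esub> u \<oplus>\<^bsub>fst U\<^esub> s \<odot>\<^bsub>fst U\<^esub> v = \<zero>\<^bsub>fst U\<^esub> \<longleftrightarrow> q [^] n divides r \<and> \<one> divides s"
    "snd U = (\<lambda>r. r \<odot>\<^bsub>fst U\<^esub> (a \<odot>\<^bsub>fst U\<^esub> u \<oplus>\<^bsub>fst U\<^esub> b \<odot>\<^bsub>fst U\<^esub> v)) ` carrier R"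
    by (rule presentedE[OF pr])
  interpret U: module R "fst U" by (rule u(1))
  have qn: "q [^] n \<in> carrier R" using q by simp
  have "\<zero> \<odot>\<^bsub>fst U\<^esub> u \<oplus>\<^bsub>fst U\<^esub> \<one> \<odot>\<^bsub>fst U\<^esub> v = \<zero>\<^bsub>fst U\<^esub>"
    using u(5)[rule_format, of \<zero> \<one>] qn by (simp add: divides_zero one_divides)
  then have v0: "v = \<zero>\<^bsub>fst U\<^esub>" using u(2,3) by simp
  have cyc: "\<exists>r \<in> carrier R. x = r \<odot>\<^bsub>fst U\<^esub> u" if x: "x \<in> carrier (fst U)" for x
    using u(4)[rule_format, OF x] u(2) unfolding v0 by auto
  have u0: "r \<odot>\<^bsub>fst U\<^esub> u = \<zero>\<^bsub>fst U\<^esub> \<longleftrightarrow> q [^] n divides r" if "r \<in> carrier R" for r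
    using u(5)[rule_format, OF that zero_closed] u(2,3) that by (simp add: divides_zero)
  have ann: "q [^] n \<odot>\<^bsub>fst U\<^esub> x = \<zero>\<^bsub>fst U\<^esub>" if x: "x \<in> carrier (fst U)" for x
  proof -
    obtain r where r: "r \<in> carrier R" "x = r \<odot>\<^bsub>fst U\<^esub> u" using cyc[OF x] by blast
    have "(q [^] n \<otimes> r) \<odot>\<^bsub>fst U\<^esub> u = \<zero>\<^bsub>fst U\<^esub>" using u0[of "q [^] n \<otimes> r"] r(1) qn by (auto simp: factor_def)
    then show ?thesis unfolding r(2) using r(1) qn u(2) by (simp add: U.smult_assoc1)
  qed
  have "u \<noteq> \<zero>\<^bsub>fst U\<^esub>"
  proof
    assume "u = \<zero>\<^bsub>fst U\<^esub>"
    then have "q [^] n divides \<one>" using u0[of \<one>] u(2) by simp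
    moreover obtain m where m: "n = Suc m" using n not0_implies_Suc by blast
    have "q divides q [^] n" unfolding m using q by (simp add: factor_def) (metis m_comm nat_pow_closed)
    ultimately have "q divides \<one>" using divides_trans q(1) by blast
    then show False using prime_not_divides_one q by blast
  qed
  then have nz: "\<not> zero_pair U" using u(2) unfolding zero_pair_def by blast
  show "local_pair R U"
  proof (rule local_pair_if_scalar_plus_nilpotent[OF U nz q ann])
    fix f assume f: "f \<in> pair_hom R U U"
    note f' = pair_homD[OF f]
    obtain r where r: "r \<in> carrier R" "f u = r \<odot>\<^bsub>fst U\<^esub> u" using cyc[OF f'(1)[OF u(2)]] by blast
    have "f x \<ominus>\<^bsub>fst U\<^esub> r \<odot>\<^bsub>fst U\<^esub> x = \<zero>\<^bsub>fst U\<^esub>" if x: "x \<in> carrier (fst U)" for x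
    proof -
      obtain s where s: "s \<in> carrier R" "x = s \<odot>\<^bsub>fst U\<^esub> u" using cyc[OF x] by blast
      have "f x = r \<odot>\<^bsub>fst U\<^esub> x"
        unfolding s(2) f'(3)[OF s(1) u(2)] r(2) using r(1) s(1) u(2) by (simp flip: U.smult_assoc1 add: m_comm)
      then show ?thesis using r(1) x by (simp add: a_minus_def U.M.r_neg)
    qed
    then show "\<exists>r \<in> carrier R. \<exists>k. \<forall>x \<in> carrier (fst U). ((\<lambda>x. f x \<ominus>\<^bsub>fst U\<^esub> r \<odot>\<^bsub>fst U\<^esub> x) ^^ k) x = \<zero>\<^bsub>fst U\<^esub>"
      using r(1) by (intro bexI[of _ r] exI[of _ 1]) auto
  qed
  show "torsion_pair R U" unfolding torsion_pair_def using ann qn prime_power_nonzero[OF q] by blast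
qed

text \<open>
  An endomorphism \<open>f\<close> of a bipicket maps the generator \<open>p\<^sup>t\<^sup>-\<^sup>2 u + p\<^sup>s\<^sup>-\<^sup>1 v\<close> of the submodule
  to a multiple of it, say by \<open>r\<close>. Comparing coefficients shows that both diagonal entries of \<open>f\<close>
  are congruent to \<open>r\<close> modulo \<open>p\<close>; this uses \<open>s < t - 1\<close>. As the entry \<open>R v \<rightarrow> R u\<close> is divisible
  by \<open>p\<close> anyway, the square of \<open>f - r\<close> maps the module to its multiples of \<open>p\<close>.
\<close>

lemma presented_bipicket_local:
  assumes pr: "presented R (p [^] (t::nat)) (p [^] (s::nat)) (p [^] (t - 2)) (p [^] (s - 1)) U"
    and p: "p \<in> carrier R" "ring_prime p" and st: "1 \<le> s" "s < t - 1"
    and U: "mpair R U"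
  shows "local_pair R U" "torsion_pair R U"
proof -
  obtain u v where u: "module R (fst U)" "u \<in> carrier (fst U)" "v \<in> carrier (fst U)"
    "\<forall>x \<in> carrier (fst U). \<exists>r \<in> carrier R. \<exists>s \<in> carrier R. x = r \<odot>\<^bsub>fst U\<^esub> u \<oplus>\<^bsub>fst U\<^esub> s \<odot>\<^bsub>fst U\<^esub> v"
    "\<forall>r \<in> carrier R. \<forall>s' \<in> carrier R.
       r \<odot>\<^bsub>fst U\<^esub> u \<oplus>\<^bsub>fst U\<^esub> s' \<odot>\<^bsub>fst U\<^esub> v = \<zero>\<^bsub>fst U\<^esub> \<longleftrightarrow> p [^] t divides r \<and> p [^] s divides s'"
    "snd U = (\<lambda>r. r \<odot>\<^bsub>fst U\<^esub> (p [^] (t - 2) \<odot>\<^bsub>fst U\<^esub> u \<oplus>\<^bsub>fst U\<^esub> p [^] (s - 1) \<odot>\<^bsub>fst U\<^esub> v)) ` carrier R"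
    by (rule presentedE[OF pr])
  interpret U: module R "fst U" by (rule u(1))
  interpret P: pid_module R "fst U" ..
  note rel = u(5)[rule_format]
  have pp: "p [^] n \<in> carrier R" for n :: nat using p by simp
  have pnz: "p [^] n \<noteq> \<zero>" for n :: nat by (rule prime_power_nonzero[OF p])
  define k where "k = s - 1"
  define l where "l = t - 2"
  define j where "j = l - s"
  have kl: "s = Suc k" "t = Suc (Suc l)" "l = j + s" using st by (auto simp: k_def l_def j_def)
  have padd: "p [^] (m + n) = p [^] m \<otimes> p [^] n" for m n :: nat using p by (simp add: nat_pow_mult)
  have dv: "p [^] t divides p [^] t \<otimes> x" "p [^] s divides p [^] s \<otimes> x" if "x \<in> carrier R" for x
    using that by (auto simp: factor_def)
  have ann: "p [^] t \<odot>\<^bsub>fst U\<^esub> x = \<zero>\<^bsub>fst U\<^esub>" if x: "x \<in> carrier (fst U)" for x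
  proof -
    obtain r w where rw: "r \<in> carrier R" "w \<in> carrier R" "x = r \<odot>\<^bsub>fst U\<^esub> u \<oplus>\<^bsub>fst U\<^esub> w \<odot>\<^bsub>fst U\<^esub> v"
      using u(4) x by blast
    have "t = s + (t - s)" using st by simp
    then have "p [^] t \<otimes> w = p [^] s \<otimes> (p [^] (t - s) \<otimes> w)"
      using padd[of s "t - s"] pp rw(2) by (simp add: m_assoc)
    then have "p [^] s divides (p [^] t \<otimes> w)" using dv(2)[of "p [^] (t - s) \<otimes> w"] pp rw(2) by simp
    then have "(p [^] t \<otimes> r) \<odot>\<^bsub>fst U\<^esub> u \<oplus>\<^bsub>fst U\<^esub> (p [^] t \<otimes> w) \<odot>\<^bsub>fst U\<^esub> v = \<zero>\<^bsub>fst U\<^esub>"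
      using rel[of "p [^] t \<otimes> r" "p [^] t \<otimes> w"] dv(1)[OF rw(1)] pp rw by simp
    then show ?thesis unfolding rw(3) using rw(1,2) pp u(2,3) by (simp add: U.smult_r_distr U.smult_assoc1)
  qed
  have "u \<noteq> \<zero>\<^bsub>fst U\<^esub>"
  proof
    assume "u = \<zero>\<^bsub>fst U\<^esub>"
    then have "\<one> \<odot>\<^bsub>fst U\<^esub> u \<oplus>\<^bsub>fst U\<^esub> \<zero> \<odot>\<^bsub>fst U\<^esub> v = \<zero>\<^bsub>fst U\<^esub>" using u(3) by simp
    then have "p [^] t divides \<one>" using rel[of \<one> \<zero>] by simp
    moreover have "p divides p [^] t" unfolding kl(2) using p by (simp add: factor_def) (metis m_comm m_closed nat_pow_closed)
    ultimately have "p divides \<one>" using divides_trans p(1) by blast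
    then show False using prime_not_divides_one p by blast
  qed
  then have nz: "\<not> zero_pair U" using u(2) unfolding zero_pair_def by blast
  let ?a = "p [^] l \<odot>\<^bsub>fst U\<^esub> u \<oplus>\<^bsub>fst U\<^esub> p [^] k \<odot>\<^bsub>fst U\<^esub> v"
  have sndU: "snd U = (\<lambda>r. r \<odot>\<^bsub>fst U\<^esub> ?a) ` carrier R" using u(6) unfolding k_def l_def .
  have ac: "?a \<in> carrier (fst U)" using pp u by simp
  show "local_pair R U"
  proof (rule local_pair_if_scalar_plus_nilpotent[OF U nz p ann])
    fix f assume f: "f \<in> pair_hom R U U"
    note f' = pair_homD[OF f]
    have "?a \<in> snd U" unfolding sndU using ac by (intro image_eqI[of _ _ \<one>]) auto
    then obtain r where r: "r \<in> carrier R" "f ?a = r \<odot>\<^bsub>fst U\<^esub> ?a" using f'(4) unfolding sndU by blast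
    define g where "g = (\<lambda>x. f x \<ominus>\<^bsub>fst U\<^esub> r \<odot>\<^bsub>fst U\<^esub> x)"
    have g: "g \<in> mod_hom R (fst U) (fst U)" unfolding g_def
      by (rule module_minus_hom[OF U.module_axioms U.module_axioms pair_hom_mod_hom[OF f] mod_hom_scale[OF U.module_axioms r(1)]])
    note g' = mod_homD[OF g]
    have ga: "g ?a = \<zero>\<^bsub>fst U\<^esub>" unfolding g_def r(2) using r(1) ac by (simp add: a_minus_def U.M.r_neg)
    obtain \<alpha> \<gamma> where al: "\<alpha> \<in> carrier R" "\<gamma> \<in> carrier R" "g u = \<alpha> \<odot>\<^bsub>fst U\<^esub> u \<oplus>\<^bsub>fst U\<^esub> \<gamma> \<odot>\<^bsub>fst U\<^esub> v"
      using u(4) g'(1)[OF u(2)] by blast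
    obtain \<beta> \<delta> where be: "\<beta> \<in> carrier R" "\<delta> \<in> carrier R" "g v = \<beta> \<odot>\<^bsub>fst U\<^esub> u \<oplus>\<^bsub>fst U\<^esub> \<delta> \<odot>\<^bsub>fst U\<^esub> v"
      using u(4) g'(1)[OF u(3)] by blast
    have scale: "x \<odot>\<^bsub>fst U\<^esub> (y \<odot>\<^bsub>fst U\<^esub> u \<oplus>\<^bsub>fst U\<^esub> z \<odot>\<^bsub>fst U\<^esub> v) = (x \<otimes> y) \<odot>\<^bsub>fst U\<^esub> u \<oplus>\<^bsub>fst U\<^esub> (x \<otimes> z) \<odot>\<^bsub>fst U\<^esub> v"
      if "x \<in> carrier R" "y \<in> carrier R" "z \<in> carrier R" for x y z
      using that u(2,3) by (simp add: U.smult_r_distr U.smult_assoc1)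
    have "p [^] s \<odot>\<^bsub>fst U\<^esub> v = \<zero>\<^bsub>fst U\<^esub>"
      using rel[of \<zero> "p [^] s"] pp u(2,3) by (simp add: divides_zero divides_refl)
    then have "p [^] s \<odot>\<^bsub>fst U\<^esub> g v = \<zero>\<^bsub>fst U\<^esub>"
      using g'(3)[OF pp u(3), of s] mod_hom_zero[OF g u(1) u(1)] by simp
    then have "p [^] t divides (p [^] s \<otimes> \<beta>)"
      unfolding be(3) scale[OF pp be(1,2)] using rel[of "p [^] s \<otimes> \<beta>" "p [^] s \<otimes> \<delta>"] pp be by simp
    moreover have "p [^] t = p [^] s \<otimes> p [^] Suc (Suc j)" using padd[of s "Suc (Suc j)"] kl by (simp add: add.commute)
    ultimately have "p [^] Suc (Suc j) divides \<beta>"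
      using mult_divides[OF pp[of "Suc (Suc j)"] be(1), of "p [^] s"] pp[of s] pnz[of s] by (simp del: nat_pow_Suc)
    then obtain b where b: "b \<in> carrier R" "\<beta> = p [^] Suc (Suc j) \<otimes> b" by (auto simp: factor_def simp del: nat_pow_Suc)
    have "g ?a = p [^] l \<odot>\<^bsub>fst U\<^esub> g u \<oplus>\<^bsub>fst U\<^esub> p [^] k \<odot>\<^bsub>fst U\<^esub> g v" using g' pp u(2,3) by simp
    also have "\<dots> = (p [^] l \<otimes> \<alpha> \<oplus> p [^] k \<otimes> \<beta>) \<odot>\<^bsub>fst U\<^esub> u \<oplus>\<^bsub>fst U\<^esub> (p [^] l \<otimes> \<gamma> \<oplus> p [^] k \<otimes> \<delta>) \<odot>\<^bsub>fst U\<^esub> v"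
      unfolding al(3) be(3) scale[OF pp al(1,2)] scale[OF pp be(1,2)]
      using al(1,2) be(1,2) pp u(2,3) by (simp add: U.smult_l_distr U.M.a_ac)
    finally have d: "p [^] t divides (p [^] l \<otimes> \<alpha> \<oplus> p [^] k \<otimes> \<beta>)" "p [^] s divides (p [^] l \<otimes> \<gamma> \<oplus> p [^] k \<otimes> \<delta>)"
      using ga rel[of "p [^] l \<otimes> \<alpha> \<oplus> p [^] k \<otimes> \<beta>" "p [^] l \<otimes> \<gamma> \<oplus> p [^] k \<otimes> \<delta>"] al(1,2) be(1,2) pp by auto
    have sub: "p divides x" if "p divides (x \<oplus> p \<otimes> y)" "x \<in> carrier R" "y \<in> carrier R" for x y
    proof -
      obtain c where c: "c \<in> carrier R" "x \<oplus> p \<otimes> y = p \<otimes> c" using \<open>p divides _\<close> by (auto simp: factor_def)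
      have "x = (x \<oplus> p \<otimes> y) \<ominus> p \<otimes> y" using that(2,3) p(1) by algebra
      also have "\<dots> = p \<otimes> (c \<ominus> y)" unfolding c(2) using c(1) that(3) p(1) by algebra
      finally show ?thesis unfolding factor_def using c(1) that(3) by blast
    qed
    have pa: "p divides \<alpha>"
    proof (rule sub)
      have lk: "k + Suc (Suc j) = l + 1" using kl by simp
      have "p [^] k \<otimes> \<beta> = (p [^] k \<otimes> p [^] Suc (Suc j)) \<otimes> b" unfolding b(2) by (rule m_assoc[symmetric, OF pp pp b(1)])
      also have "\<dots> = p [^] l \<otimes> (p \<otimes> b)"
        unfolding padd[symmetric] lk using p(1) b(1) by (simp add: m_assoc)
      finally have "p [^] l \<otimes> \<alpha> \<oplus> p [^] k \<otimes> \<beta> = p [^] l \<otimes> (\<alpha> \<oplus> p \<otimes> b)"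
        using p(1) al(1) b(1) pp by (simp add: r_distr)
      moreover have "p [^] t = p [^] l \<otimes> (p \<otimes> p)" unfolding kl(2) using p(1) by (simp add: m_assoc)
      ultimately have "(p \<otimes> p) divides (\<alpha> \<oplus> p \<otimes> b)"
        using d(1) mult_divides[of "p \<otimes> p" "\<alpha> \<oplus> p \<otimes> b" "p [^] l"] p(1) al(1) b(1) pp pnz by simp
      moreover have "p divides (p \<otimes> p)" using p(1) by (auto simp: factor_def)
      ultimately show "p divides (\<alpha> \<oplus> p \<otimes> b)" using divides_trans p(1) by blast
    qed (use al b in auto)
    have pd: "p divides \<delta>"
    proof (rule sub)
      have "l = k + Suc j" using kl by simp
      then have "p [^] l \<otimes> \<gamma> = p [^] k \<otimes> (p [^] Suc j \<otimes> \<gamma>)" using padd[of k "Suc j"] m_assoc[OF pp pp al(2), of k "Suc j"] by simp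
      also have "p [^] Suc j \<otimes> \<gamma> = p \<otimes> (p [^] j \<otimes> \<gamma>)" using p(1) al(2) by (simp add: m_ac)
      finally have "p [^] l \<otimes> \<gamma> \<oplus> p [^] k \<otimes> \<delta> = p [^] k \<otimes> (\<delta> \<oplus> p \<otimes> (p [^] j \<otimes> \<gamma>))"
        using p(1) al(2) be(2) pp by (simp add: r_distr a_comm)
      moreover have "p [^] s = p [^] k \<otimes> p" unfolding kl(1) by simp
      ultimately show "p divides (\<delta> \<oplus> p \<otimes> (p [^] j \<otimes> \<gamma>))"
        using d(2) mult_divides[of p "\<delta> \<oplus> p \<otimes> (p [^] j \<otimes> \<gamma>)" "p [^] k"] p(1) al(2) be(2) pp pnz by simp
    qed (use al be pp in auto)
    obtain a1 d1 where a1: "a1 \<in> carrier R" "\<alpha> = p \<otimes> a1" and d1: "d1 \<in> carrier R" "\<delta> = p \<otimes> d1"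
      using pa pd by (auto simp: factor_def)
    let ?b = "p [^] Suc j \<otimes> b"
    have b1: "?b \<in> carrier R" "\<beta> = p \<otimes> ?b" using b p(1) by (simp_all add: m_ac)
    define y where "y = ?b \<odot>\<^bsub>fst U\<^esub> u \<oplus>\<^bsub>fst U\<^esub> d1 \<odot>\<^bsub>fst U\<^esub> v"
    have y: "y \<in> carrier (fst U)" using b1(1) d1(1) u(2,3) by (simp add: y_def)
    have gv: "g v = p \<odot>\<^bsub>fst U\<^esub> y"
      unfolding be(3) b1(2) d1(2) y_def by (rule scale[OF p(1) b1(1) d1(1), symmetric])
    have gu: "g u = p \<odot>\<^bsub>fst U\<^esub> (a1 \<odot>\<^bsub>fst U\<^esub> u) \<oplus>\<^bsub>fst U\<^esub> \<gamma> \<odot>\<^bsub>fst U\<^esub> v"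
      unfolding al(3) a1(2) using p(1) a1(1) u(2) by (simp add: U.smult_assoc1)
    define z where "z = a1 \<odot>\<^bsub>fst U\<^esub> g u \<oplus>\<^bsub>fst U\<^esub> \<gamma> \<odot>\<^bsub>fst U\<^esub> y"
    have z: "z \<in> carrier (fst U)" using a1(1) al(2) y g'(1)[OF u(2)] by (simp add: z_def)
    have ggu: "g (g u) = p \<odot>\<^bsub>fst U\<^esub> z"
    proof -
      have "g (g u) = p \<odot>\<^bsub>fst U\<^esub> (a1 \<odot>\<^bsub>fst U\<^esub> g u) \<oplus>\<^bsub>fst U\<^esub> \<gamma> \<odot>\<^bsub>fst U\<^esub> g v"
        by (rule trans[OF arg_cong[OF gu]]) (use g' p(1) a1(1) al(2) u(2,3) in simp)
      also have "\<gamma> \<odot>\<^bsub>fst U\<^esub> g v = p \<odot>\<^bsub>fst U\<^esub> (\<gamma> \<odot>\<^bsub>fst U\<^esub> y)" unfolding gv by (rule P.smult_commute[OF al(2) p(1) y])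
      finally show ?thesis unfolding z_def using p(1) a1(1) al(2) y g'(1)[OF u(2)] by (simp add: U.smult_r_distr)
    qed
    have "\<exists>w \<in> carrier (fst U). g (g x) = p \<odot>\<^bsub>fst U\<^esub> w" if x: "x \<in> carrier (fst U)" for x
    proof -
      obtain r1 r2 where rr: "r1 \<in> carrier R" "r2 \<in> carrier R" "x = r1 \<odot>\<^bsub>fst U\<^esub> u \<oplus>\<^bsub>fst U\<^esub> r2 \<odot>\<^bsub>fst U\<^esub> v"
        using u(4) x by blast
      have "g (g x) = r1 \<odot>\<^bsub>fst U\<^esub> g (g u) \<oplus>\<^bsub>fst U\<^esub> r2 \<odot>\<^bsub>fst U\<^esub> g (g v)"
        unfolding rr(3) using g' rr(1,2) u(2,3) by simp
      also have "g (g v) = p \<odot>\<^bsub>fst U\<^esub> g y" unfolding gv by (rule g'(3)[OF p(1) y])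
      also have "r1 \<odot>\<^bsub>fst U\<^esub> g (g u) \<oplus>\<^bsub>fst U\<^esub> r2 \<odot>\<^bsub>fst U\<^esub> (p \<odot>\<^bsub>fst U\<^esub> g y) =
          p \<odot>\<^bsub>fst U\<^esub> (r1 \<odot>\<^bsub>fst U\<^esub> z \<oplus>\<^bsub>fst U\<^esub> r2 \<odot>\<^bsub>fst U\<^esub> g y)"
        unfolding ggu P.smult_commute[OF rr(1) p(1) z] P.smult_commute[OF rr(2) p(1) g'(1)[OF y]]
        using rr(1,2) p(1) z g'(1)[OF y] by (simp add: U.smult_r_distr)
      finally have "g (g x) = p \<odot>\<^bsub>fst U\<^esub> (r1 \<odot>\<^bsub>fst U\<^esub> z \<oplus>\<^bsub>fst U\<^esub> r2 \<odot>\<^bsub>fst U\<^esub> g y)" .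
      moreover have "r1 \<odot>\<^bsub>fst U\<^esub> z \<oplus>\<^bsub>fst U\<^esub> r2 \<odot>\<^bsub>fst U\<^esub> g y \<in> carrier (fst U)"
        using rr(1,2) z g'(1)[OF y] by simp
      ultimately show ?thesis by blast
    qed
    then have "\<exists>w \<in> carrier (fst U). (g ^^ (2 * t)) x = p [^] t \<odot>\<^bsub>fst U\<^esub> w" if "x \<in> carrier (fst U)" for x
      using funpow_square[OF u(1) is_cring g p(1) _ that] by blast
    then have "(g ^^ (2 * t)) x = \<zero>\<^bsub>fst U\<^esub>" if "x \<in> carrier (fst U)" for x using ann that by force
    then show "\<exists>r \<in> carrier R. \<exists>k. \<forall>x \<in> carrier (fst U). ((\<lambda>x. f x \<ominus>\<^bsub>fst U\<^esub> r \<odot>\<^bsub>fst U\<^esub> x) ^^ k) x = \<zero>\<^bsub>fst U\<^esub>"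
      unfolding g_def using r(1) by blast
  qed
  show "torsion_pair R U" unfolding torsion_pair_def using ann pp pnz by blast
qed

end

section \<open>Identification of the standard pairs\<close>

lemma restrict_scalars_simps [simp]:
  "carrier (restrict_scalars \<phi> M) = carrier M" "\<zero>\<^bsub>restrict_scalars \<phi> M\<^esub> = \<zero>\<^bsub>M\<^esub>"
  "x \<oplus>\<^bsub>restrict_scalars \<phi> M\<^esub> y = x \<oplus>\<^bsub>M\<^esub> y" "r \<odot>\<^bsub>restrict_scalars \<phi> M\<^esub> x = \<phi> r \<odot>\<^bsub>M\<^esub> x"
  by (simp_all add: restrict_scalars_def)

lemma restrict_scalars_comp:
  "restrict_scalars \<phi> (restrict_scalars \<psi> M) = restrict_scalars (\<lambda>r. \<psi> (\<phi> r)) M"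
  by (simp add: restrict_scalars_def)

lemma restrict_scalars_module_sum:
  "restrict_scalars \<phi> (module_sum M N) = module_sum (restrict_scalars \<phi> M) (restrict_scalars \<phi> N)"
  by (simp add: restrict_scalars_def module_sum_def)

lemma module_sum_simps [simp]:
  "carrier (module_sum M N) = carrier M \<times> carrier N"
  "\<zero>\<^bsub>module_sum M N\<^esub> = (\<zero>\<^bsub>M\<^esub>, \<zero>\<^bsub>N\<^esub>)"
  "(x, y) \<oplus>\<^bsub>module_sum M N\<^esub> (x', y') = (x \<oplus>\<^bsub>M\<^esub> x', y \<oplus>\<^bsub>N\<^esub> y')"
  "r \<odot>\<^bsub>module_sum M N\<^esub> (x, y) = (r \<odot>\<^bsub>M\<^esub> x, r \<odot>\<^bsub>N\<^esub> y)"
  by (simp_all add: module_sum_def)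

lemma ring_hom_zero':
  assumes "cring R" "cring S" "\<phi> \<in> ring_hom R S" shows "\<phi> \<zero>\<^bsub>R\<^esub> = \<zero>\<^bsub>S\<^esub>"
  using ring_hom_zero[OF assms(3) cring.axioms(1)[OF assms(1)] cring.axioms(1)[OF assms(2)]] .

lemma module_restrict_scalars:
  assumes R: "cring R" and M: "module S M" and \<phi>: "\<phi> \<in> ring_hom R S"
  shows "module R (restrict_scalars \<phi> M)"
proof -
  interpret M: module S M by fact
  note h = ring_hom_memE[OF \<phi>]
  show ?thesis
  proof (rule moduleI[OF R])
    show "abelian_group (restrict_scalars \<phi> M)"
    proof (rule abelian_groupI)
      fix x assume "x \<in> carrier (restrict_scalars \<phi> M)"
      then show "\<exists>y\<in>carrier (restrict_scalars \<phi> M). y \<oplus>\<^bsub>restrict_scalars \<phi> M\<^esub> x = \<zero>\<^bsub>restrict_scalars \<phi> M\<^esub>"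
        by (intro bexI[of _ "\<ominus>\<^bsub>M\<^esub> x"]) (auto simp: M.M.l_neg)
    qed (auto simp: M.M.a_ac)
  qed (auto simp: h M.smult_l_distr M.smult_r_distr M.smult_assoc1)
qed

lemma quot_module_eq: "quot_module R I = restrict_scalars (\<lambda>r. I +>\<^bsub>R\<^esub> r) (self_module (R Quot I))"
  by (simp add: quot_module_def)

lemma (in cring) presented_free_pair: "presented R \<zero> \<one> \<zero> \<zero> (free_pair R)"
proof -
  have m: "module R (self_module R)" by (rule module_self_module)
  have gen: "\<exists>r \<in> carrier R. \<exists>s \<in> carrier R. x = r \<otimes> \<one> \<oplus> s \<otimes> \<zero>" if x: "x \<in> carrier R" for x
    by (intro bexI[of _ x] bexI[of _ \<zero>]) (use x in auto)
  have rel: "r \<otimes> \<one> \<oplus> s \<otimes> \<zero> = \<zero> \<longleftrightarrow> \<zero> divides r \<and> \<one> divides s"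
    if "r \<in> carrier R" "s \<in> carrier R" for r s
    using that by (simp add: zero_divides one_divides)
  have sub: "{\<zero>} = (\<lambda>r. r \<otimes> (\<zero> \<otimes> \<one> \<oplus> \<zero> \<otimes> \<zero>)) ` carrier R" by auto
  show ?thesis unfolding presented_def fst_conv snd_conv self_module_simps
    by (intro conjI m bexI[OF _ one_closed] bexI[OF _ zero_closed] ballI gen rel sub)
qed

text \<open>
  Only the ring homomorphism from \<open>R\<close> and its kernel matter, not the construction of the quotient. This
  treats cosets of cosets, which arise from quotients of \<open>R / (p\<^sup>n)\<close>, like plain cosets.
\<close>

lemma presented_ring_quotient:
  assumes R: "cring R" and S: "cring S" and \<chi>: "\<chi> \<in> ring_hom R S"
    and onto: "carrier S \<subseteq> \<chi> ` carrier R"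
    and ker: "\<And>r. r \<in> carrier R \<Longrightarrow> \<chi> r = \<zero>\<^bsub>S\<^esub> \<longleftrightarrow> d divides\<^bsub>R\<^esub> r" and a: "a \<in> carrier R"
  shows "presented R d \<one>\<^bsub>R\<^esub> a \<zero>\<^bsub>R\<^esub>
    (restrict_scalars \<chi> (self_module S), (\<lambda>r. \<chi> (r \<otimes>\<^bsub>R\<^esub> a)) ` carrier R)"
proof -
  interpret R: cring R by fact
  interpret S: cring S by fact
  note h = ring_hom_memE[OF \<chi>]
  have m: "module R (restrict_scalars \<chi> (self_module S))"
    by (rule module_restrict_scalars[OF R S.module_self_module \<chi>])
  have gen: "\<exists>r \<in> carrier R. \<exists>s \<in> carrier R. x = \<chi> r \<otimes>\<^bsub>S\<^esub> \<one>\<^bsub>S\<^esub> \<oplus>\<^bsub>S\<^esub> \<chi> s \<otimes>\<^bsub>S\<^esub> \<zero>\<^bsub>S\<^esub>" if x: "x \<in> carrier S" for x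
  proof -
    obtain r where "r \<in> carrier R" "x = \<chi> r" using x onto by blast
    then show ?thesis using h(1) by (intro bexI[of _ r] bexI[of _ "\<zero>\<^bsub>R\<^esub>"]) auto
  qed
  have rel: "\<chi> r \<otimes>\<^bsub>S\<^esub> \<one>\<^bsub>S\<^esub> \<oplus>\<^bsub>S\<^esub> \<chi> s \<otimes>\<^bsub>S\<^esub> \<zero>\<^bsub>S\<^esub> = \<zero>\<^bsub>S\<^esub> \<longleftrightarrow> d divides\<^bsub>R\<^esub> r \<and> \<one>\<^bsub>R\<^esub> divides\<^bsub>R\<^esub> s"
    if "r \<in> carrier R" "s \<in> carrier R" for r s
    using ker[OF that(1)] h(1) that by (simp add: R.one_divides)
  have sub: "(\<lambda>r. \<chi> (r \<otimes>\<^bsub>R\<^esub> a)) ` carrier R =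
      (\<lambda>r. \<chi> r \<otimes>\<^bsub>S\<^esub> (\<chi> a \<otimes>\<^bsub>S\<^esub> \<one>\<^bsub>S\<^esub> \<oplus>\<^bsub>S\<^esub> \<chi> \<zero>\<^bsub>R\<^esub> \<otimes>\<^bsub>S\<^esub> \<zero>\<^bsub>S\<^esub>)) ` carrier R"
    by (rule image_cong[OF refl]) (use h a in simp)
  show ?thesis unfolding presented_def fst_conv snd_conv restrict_scalars_simps self_module_simps
    by (intro conjI m bexI[OF _ S.one_closed] bexI[OF _ S.zero_closed] ballI gen rel sub)
qed

lemma presented_ring_quotient_sum:
  assumes R: "cring R" and S: "cring S" "cring T" and \<chi>: "\<chi> \<in> ring_hom R S" "\<psi> \<in> ring_hom R T"
    and onto: "carrier S \<subseteq> \<chi> ` carrier R" "carrier T \<subseteq> \<psi> ` carrier R"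
    and ker: "\<And>r. r \<in> carrier R \<Longrightarrow> \<chi> r = \<zero>\<^bsub>S\<^esub> \<longleftrightarrow> d divides\<^bsub>R\<^esub> r"
      "\<And>r. r \<in> carrier R \<Longrightarrow> \<psi> r = \<zero>\<^bsub>T\<^esub> \<longleftrightarrow> e divides\<^bsub>R\<^esub> r"
    and ab: "a \<in> carrier R" "b \<in> carrier R"
  shows "presented R d e a b
    (module_sum (restrict_scalars \<chi> (self_module S)) (restrict_scalars \<psi> (self_module T)),
     (\<lambda>r. (\<chi> (r \<otimes>\<^bsub>R\<^esub> a), \<psi> (r \<otimes>\<^bsub>R\<^esub> b))) ` carrier R)"
proof -
  interpret R: cring R by fact
  interpret S: cring S by fact
  interpret T: cring T by fact
  note h = ring_hom_memE[OF \<chi>(1)] and k = ring_hom_memE[OF \<chi>(2)]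
  let ?B = "module_sum (restrict_scalars \<chi> (self_module S)) (restrict_scalars \<psi> (self_module T))"
  have m: "module R ?B"
    by (rule module_module_sum[OF module_restrict_scalars[OF R S.module_self_module \<chi>(1)]
          module_restrict_scalars[OF R T.module_self_module \<chi>(2)]])
  let ?u = "(\<one>\<^bsub>S\<^esub>, \<zero>\<^bsub>T\<^esub>)" and ?v = "(\<zero>\<^bsub>S\<^esub>, \<one>\<^bsub>T\<^esub>)"
  have uv: "?u \<in> carrier ?B" "?v \<in> carrier ?B" by auto
  have lin: "r \<odot>\<^bsub>?B\<^esub> ?u \<oplus>\<^bsub>?B\<^esub> s \<odot>\<^bsub>?B\<^esub> ?v = (\<chi> r, \<psi> s)" if "r \<in> carrier R" "s \<in> carrier R" for r s
    using that h(1) k(1) by simp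
  have gen: "\<exists>r \<in> carrier R. \<exists>s \<in> carrier R. x = r \<odot>\<^bsub>?B\<^esub> ?u \<oplus>\<^bsub>?B\<^esub> s \<odot>\<^bsub>?B\<^esub> ?v" if x: "x \<in> carrier ?B" for x
  proof -
    obtain y z where yz: "x = (y, z)" "y \<in> carrier S" "z \<in> carrier T" using x by auto
    obtain r where r: "r \<in> carrier R" "y = \<chi> r" using yz onto by blast
    obtain s where s: "s \<in> carrier R" "z = \<psi> s" using yz onto by blast
    have "x = r \<odot>\<^bsub>?B\<^esub> ?u \<oplus>\<^bsub>?B\<^esub> s \<odot>\<^bsub>?B\<^esub> ?v" unfolding lin[OF r(1) s(1)] yz(1) r(2) s(2) ..
    then show ?thesis using r(1) s(1) by blast
  qed
  have rel: "r \<odot>\<^bsub>?B\<^esub> ?u \<oplus>\<^bsub>?B\<^esub> s \<odot>\<^bsub>?B\<^esub> ?v = \<zero>\<^bsub>?B\<^esub> \<longleftrightarrow> d divides\<^bsub>R\<^esub> r \<and> e divides\<^bsub>R\<^esub> s"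
    if "r \<in> carrier R" "s \<in> carrier R" for r s
    unfolding lin[OF that] using ker that by simp
  have sub: "(\<lambda>r. (\<chi> (r \<otimes>\<^bsub>R\<^esub> a), \<psi> (r \<otimes>\<^bsub>R\<^esub> b))) ` carrier R =
      (\<lambda>r. r \<odot>\<^bsub>?B\<^esub> (a \<odot>\<^bsub>?B\<^esub> ?u \<oplus>\<^bsub>?B\<^esub> b \<odot>\<^bsub>?B\<^esub> ?v)) ` carrier R"
    unfolding lin[OF ab] by (rule image_cong[OF refl]) (use h k ab in simp)
  show ?thesis unfolding presented_def fst_conv snd_conv
    by (intro conjI m bexI[OF _ uv(1)] bexI[OF _ uv(2)] ballI gen rel sub)
qed

lemma (in cring) mem_PIdl: "x \<in> PIdl a \<longleftrightarrow> (\<exists>r \<in> carrier R. x = r \<otimes> a)"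
  by (auto simp: cgenideal_def)

lemma Quot_carrier: "carrier (R Quot I) = (\<lambda>r. I +>\<^bsub>R\<^esub> r) ` carrier R"
  by (auto simp: FactRing_def A_RCOSETS_def' a_r_coset_def RCOSETS_def)

lemma (in cring) Quot_facts:
  assumes "ideal I R"
  shows "cring (R Quot I)" "(\<lambda>r. I +> r) \<in> ring_hom R (R Quot I)"
    "\<And>r. r \<in> carrier R \<Longrightarrow> I +> r = \<zero>\<^bsub>R Quot I\<^esub> \<longleftrightarrow> r \<in> I"
proof -
  interpret ideal I R by fact
  show "cring (R Quot I)" by (rule quotient_is_cring[OF is_cring])
  show "(\<lambda>r. I +> r) \<in> ring_hom R (R Quot I)" by (rule rcos_ring_hom)
  have "\<zero>\<^bsub>R Quot I\<^esub> = I" by (simp add: FactRing_def)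
  then show "I +> r = \<zero>\<^bsub>R Quot I\<^esub> \<longleftrightarrow> r \<in> I" if "r \<in> carrier R" for r
    using rcos_const_imp_mem[OF that] a_rcos_const by auto
qed

text \<open>
  By \<open>ker\<close> the kernel of \<open>\<phi>\<close> is contained in the ideal of \<open>d\<close>; hence passing to \<open>S\<close> first does not change
  the quotient by \<open>d\<close>.
\<close>

lemma quotient_of_quotient:
  assumes R: "cring R" and S: "cring S" and \<phi>: "\<phi> \<in> ring_hom R S" and onto: "carrier S \<subseteq> \<phi> ` carrier R"
    and ker: "\<forall>r \<in> carrier R. \<phi> r = \<zero>\<^bsub>S\<^esub> \<longrightarrow> d divides\<^bsub>R\<^esub> r" and d: "d \<in> carrier R"
    and J: "J = PIdl\<^bsub>S\<^esub> (\<phi> d)"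
  shows "cring (S Quot J)" "(\<lambda>r. J +>\<^bsub>S\<^esub> \<phi> r) \<in> ring_hom R (S Quot J)"
    "carrier (S Quot J) \<subseteq> (\<lambda>r. J +>\<^bsub>S\<^esub> \<phi> r) ` carrier R"
    "\<And>r. r \<in> carrier R \<Longrightarrow> J +>\<^bsub>S\<^esub> \<phi> r = \<zero>\<^bsub>S Quot J\<^esub> \<longleftrightarrow> d divides\<^bsub>R\<^esub> r"
    "(\<lambda>s. J +>\<^bsub>S\<^esub> s) \<in> ring_hom S (S Quot J)"
proof -
  interpret R: cring R by fact
  interpret S: cring S by fact
  note h = ring_hom_memE[OF \<phi>]
  have dS: "\<phi> d \<in> carrier S" using h(1)[OF d] .
  have Ji: "ideal J S" unfolding J by (rule S.cgenideal_ideal[OF dS])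
  show "cring (S Quot J)" "(\<lambda>s. J +>\<^bsub>S\<^esub> s) \<in> ring_hom S (S Quot J)" using S.Quot_facts[OF Ji] by auto
  show "(\<lambda>r. J +>\<^bsub>S\<^esub> \<phi> r) \<in> ring_hom R (S Quot J)"
    using ring_hom_trans[OF \<phi> S.Quot_facts(2)[OF Ji]] by (simp add: comp_def)
  show "carrier (S Quot J) \<subseteq> (\<lambda>r. J +>\<^bsub>S\<^esub> \<phi> r) ` carrier R"
    unfolding Quot_carrier using onto by blast
  fix r assume r: "r \<in> carrier R"
  have "\<phi> r \<in> J \<longleftrightarrow> d divides\<^bsub>R\<^esub> r"
  proof
    assume "\<phi> r \<in> J"
    then obtain s where s: "s \<in> carrier S" "\<phi> r = s \<otimes>\<^bsub>S\<^esub> \<phi> d" unfolding J S.mem_PIdl by blast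
    obtain t where t: "t \<in> carrier R" "s = \<phi> t" using s(1) onto by blast
    have td: "t \<otimes>\<^bsub>R\<^esub> d \<in> carrier R" using t(1) d by simp
    have e: "\<phi> r = \<phi> (t \<otimes>\<^bsub>R\<^esub> d)" using s(2) t h(2) d by simp
    let ?x = "r \<oplus>\<^bsub>R\<^esub> (\<ominus>\<^bsub>R\<^esub> \<one>\<^bsub>R\<^esub>) \<otimes>\<^bsub>R\<^esub> (t \<otimes>\<^bsub>R\<^esub> d)"
    have "\<phi> ?x = \<phi> (t \<otimes>\<^bsub>R\<^esub> d) \<oplus>\<^bsub>S\<^esub> \<phi> (\<ominus>\<^bsub>R\<^esub> \<one>\<^bsub>R\<^esub>) \<otimes>\<^bsub>S\<^esub> \<phi> (t \<otimes>\<^bsub>R\<^esub> d)"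
      using h(2,3) r td e by simp
    also have "\<dots> = \<phi> (t \<otimes>\<^bsub>R\<^esub> d \<oplus>\<^bsub>R\<^esub> (\<ominus>\<^bsub>R\<^esub> \<one>\<^bsub>R\<^esub>) \<otimes>\<^bsub>R\<^esub> (t \<otimes>\<^bsub>R\<^esub> d))"
      using h(2,3) td by simp
    also have "t \<otimes>\<^bsub>R\<^esub> d \<oplus>\<^bsub>R\<^esub> (\<ominus>\<^bsub>R\<^esub> \<one>\<^bsub>R\<^esub>) \<otimes>\<^bsub>R\<^esub> (t \<otimes>\<^bsub>R\<^esub> d) = \<zero>\<^bsub>R\<^esub>" using td by (simp add: R.l_minus R.r_neg)
    finally have "\<phi> ?x = \<zero>\<^bsub>S\<^esub>" using ring_hom_zero'[OF R S \<phi>] by simp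
    then have "d divides\<^bsub>R\<^esub> ?x" using ker r td by simp
    then obtain c where c: "c \<in> carrier R" "?x = d \<otimes>\<^bsub>R\<^esub> c" by (auto simp: factor_def)
    have "r = ?x \<oplus>\<^bsub>R\<^esub> t \<otimes>\<^bsub>R\<^esub> d" using r td by (simp add: R.l_minus R.a_assoc R.l_neg)
    also have "\<dots> = d \<otimes>\<^bsub>R\<^esub> (c \<oplus>\<^bsub>R\<^esub> t)" unfolding c(2) using c(1) t(1) d by (simp add: R.r_distr R.m_comm)
    finally show "d divides\<^bsub>R\<^esub> r" unfolding factor_def using c(1) t(1) by blast
  next
    assume "d divides\<^bsub>R\<^esub> r"
    then obtain c where c: "c \<in> carrier R" "r = d \<otimes>\<^bsub>R\<^esub> c" by (auto simp: factor_def)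
    then have "\<phi> r = \<phi> c \<otimes>\<^bsub>S\<^esub> \<phi> d" using h(1,2) d by (simp add: S.m_comm)
    then show "\<phi> r \<in> J" unfolding J S.mem_PIdl using h(1)[OF c(1)] by blast
  qed
  then show "J +>\<^bsub>S\<^esub> \<phi> r = \<zero>\<^bsub>S Quot J\<^esub> \<longleftrightarrow> d divides\<^bsub>R\<^esub> r"
    using S.Quot_facts(3)[OF Ji h(1)[OF r]] by simp
qed

context principal_domain
begin

lemma trunc_facts:
  assumes p: "p \<in> carrier R"
  shows "cring (trunc_ring R p n)" "trunc_proj R p n \<in> ring_hom R (trunc_ring R p n)"
    "carrier (trunc_ring R p n) = trunc_proj R p n ` carrier R"
    "\<And>r. r \<in> carrier R \<Longrightarrow> trunc_proj R p n r = \<zero>\<^bsub>trunc_ring R p n\<^esub> \<longleftrightarrow> p [^] n divides r"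
    "\<And>m. trunc_proj R p n p [^]\<^bsub>trunc_ring R p n\<^esub> (m::nat) = trunc_proj R p n (p [^] m)"
proof -
  let ?I = "PIdl (p [^] n)"
  have I: "ideal ?I R" using p by (intro cgenideal_ideal) simp
  have proj: "trunc_proj R p n = (\<lambda>r. ?I +> r)" by (simp add: fun_eq_iff trunc_proj_def)
  show S: "cring (trunc_ring R p n)" and h: "trunc_proj R p n \<in> ring_hom R (trunc_ring R p n)"
    using Quot_facts[OF I] unfolding proj trunc_ring_def by auto
  show "carrier (trunc_ring R p n) = trunc_proj R p n ` carrier R"
    unfolding proj trunc_ring_def Quot_carrier ..
  show "trunc_proj R p n r = \<zero>\<^bsub>trunc_ring R p n\<^esub> \<longleftrightarrow> p [^] n divides r" if r: "r \<in> carrier R" for r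
    using Quot_facts(3)[OF I r] p r unfolding proj trunc_ring_def mem_PIdl
    by (auto simp: factor_def m_comm)
  interpret S: cring "trunc_ring R p n" by (rule S)
  interpret ring_hom_ring R "trunc_ring R p n" "trunc_proj R p n"
    by (rule ring_hom_ringI2[OF ring_axioms S.ring_axioms h])
  show "trunc_proj R p n p [^]\<^bsub>trunc_ring R p n\<^esub> (m::nat) = trunc_proj R p n (p [^] m)" for m
    using hom_nat_pow[OF p, of m] by simp
qed

lemma prime_power_divides_mono:
  assumes "p \<in> carrier R" "l \<le> (n::nat)" "p [^] n divides r" "r \<in> carrier R" shows "p [^] l divides r"
proof -
  have "p [^] n = p [^] l \<otimes> p [^] (n - l)" using assms(1,2) by (simp add: nat_pow_mult)
  then have "p [^] l divides p [^] n" by (rule dividesI[OF nat_pow_closed[OF assms(1)]])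
  then show ?thesis using assms(3) nat_pow_closed[OF assms(1)] by (rule divides_trans)
qed

lemma presented_restricted_picket:
  assumes p: "p \<in> carrier R" and l: "l \<le> n"
  shows "presented R (p [^] l) \<one> (p [^] (l - m)) \<zero>
    (restrict_pair (trunc_proj R p n) (picket (trunc_ring R p n) (trunc_proj R p n p) l m))"
proof -
  let ?S = "trunc_ring R p n" and ?\<phi> = "trunc_proj R p n"
  note t = trunc_facts[OF p, where n = n]
  interpret S: cring ?S by (rule t(1))
  let ?J = "PIdl\<^bsub>?S\<^esub> (?\<phi> (p [^] l))"
  have pl: "p [^] k \<in> carrier R" for k :: nat using p by simp
  have ker: "\<forall>r \<in> carrier R. ?\<phi> r = \<zero>\<^bsub>?S\<^esub> \<longrightarrow> p [^] l divides r"
    using prime_power_divides_mono[OF p l] t(4) by blast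
  note q = quotient_of_quotient[OF is_cring t(1,2) equalityD1[OF t(3)] ker pl refl]
  have "(\<lambda>x. ?J +>\<^bsub>?S\<^esub> x) ` (PIdl\<^bsub>?S\<^esub> (?\<phi> (p [^] (l - m)))) = (\<lambda>r. ?J +>\<^bsub>?S\<^esub> ?\<phi> (r \<otimes> p [^] (l - m))) ` carrier R"
  proof -
    have "PIdl\<^bsub>?S\<^esub> (?\<phi> (p [^] (l - m))) = (\<lambda>r. ?\<phi> (r \<otimes> p [^] (l - m))) ` carrier R"
    proof -
      have "PIdl\<^bsub>?S\<^esub> (?\<phi> (p [^] (l - m))) = (\<lambda>s. s \<otimes>\<^bsub>?S\<^esub> ?\<phi> (p [^] (l - m))) ` carrier ?S"
        unfolding cgenideal_def by blast
      also have "\<dots> = (\<lambda>r. ?\<phi> r \<otimes>\<^bsub>?S\<^esub> ?\<phi> (p [^] (l - m))) ` carrier R" unfolding t(3) image_image ..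
      also have "\<dots> = (\<lambda>r. ?\<phi> (r \<otimes> p [^] (l - m))) ` carrier R"
        by (rule image_cong[OF refl ring_hom_memE(2)[OF t(2) _ pl, symmetric]])
      finally show ?thesis .
    qed
    then show ?thesis by (simp add: image_image)
  qed
  then have eq: "restrict_pair ?\<phi> (picket ?S (?\<phi> p) l m) =
      (restrict_scalars (\<lambda>r. ?J +>\<^bsub>?S\<^esub> ?\<phi> r) (self_module (?S Quot ?J)), (\<lambda>r. ?J +>\<^bsub>?S\<^esub> ?\<phi> (r \<otimes> p [^] (l - m))) ` carrier R)"
    by (simp add: restrict_pair_def picket_def Let_def t(5) quot_module_eq restrict_scalars_comp)
  show ?thesis unfolding eq by (rule presented_ring_quotient[OF is_cring q(1-4) pl])
qed

lemma presented_restricted_bipicket: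
  assumes p: "p \<in> carrier R" and st: "s \<le> n" "t \<le> n"
  shows "presented R (p [^] t) (p [^] s) (p [^] (t - 2)) (p [^] (s - 1))
    (restrict_pair (trunc_proj R p n) (bipicket (trunc_ring R p n) (trunc_proj R p n p) t s))"
proof -
  let ?S = "trunc_ring R p n" and ?\<phi> = "trunc_proj R p n"
  note tr = trunc_facts[OF p, where n = n]
  interpret S: cring ?S by (rule tr(1))
  let ?I = "PIdl\<^bsub>?S\<^esub> (?\<phi> (p [^] t))" and ?J = "PIdl\<^bsub>?S\<^esub> (?\<phi> (p [^] s))"
  have pl: "p [^] k \<in> carrier R" for k :: nat using p by simp
  have ker: "\<forall>r \<in> carrier R. ?\<phi> r = \<zero>\<^bsub>?S\<^esub> \<longrightarrow> p [^] t divides r"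
    "\<forall>r \<in> carrier R. ?\<phi> r = \<zero>\<^bsub>?S\<^esub> \<longrightarrow> p [^] s divides r"
  proof -
    have pn: "p [^] n divides r" if "r \<in> carrier R" "?\<phi> r = \<zero>\<^bsub>?S\<^esub>" for r
      by (rule iffD1[OF tr(4)[OF that(1)] that(2)])
    show "\<forall>r \<in> carrier R. ?\<phi> r = \<zero>\<^bsub>?S\<^esub> \<longrightarrow> p [^] t divides r"
      by (intro ballI impI) (rule prime_power_divides_mono[OF p st(2) pn])
    show "\<forall>r \<in> carrier R. ?\<phi> r = \<zero>\<^bsub>?S\<^esub> \<longrightarrow> p [^] s divides r"
      by (intro ballI impI) (rule prime_power_divides_mono[OF p st(1) pn])
  qed
  note qI = quotient_of_quotient[OF is_cring tr(1,2) equalityD1[OF tr(3)] ker(1) pl refl]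
  note qJ = quotient_of_quotient[OF is_cring tr(1,2) equalityD1[OF tr(3)] ker(2) pl refl]
  interpret QI: cring "?S Quot ?I" by (rule qI(1))
  interpret QJ: cring "?S Quot ?J" by (rule qJ(1))
  let ?B = "module_sum (quot_module ?S ?I) (quot_module ?S ?J)"
  let ?g = "(?I +>\<^bsub>?S\<^esub> ?\<phi> (p [^] (t - 2)), ?J +>\<^bsub>?S\<^esub> ?\<phi> (p [^] (s - 1)))"
  note h = ring_hom_memE[OF tr(2)]
  note hI = ring_hom_memE[OF qI(5)] and hJ = ring_hom_memE[OF qJ(5)]
  have B: "module ?S ?B" unfolding quot_module_eq
    by (rule module_module_sum[OF module_restrict_scalars[OF tr(1) QI.module_self_module qI(5)]
          module_restrict_scalars[OF tr(1) QJ.module_self_module qJ(5)]])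
  have "?g \<in> carrier ?B" unfolding quot_module_eq using hI(1) hJ(1) h(1) pl by simp
  then have "generated_submodule ?S ?B {?g} = (\<lambda>x. x \<odot>\<^bsub>?B\<^esub> ?g) ` carrier ?S"
    by (rule generated_submodule_singleton[OF B])
  also have "\<dots> = (\<lambda>r. ?\<phi> r \<odot>\<^bsub>?B\<^esub> ?g) ` carrier R" unfolding tr(3) image_image ..
  also have "\<dots> = (\<lambda>r. (?I +>\<^bsub>?S\<^esub> ?\<phi> (r \<otimes> p [^] (t - 2)), ?J +>\<^bsub>?S\<^esub> ?\<phi> (r \<otimes> p [^] (s - 1)))) ` carrier R"
  proof (rule image_cong[OF refl])
    fix r assume r: "r \<in> carrier R"
    have "?\<phi> r \<odot>\<^bsub>?B\<^esub> ?g = ((?I +>\<^bsub>?S\<^esub> ?\<phi> r) \<otimes>\<^bsub>?S Quot ?I\<^esub> (?I +>\<^bsub>?S\<^esub> ?\<phi> (p [^] (t - 2))),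
        (?J +>\<^bsub>?S\<^esub> ?\<phi> r) \<otimes>\<^bsub>?S Quot ?J\<^esub> (?J +>\<^bsub>?S\<^esub> ?\<phi> (p [^] (s - 1))))"
      by (simp only: quot_module_eq module_sum_simps restrict_scalars_simps self_module_simps)
    also have "\<dots> = (?I +>\<^bsub>?S\<^esub> ?\<phi> (r \<otimes> p [^] (t - 2)), ?J +>\<^bsub>?S\<^esub> ?\<phi> (r \<otimes> p [^] (s - 1)))"
      unfolding h(2)[OF r pl] hI(2)[OF h(1)[OF r] h(1)[OF pl]] hJ(2)[OF h(1)[OF r] h(1)[OF pl]] ..
    finally show "?\<phi> r \<odot>\<^bsub>?B\<^esub> ?g = (?I +>\<^bsub>?S\<^esub> ?\<phi> (r \<otimes> p [^] (t - 2)), ?J +>\<^bsub>?S\<^esub> ?\<phi> (r \<otimes> p [^] (s - 1)))" .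
  qed
  finally have eq: "restrict_pair ?\<phi> (bipicket ?S (?\<phi> p) t s) =
      (module_sum (restrict_scalars (\<lambda>r. ?I +>\<^bsub>?S\<^esub> ?\<phi> r) (self_module (?S Quot ?I)))
         (restrict_scalars (\<lambda>r. ?J +>\<^bsub>?S\<^esub> ?\<phi> r) (self_module (?S Quot ?J))),
       (\<lambda>r. (?I +>\<^bsub>?S\<^esub> ?\<phi> (r \<otimes> p [^] (t - 2)), ?J +>\<^bsub>?S\<^esub> ?\<phi> (r \<otimes> p [^] (s - 1)))) ` carrier R)"
    by (simp add: restrict_pair_def bipicket_def Let_def tr(5) restrict_scalars_module_sum)
      (simp add: quot_module_eq restrict_scalars_comp)
  show ?thesis unfolding eq
    by (rule presented_ring_quotient_sum[OF is_cring qI(1) qJ(1) qI(2) qJ(2) qI(3) qJ(3) qI(4) qJ(4) pl pl])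
qed

lemma presented_quotient:
  assumes q: "q \<in> carrier R"
  shows "presented R q \<one> \<zero> \<zero> (quot_module R (PIdl q), {\<zero>\<^bsub>quot_module R (PIdl q)\<^esub>})"
proof -
  have I: "ideal (PIdl q) R" by (rule cgenideal_ideal[OF q])
  note Q = Quot_facts[OF I]
  have ker: "PIdl q +> r = \<zero>\<^bsub>R Quot PIdl q\<^esub> \<longleftrightarrow> q divides r" if r: "r \<in> carrier R" for r
    using Q(3)[OF r] q r unfolding mem_PIdl by (auto simp: factor_def m_comm)
  have "(\<lambda>r. PIdl q +> (r \<otimes> \<zero>)) ` carrier R = {\<zero>\<^bsub>R Quot PIdl q\<^esub>}"
    using ring_hom_zero'[OF is_cring Q(1,2)] by auto
  then show ?thesis
    using presented_ring_quotient[OF is_cring Q(1,2) equalityD1[OF Quot_carrier] ker zero_closed]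
    by (simp add: quot_module_eq)
qed

lemma standard_pair_type:
  assumes p: "p \<in> carrier R" and std: "standard_pair R p U"
  shows "type_prime_to_p R p U \<or> (\<exists>n. type_P R p n U \<or> type_Q R p n U) \<or> type_free R U"
proof -
  have pp: "p [^] n \<in> carrier R" for n :: nat using p by simp
  consider "presented_free R U" | "presented_prime R p U" | "presented_picket R p U" | "presented_bipicket R p U"
    using std unfolding standard_pair_def by blast
  then show ?thesis
  proof cases
    case 1
    then have "type_free R U"
      unfolding presented_free_def type_free_def by (rule presented_iso[OF _ presented_free_pair zero_closed zero_closed])
    then show ?thesis by blast
  next
    case 2
    then obtain q k where q: "q \<in> carrier R" "ring_prime q" "\<not> q divides p"
      and pr: "presented R (q [^] Suc k) \<one> \<zero> \<zero> U" unfolding presented_prime_def by blast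
    let ?q = "q [^] Suc k"
    have qc: "?q \<in> carrier R" using q by simp
    have iso: "pair_iso R U (quot_module R (PIdl ?q), {\<zero>\<^bsub>quot_module R (PIdl ?q)\<^esub>})"
      by (rule presented_iso[OF pr presented_quotient[OF qc] zero_closed zero_closed])
    obtain a b where ab: "a \<in> carrier R" "b \<in> carrier R" "a \<otimes> p \<oplus> b \<otimes> ?q = \<one>"
      using prime_pow_coprime[OF q(1,2) p q(3)] by blast
    have "y divides \<one>" if y: "y \<in> carrier R" "y divides ?q" "y divides p" for y
    proof -
      obtain c d where cd: "c \<in> carrier R" "d \<in> carrier R" "?q = y \<otimes> c" "p = y \<otimes> d"
        using y unfolding factor_def by blast
      have "\<one> = a \<otimes> p \<oplus> b \<otimes> ?q" using ab(3) by (rule sym)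
      also have "\<dots> = a \<otimes> (y \<otimes> d) \<oplus> b \<otimes> (y \<otimes> c)" unfolding cd(3) by (subst cd(4)) (rule refl)
      also have "\<dots> = y \<otimes> (a \<otimes> d \<oplus> b \<otimes> c)" using ab(1,2) cd(1,2) y(1) by algebra
      finally show ?thesis unfolding factor_def using ab(1,2) cd(1,2) by blast
    qed
    then have "\<one> gcdof ?q p" unfolding isgcd_def using one_divides qc p by blast
    then have "type_prime_to_p R p U" unfolding type_prime_to_p_def
      using q iso by (intro exI[of _ q] exI[of _ "Suc k"] exI[of _ ?q]) simp
    then show ?thesis by blast
  next
    case 3
    then obtain l m where lm: "m \<le> (2::nat)" "1 \<le> l" "m \<le> l"
      and pr: "presented R (p [^] l) \<one> (p [^] (l - m)) \<zero> U" unfolding presented_picket_def by blast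
    have "type_P R p l U" unfolding type_P_def
      using lm presented_iso[OF pr presented_restricted_picket[OF p order_refl] pp zero_closed]
      by (intro exI[of _ l] exI[of _ m]) auto
    then show ?thesis by blast
  next
    case 4
    then obtain s t where st: "1 \<le> (s::nat)" "s < t - 1"
      and pr: "presented R (p [^] t) (p [^] s) (p [^] (t - 2)) (p [^] (s - 1)) U" unfolding presented_bipicket_def by blast
    have "s \<le> t" using st by simp
    then have "type_Q R p t U" unfolding type_Q_def
      using st presented_iso[OF pr presented_restricted_bipicket[OF p _ order_refl] pp pp]
      by (intro exI[of _ s] exI[of _ t]) auto
    then show ?thesis by blast
  qed
qed

end

section \<open>Decompositions into standard pairs\<close>

context principal_domain
begin

lemma standard_pair_krull_schmidt:
  assumes p: "p \<in> carrier R" "ring_prime p" and std: "standard_pair R p U" and U: "mpair R U"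
  shows "krull_schmidt_summand R U"
proof -
  consider "presented_free R U" | "presented_prime R p U" | "presented_picket R p U" | "presented_bipicket R p U"
    using std unfolding standard_pair_def by blast
  then show ?thesis
  proof cases
    case 1
    then have "type_free R U"
      unfolding presented_free_def type_free_def by (rule presented_iso[OF _ presented_free_pair zero_closed zero_closed])
    then show ?thesis using U unfolding krull_schmidt_summand_def by blast
  next
    case 2
    then obtain q k where q: "q \<in> carrier R" "ring_prime q"
      and pr: "presented R (q [^] Suc k) \<one> \<zero> \<zero> U" unfolding presented_prime_def by blast
    show ?thesis using presented_cyclic_local[OF pr q _ U] unfolding krull_schmidt_summand_def by blast
  next
    case 3
    then obtain l m where lm: "1 \<le> (l::nat)"
      and pr: "presented R (p [^] l) \<one> (p [^] (l - m)) \<zero> U" unfolding presented_picket_def by blast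
    have "l \<noteq> 0" using lm by simp
    then show ?thesis using presented_cyclic_local[OF pr p _ U] unfolding krull_schmidt_summand_def by blast
  next
    case 4
    then obtain s t where st: "1 \<le> (s::nat)" "s < t - 1"
      and pr: "presented R (p [^] t) (p [^] s) (p [^] (t - 2)) (p [^] (s - 1)) U" unfolding presented_bipicket_def by blast
    show ?thesis using presented_bipicket_local[OF pr p st U] unfolding krull_schmidt_summand_def by blast
  qed
qed

lemma standard_pair_nonzero:
  assumes p: "p \<in> carrier R" "ring_prime p" and std: "standard_pair R p U" and U: "mpair R U"
  shows "\<not> zero_pair U"
proof
  assume z: "zero_pair U"
  have "krull_schmidt_summand R U" by (rule standard_pair_krull_schmidt[OF assms])
  then have "type_free R U" using z unfolding krull_schmidt_summand_def local_pair_def by blast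
  then have "pair_iso R U (free_pair R)" unfolding type_free_def .
  then have "zero_pair (free_pair R)"
    by (rule zero_pair_iso[OF _ mpairD(1)[OF U] mpairD(1)[OF mpair_free_pair] z])
  then show False unfolding zero_pair_def using one_closed by auto
qed

lemma standard_pair_iso:
  assumes p: "p \<in> carrier R" and std: "standard_pair R p U" and iso: "pair_iso R U V" and V: "mpair R V"
  shows "standard_pair R p V"
proof -
  have inv: "presented R d e a b V" if "presented R d e a b U" "a \<in> carrier R" "b \<in> carrier R" for d e a b
    by (rule presented_iso_invariant[OF that(1) iso mpairD(1)[OF V] that(2,3) mpairD(3)[OF V]])
  have pp: "p [^] n \<in> carrier R" for n :: nat using p by simp
  consider "presented_free R U" | "presented_prime R p U" | "presented_picket R p U" | "presented_bipicket R p U"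
    using std unfolding standard_pair_def by blast
  then show ?thesis
  proof cases
    case 1 then show ?thesis unfolding standard_pair_def presented_free_def using inv zero_closed by blast
  next
    case 2 then show ?thesis unfolding standard_pair_def presented_prime_def using inv zero_closed by blast
  next
    case 3 then show ?thesis unfolding standard_pair_def presented_picket_def using inv zero_closed pp by blast
  next
    case 4 then show ?thesis unfolding standard_pair_def presented_bipicket_def using inv pp by blast
  qed
qed

end

context pid_module
begin

lemma pair_split_iso:
  assumes "pair_split D A E A1 C A2"
  shows "pair_iso R (pair_sum (sub_pair E A1) (sub_pair C A2)) (sub_pair D A)"
proof (rule pair_iso_if_bij)
  have E: "submodule E R M" and A1: "submodule A1 R M" "A1 \<subseteq> E" and C: "submodule C R M"
    and A2: "submodule A2 R M" "A2 \<subseteq> C" and D: "D = E +\<^sub>S C" and A: "A = A1 +\<^sub>S A2"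
    and int: "E \<inter> C = {\<zero>\<^sub>M}" using assms unfolding pair_split_def by auto
  note Ec = submoduleD(1)[OF E] and Cc = submoduleD(1)[OF C]
  let ?f = "\<lambda>(x, y). x +\<^sub>M y"
  show "?f \<in> pair_hom R (pair_sum (sub_pair E A1) (sub_pair C A2)) (sub_pair D A)"
  proof (rule pair_homI)
    fix z assume "z \<in> carrier (fst (pair_sum (sub_pair E A1) (sub_pair C A2)))"
    then show "?f z \<in> carrier (fst (sub_pair D A))" by (auto simp: D mem_set_add)
  next
    fix z z' assume "z \<in> carrier (fst (pair_sum (sub_pair E A1) (sub_pair C A2)))"
      "z' \<in> carrier (fst (pair_sum (sub_pair E A1) (sub_pair C A2)))"
    then show "?f (z \<oplus>\<^bsub>fst (pair_sum (sub_pair E A1) (sub_pair C A2))\<^esub> z') = ?f z \<oplus>\<^bsub>fst (sub_pair D A)\<^esub> ?f z'"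
      using Ec Cc by (cases z; cases z') (simp add: M.a_ac)
  next
    fix r z assume "r \<in> carrier R" "z \<in> carrier (fst (pair_sum (sub_pair E A1) (sub_pair C A2)))"
    then show "?f (r \<odot>\<^bsub>fst (pair_sum (sub_pair E A1) (sub_pair C A2))\<^esub> z) = r \<odot>\<^bsub>fst (sub_pair D A)\<^esub> ?f z"
      using Ec Cc by (cases z) (simp add: smult_r_distr)
  next
    fix z assume "z \<in> snd (pair_sum (sub_pair E A1) (sub_pair C A2))"
    then show "?f z \<in> snd (sub_pair D A)" by (auto simp: A mem_set_add)
  qed
  have m: "mpair R (sub_pair N L)" if "submodule N R M" "submodule L R M" "L \<subseteq> N" for N L
  proof -
    have mN: "module R (M\<lparr>carrier := N\<rparr>)" by (rule submodule.submodule_is_module[OF that(1) module_axioms])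
    have "submodule L R (M\<lparr>carrier := N\<rparr>)"
      by (rule module.submoduleI'[OF mN]) (use that(3) submoduleD[OF that(2)] in auto)
    then show ?thesis using mN by (simp add: mpair_def)
  qed
  have mp: "mpair R (pair_sum (sub_pair E A1) (sub_pair C A2))"
    by (rule mpair_pair_sum[OF m[OF E A1] m[OF C A2]])
  show "module R (fst (pair_sum (sub_pair E A1) (sub_pair C A2)))" by (rule mpairD(1)[OF mp])
  show "snd (pair_sum (sub_pair E A1) (sub_pair C A2)) \<subseteq> carrier (fst (pair_sum (sub_pair E A1) (sub_pair C A2)))"
    by (rule mpairD(3)[OF mp])
  show "snd (sub_pair D A) \<subseteq> ?f ` snd (pair_sum (sub_pair E A1) (sub_pair C A2))"
    by (force simp: A mem_set_add)
  have "inj_on ?f (E \<times> C)"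
  proof (rule inj_onI, clarify)
    fix x y x' y' assume xy: "x \<in> E" "y \<in> C" "x' \<in> E" "y' \<in> C" and e: "x +\<^sub>M y = x' +\<^sub>M y'"
    have c: "x \<in> carrier M" "y \<in> carrier M" "x' \<in> carrier M" "y' \<in> carrier M" using xy Ec Cc by auto
    have "(x -\<^sub>M x') +\<^sub>M y = y'"
    proof -
      have "(x -\<^sub>M x') +\<^sub>M y = (x +\<^sub>M y) -\<^sub>M x'" using c by (simp add: a_minus_def M.a_ac)
      also have "\<dots> = y'" unfolding e by (rule diff_eqI) (use c in \<open>simp_all add: M.a_comm\<close>)
      finally show ?thesis .
    qed
    then have "x -\<^sub>M x' \<in> C" using add_mem_cancel_right[OF C, of "x -\<^sub>M x'" y] xy c by simp
    then have "x -\<^sub>M x' = \<zero>\<^sub>M" using submoduleD(6)[OF E xy(1,3)] int by blast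
    then have "x = x'" using diff_add_cancel[OF c(1,3)] c by simp
    then show "x = x' \<and> y = y'" using e c by simp
  qed
  moreover have "?f ` (E \<times> C) = D" by (force simp: D mem_set_add)
  ultimately show "bij_betw ?f (carrier (fst (pair_sum (sub_pair E A1) (sub_pair C A2)))) (carrier (fst (sub_pair D A)))"
    by (simp add: bij_betw_def)
qed

lemma submodule_sum_assoc:
  assumes "submodule N R M" "submodule L R M" "submodule K R M"
  shows "N +\<^sub>S (L +\<^sub>S K) = (N +\<^sub>S L) +\<^sub>S K"
proof -
  note c = submoduleD(1)[OF assms(1)] submoduleD(1)[OF assms(2)] submoduleD(1)[OF assms(3)]
  note NL = submodule_set_add[OF assms(1,2)] and LK = submodule_set_add[OF assms(2,3)]
  note N_LK = submodule_set_add[OF assms(1) LK] and NL_K = submodule_set_add[OF NL assms(3)]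
  note up = set_add_upper[OF assms(1,2)] set_add_upper[OF assms(2,3)]
    set_add_upper[OF assms(1) LK] set_add_upper[OF NL assms(3)]
  show ?thesis
    by (intro equalityI set_add_least N_LK NL_K) (use up in blast)+
qed

lemma pair_split_assoc:
  assumes 1: "pair_split T A C A1 D A2" and 2: "pair_split D A2 E B1 D' B2"
  shows "pair_split T A (E +\<^sub>S C) (B1 +\<^sub>S A1) D' B2"
    and "pair_split (E +\<^sub>S C) (B1 +\<^sub>S A1) E B1 C A1"
proof -
  have C: "submodule C R M" "submodule A1 R M" "A1 \<subseteq> C" and D: "submodule D R M" "submodule A2 R M" "A2 \<subseteq> D"
    and T: "T = C +\<^sub>S D" "A = A1 +\<^sub>S A2" and CD: "C \<inter> D = {\<zero>\<^sub>M}"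
    using 1 unfolding pair_split_def by auto
  have E: "submodule E R M" "submodule B1 R M" "B1 \<subseteq> E" and D': "submodule D' R M" "submodule B2 R M" "B2 \<subseteq> D'"
    and De: "D = E +\<^sub>S D'" "A2 = B1 +\<^sub>S B2" and ED: "E \<inter> D' = {\<zero>\<^sub>M}"
    using 2 unfolding pair_split_def by auto
  have sub: "E \<subseteq> D" "D' \<subseteq> D" unfolding De using set_add_upper[OF E(1) D'(1)] by auto
  have comm: "N +\<^sub>S L = L +\<^sub>S N" if "submodule N R M" "submodule L R M" for N L
    using set_add_upper[OF that] set_add_upper[OF that(2,1)] submodule_set_add that
    by (intro equalityI set_add_least) auto
  have mono: "N +\<^sub>S L \<subseteq> N' +\<^sub>S L'" if "N \<subseteq> N'" "L \<subseteq> L'" for N L N' L'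
    using that unfolding subset_iff mem_set_add by blast
  show "pair_split (E +\<^sub>S C) (B1 +\<^sub>S A1) E B1 C A1"
    unfolding pair_split_def using C E CD sub submoduleD(2)[OF E(1)] submoduleD(2)[OF C(1)] by auto
  show "pair_split T A (E +\<^sub>S C) (B1 +\<^sub>S A1) D' B2"
    unfolding pair_split_def
  proof (intro conjI submodule_set_add C E D' mono)
    show "T = (E +\<^sub>S C) +\<^sub>S D'"
      unfolding T De comm[OF E(1) C(1)] by (rule submodule_sum_assoc[OF C(1) E(1) D'(1)])
    show "A = (B1 +\<^sub>S A1) +\<^sub>S B2"
      unfolding T De comm[OF E(2) C(2)] by (rule submodule_sum_assoc[OF C(2) E(2) D'(2)])
    show "(E +\<^sub>S C) \<inter> D' = {\<zero>\<^sub>M}"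
    proof
      show "{\<zero>\<^sub>M} \<subseteq> (E +\<^sub>S C) \<inter> D'"
        using submoduleD(2)[OF submodule_set_add[OF E(1) C(1)]] submoduleD(2)[OF D'(1)] by simp
      show "(E +\<^sub>S C) \<inter> D' \<subseteq> {\<zero>\<^sub>M}"
      proof
        fix z assume z: "z \<in> (E +\<^sub>S C) \<inter> D'"
        then obtain x y where xy: "x \<in> E" "y \<in> C" "z = x +\<^sub>M y" by (auto simp: mem_set_add)
        have yc: "y \<in> carrier M" and xc: "x \<in> carrier M" using submoduleD(1)[OF C(1) xy(2)] submoduleD(1)[OF E(1) xy(1)] .
        have "x +\<^sub>M y \<in> D" using z sub unfolding xy(3) by blast
        then have "y \<in> D" using add_mem_cancel_left[OF D(1)] xy(1) sub(1) yc by blast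
        then have y0: "y = \<zero>\<^sub>M" using CD xy(2) by blast
        then have "z = x" using xy(3) xc by simp
        then show "z \<in> {\<zero>\<^sub>M}" using ED z xy(1) by blast
      qed
    qed
  qed
qed

end

context fg_pid_module
begin

lemma is_pair_sub_pair:
  assumes E: "submodule E R M" and A: "submodule A R M" "A \<subseteq> E"
  shows "is_pair R (sub_pair E A)"
proof -
  let ?E = "M\<lparr>carrier := E\<rparr>"
  have m: "module R ?E" by (rule submodule.submodule_is_module[OF E module_axioms])
  have sub: "submodule N R ?E \<longleftrightarrow> submodule N R M \<and> N \<subseteq> E" for N
  proof
    assume N: "submodule N R ?E"
    interpret E: pid_module R ?E by (intro pid_module.intro principal_domain_axioms m)
    note Nd = E.submoduleD[OF N]
    have NE: "N \<subseteq> E" using Nd(1) by auto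
    then show "submodule N R M \<and> N \<subseteq> E"
      using Nd(2-4) submoduleD(1)[OF E] by (intro conjI submoduleI') auto
  next
    assume "submodule N R M \<and> N \<subseteq> E"
    then show "submodule N R ?E"
      by (intro module.submoduleI'[OF m]) (auto dest: submoduleD)
  qed
  obtain S where S: "finite S" "S \<subseteq> E" "\<And>L. submodule L R M \<Longrightarrow> S \<subseteq> L \<Longrightarrow> E \<subseteq> L"
    using fin_gen[OF E] unfolding fin_gen_def by blast
  have "generated_submodule R ?E S = E"
    unfolding generated_submodule_def sub using S E by blast
  then have "finitely_generated R ?E"
    unfolding finitely_generated_def using S by (intro exI[of _ S]) simp
  then show ?thesis using m sub A by (simp add: is_pair_def)
qed

text \<open>
  Submodules satisfy the ascending chain condition, so there is a maximal summand with a decomposition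
  into standard pairs. A nonzero complement would contribute one more standard pair.
\<close>

lemma standard_decomposition_internal:
  assumes A: "submodule A R M" and p: "p \<in> carrier R" "ring_prime p"
    and ppA: "\<And>a. a \<in> A \<Longrightarrow> p *\<^sub>M (p *\<^sub>M a) = \<zero>\<^sub>M"
  shows "\<exists>Us :: ('a, 'c) mod_pair list. (\<forall>U \<in> set Us. standard_pair R p U \<and> is_pair R U) \<and>
    pair_iso R (M, A) (pair_list_sum Us)"
proof -
  define decomposed where "decomposed C A1 \<longleftrightarrow> (\<exists>Us :: ('a, 'c) mod_pair list.
    (\<forall>U \<in> set Us. standard_pair R p U \<and> is_pair R U) \<and> pair_iso R (sub_pair C A1) (pair_list_sum Us))" for C A1
  let ?F = "{C. submodule C R M \<and> (\<exists>A1 D A2. pair_split (carrier M) A C A1 D A2 \<and> decomposed C A1)}"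
  have "{\<zero>\<^sub>M} \<in> ?F"
  proof -
    have "pair_split (carrier M) A {\<zero>\<^sub>M} {\<zero>\<^sub>M} (carrier M) A"
      unfolding pair_split_def
      using A submodule_zero_set carrier_is_submodule set_add_zero submoduleD(1)[OF A] by auto
    moreover have "pair_iso R (sub_pair {\<zero>\<^sub>M} {\<zero>\<^sub>M}) (pair_list_sum ([] :: ('a, 'c) mod_pair list))"
    proof (rule pair_isoI)
      show "(\<lambda>_ _. undefined) \<in> pair_hom R (sub_pair {\<zero>\<^sub>M} {\<zero>\<^sub>M}) (pair_list_sum ([] :: ('a, 'c) mod_pair list))"
        by (rule pair_homI) (auto simp: fun_eq_iff)
      show "(\<lambda>_. \<zero>\<^sub>M) \<in> pair_hom R (pair_list_sum ([] :: ('a, 'c) mod_pair list)) (sub_pair {\<zero>\<^sub>M} {\<zero>\<^sub>M})"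
        by (rule pair_homI) auto
    qed auto
    then have "decomposed {\<zero>\<^sub>M} {\<zero>\<^sub>M}" unfolding decomposed_def by (intro exI[of _ "[]"]) simp
    ultimately show ?thesis using submodule_zero_set by blast
  qed
  then have "?F \<noteq> {}" by blast
  then obtain C where CF: "C \<in> ?F" and max: "\<And>L. L \<in> ?F \<Longrightarrow> C \<subseteq> L \<Longrightarrow> L = C"
    using maximal_submodule[of ?F] by blast
  then obtain A1 D A2 where split: "pair_split (carrier M) A C A1 D A2" and dec: "decomposed C A1" by blast
  have C: "submodule C R M" "submodule A1 R M" "A1 \<subseteq> C" and D: "submodule D R M" "submodule A2 R M" "A2 \<subseteq> D"
    and T: "carrier M = C +\<^sub>S D" "A = A1 +\<^sub>S A2" and CD: "C \<inter> D = {\<zero>\<^sub>M}"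
    using split unfolding pair_split_def by auto
  have "D = {\<zero>\<^sub>M}"
  proof (rule ccontr)
    assume "D \<noteq> {\<zero>\<^sub>M}"
    have "A2 \<subseteq> A" unfolding T using set_add_upper[OF C(2) D(2)] by blast
    then have pp2: "p *\<^sub>M (p *\<^sub>M a) = \<zero>\<^sub>M" if "a \<in> A2" for a using ppA that by blast
    obtain E B1 D' B2 where E: "pair_split D A2 E B1 D' B2" "standard_pair R p (sub_pair E B1)"
      using split_standard_summand[OF D(1) \<open>D \<noteq> _\<close> D(2,3) p pp2] by blast
    have Es: "submodule E R M" "submodule B1 R M" "B1 \<subseteq> E" "E \<subseteq> D"
      using E(1) set_add_upper(1)[of E D'] unfolding pair_split_def by auto
    note new = pair_split_assoc[OF split E(1)]
    obtain Us :: "('a, 'c) mod_pair list" where Us: "\<forall>U \<in> set Us. standard_pair R p U \<and> is_pair R U"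
      "pair_iso R (sub_pair C A1) (pair_list_sum Us)" using dec unfolding decomposed_def by blast
    have "pair_iso R (sub_pair (E +\<^sub>S C) (B1 +\<^sub>S A1)) (pair_sum (sub_pair E B1) (sub_pair C A1))"
      by (rule pair_iso_sym[OF pair_split_iso[OF new(2)]])
    also have "pair_iso R \<dots> (pair_sum (sub_pair E B1) (pair_list_sum Us))"
      by (rule pair_sum_cong[OF pair_iso_refl Us(2)])
    also have "pair_iso R \<dots> (pair_list_sum (sub_pair E B1 # Us))" by (rule pair_iso_sym[OF pair_list_sum_Cons])
    finally have sum_iso: "pair_iso R (sub_pair (E +\<^sub>S C) (B1 +\<^sub>S A1)) (pair_list_sum (sub_pair E B1 # Us))" .
    have "decomposed (E +\<^sub>S C) (B1 +\<^sub>S A1)"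
      unfolding decomposed_def
      by (rule exI[of _ "sub_pair E B1 # Us"])
        (use sum_iso Us(1) E(2) is_pair_sub_pair[OF Es(1-3)] in simp)
    then have "E +\<^sub>S C \<in> ?F" using submodule_set_add[OF Es(1) C(1)] new(1) by blast
    then have "E \<subseteq> C" using max[of "E +\<^sub>S C"] set_add_upper[OF Es(1) C(1)] by blast
    then have "E \<subseteq> {\<zero>\<^sub>M}" using Es(4) CD by blast
    then have "zero_pair (sub_pair E B1)" using submoduleD(2)[OF Es(1)] unfolding zero_pair_def by auto
    then show False using standard_pair_nonzero[OF p E(2)] is_pair_mpair[OF is_pair_sub_pair[OF Es(1-3)]] by blast
  qed
  have comm: "N +\<^sub>S {\<zero>\<^sub>M} = N" if "submodule N R M" for N
    using set_add_upper(1)[OF that submodule_zero_set] set_add_least[OF that, of N "{\<zero>\<^sub>M}"] submoduleD(2)[OF that] by auto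
  have "C = carrier M" using T(1) comm[OF C(1)] unfolding \<open>D = _\<close> by simp
  moreover have "A2 = {\<zero>\<^sub>M}" using D submoduleD(2)[OF D(2)] unfolding \<open>D = _\<close> by blast
  then have "A1 = A" using T(2) comm[OF C(2)] by simp
  ultimately have "decomposed (carrier M) A" using dec by simp
  then show ?thesis unfolding decomposed_def by simp
qed

end

section \<open>Indecomposability and uniqueness\<close>

lemma retract_p2_bounded:
  assumes r: "retract R U V" and V: "p2_bounded R p V" and U: "mpair R U" and mV: "mpair R V"
    and p: "p \<in> carrier R"
  shows "p2_bounded R p U"
proof -
  interpret U: module R "fst U" by (rule mpairD(1)[OF U])
  obtain f g where f: "f \<in> pair_hom R U V" and g: "g \<in> pair_hom R V U"
    and gf: "\<And>x. x \<in> carrier (fst U) \<Longrightarrow> g (f x) = x" using r unfolding retract_def by blast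
  let ?q = "p [^]\<^bsub>R\<^esub> (2::nat)"
  have q: "?q \<in> carrier R" using p by simp
  have "?q \<odot>\<^bsub>fst U\<^esub> a = \<zero>\<^bsub>fst U\<^esub>" if a: "a \<in> snd U" for a
  proof -
    have ac: "a \<in> carrier (fst U)" using mpairD(3)[OF U] a by blast
    have "?q \<odot>\<^bsub>fst V\<^esub> f a = \<zero>\<^bsub>fst V\<^esub>"
      using V pair_homD(4)[OF f a] unfolding p2_bounded_def by (simp add: case_prod_beta)
    then have "f (?q \<odot>\<^bsub>fst U\<^esub> a) = \<zero>\<^bsub>fst V\<^esub>" using pair_homD(3)[OF f q ac] by simp
    then have "?q \<odot>\<^bsub>fst U\<^esub> a = g \<zero>\<^bsub>fst V\<^esub>" using gf[of "?q \<odot>\<^bsub>fst U\<^esub> a"] q ac by simp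
    then show ?thesis using pair_hom_zero[OF g mpairD(1)[OF mV] mpairD(1)[OF U]] by simp
  qed
  then show ?thesis unfolding p2_bounded_def by (simp add: case_prod_beta)
qed

lemma retract_sum_left: "mpair R V \<Longrightarrow> mpair R W \<Longrightarrow> retract R V (pair_sum V W)"
  unfolding retract_def by (intro bexI[OF _ pair_hom_inl] bexI[OF _ pair_hom_fst]) simp_all

lemma retract_sum_right: "mpair R V \<Longrightarrow> mpair R W \<Longrightarrow> retract R W (pair_sum V W)"
  unfolding retract_def by (intro bexI[OF _ pair_hom_inr] bexI[OF _ pair_hom_snd]) simp_all

lemma retract_list_summand:
  assumes "cring R" "\<And>V. V \<in> set Vs \<Longrightarrow> mpair R V" "V \<in> set Vs"
  shows "retract R V (pair_list_sum Vs)"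
proof -
  obtain xs ys where Vs: "Vs = xs @ V # ys" using split_list[OF assms(3)] by blast
  have "retract R V (pair_sum V (pair_list_sum (xs @ ys)))"
    using assms(2) Vs by (intro retract_sum_left mpair_pair_list_sum assms(1)) auto
  then show ?thesis using retract_iso[OF _ pair_iso_sym[OF pair_list_sum_extract]] unfolding Vs by blast
qed

lemma pair_list_sum_single: "pair_iso R U (pair_list_sum [U])"
  by (rule pair_isoI[where f = "\<lambda>u. \<lambda>i\<in>{..<1}. u" and g = "\<lambda>f. f 0"]; (rule pair_homI)?)
    (auto simp: fun_eq_iff PiE_iff extensional_def)

lemma pair_sum_zero_iso:
  assumes V: "mpair R V" and W: "mpair R W" "zero_pair W"
  shows "pair_iso R (pair_sum V W) V"
proof (rule pair_isoI[OF pair_hom_fst pair_hom_inl[OF V W(1)]])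
  fix x assume "x \<in> carrier (fst (pair_sum V W))"
  then show "(fst x, \<zero>\<^bsub>fst W\<^esub>) = x" using W(2) by (cases x) (auto simp: zero_pair_def)
qed simp

context principal_domain
begin

context
  fixes p :: 'a
  assumes p: "p \<in> carrier R" "ring_prime p"
begin

lemma p2_boundedD:
  assumes "mpair R U" "p2_bounded R p U" "a \<in> snd U"
  shows "p \<odot>\<^bsub>fst U\<^esub> (p \<odot>\<^bsub>fst U\<^esub> a) = \<zero>\<^bsub>fst U\<^esub>"
proof -
  interpret U: module R "fst U" by (rule mpairD(1)[OF assms(1)])
  have ac: "a \<in> carrier (fst U)" using mpairD(3)[OF assms(1)] assms(3) by blast
  have "p [^] (2::nat) \<odot>\<^bsub>fst U\<^esub> a = \<zero>\<^bsub>fst U\<^esub>"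
    using assms(2,3) unfolding p2_bounded_def by (simp add: case_prod_beta)
  moreover have "p [^] (2::nat) = p \<otimes> p" using p by (simp add: numeral_2_eq_2)
  ultimately show ?thesis using ac p by (simp add: U.smult_assoc1)
qed

lemma fg_pid_moduleI: "is_pair R U \<Longrightarrow> fg_pid_module R (fst U)"
  unfolding is_pair_def
  by (intro fg_pid_module.intro pid_module.intro principal_domain_axioms fg_pid_module_axioms.intro) auto

lemma standard_decomposition:
  fixes U :: "('a, 'c) mod_pair"
  assumes U: "is_pair R U" "p2_bounded R p U"
  shows "\<exists>Us :: ('a, 'c) mod_pair list. (\<forall>V \<in> set Us. standard_pair R p V \<and> is_pair R V) \<and>
    pair_iso R U (pair_list_sum Us)"
proof -
  note mU = is_pair_mpair[OF U(1)]
  interpret fg_pid_module R "fst U" by (rule fg_pid_moduleI[OF U(1)])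
  show ?thesis
    using standard_decomposition_internal[OF mpairD(2)[OF mU] p p2_boundedD[OF mU U(2)]]
    by (simp only: prod.collapse)
qed

text \<open>An indecomposable pair coincides with the standard summand that can be split off from it.\<close>

lemma indecomposable_standard:
  fixes U :: "('a, 'c) mod_pair"
  assumes U: "indecomposable_pair R U" "p2_bounded R p U"
  shows "standard_pair R p U"
proof -
  note ind_def = U(1)[unfolded indecomposable_pair_def]
  have iU: "is_pair R U" and nz: "\<not> zero_pair U" using ind_def by simp_all
  have ind: "zero_pair V \<or> zero_pair W"
    if "is_pair R V" "is_pair R W" "pair_iso R U (pair_sum V W)" for V W :: "('a, 'c) mod_pair"
    by (rule ind_def[THEN conjunct2, THEN conjunct2, rule_format]) (intro conjI that)
  note mU = is_pair_mpair[OF iU]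
  interpret fg_pid_module R "fst U" by (rule fg_pid_moduleI[OF iU])
  have "carrier (fst U) \<noteq> {\<zero>\<^bsub>fst U\<^esub>}" using nz unfolding zero_pair_def .
  then obtain E A1 C A2 where split: "pair_split (carrier (fst U)) (snd U) E A1 C A2"
    and std: "standard_pair R p (sub_pair E A1)"
    using split_standard_summand[OF carrier_is_submodule _ mpairD(2,3)[OF mU] p p2_boundedD[OF mU U(2)]] by blast
  have E: "is_pair R (sub_pair E A1)" and C: "is_pair R (sub_pair C A2)"
    using split is_pair_sub_pair unfolding pair_split_def by blast+
  note mE = is_pair_mpair[OF E] and mC = is_pair_mpair[OF C]
  have "sub_pair (carrier (fst U)) (snd U) = U" by simp
  then have "pair_iso R (pair_sum (sub_pair E A1) (sub_pair C A2)) U"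
    using pair_split_iso[OF split] by (simp only:)
  note iso = pair_iso_sym[OF this]
  have "\<not> zero_pair (sub_pair E A1)" by (rule standard_pair_nonzero[OF p std mE])
  then have "zero_pair (sub_pair C A2)" using ind[OF E C iso] by blast
  then have "pair_iso R (pair_sum (sub_pair E A1) (sub_pair C A2)) (sub_pair E A1)"
    by (rule pair_sum_zero_iso[OF mE mC])
  then have "pair_iso R (sub_pair E A1) U" using pair_iso_sym[OF pair_iso_trans[OF iso]] by blast
  then show ?thesis by (rule standard_pair_iso[OF p(1) std _ mU])
qed

text \<open>
  A decomposition of a standard pair into two summands refines to one into standard pairs, and by
  uniqueness the latter has a single member.
\<close>

lemma standard_indecomposable:
  fixes U :: "('a, 'c) mod_pair"
  assumes U: "is_pair R U" "p2_bounded R p U" and std: "standard_pair R p U"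
  shows "indecomposable_pair R U"
  unfolding indecomposable_pair_def
proof (intro conjI allI impI)
  note mU = is_pair_mpair[OF U(1)]
  show "is_pair R U" by (rule U(1))
  show "\<not> zero_pair U" by (rule standard_pair_nonzero[OF p std mU])
  fix V W :: "('a, 'c) mod_pair"
  assume VW: "is_pair R V \<and> is_pair R W \<and> pair_iso R U (pair_sum V W)"
  have mV: "mpair R V" and mW: "mpair R W" using VW is_pair_mpair by blast+
  note mVW = mpair_pair_sum[OF mV mW]
  have "retract R (pair_sum V W) U" using VW pair_iso_retract pair_iso_sym by blast
  note bVW = retract_p2_bounded[OF this U(2) mVW mU p(1)]
  have bV: "p2_bounded R p V" by (rule retract_p2_bounded[OF retract_sum_left[OF mV mW] bVW mV mVW p(1)])
  have bW: "p2_bounded R p W" by (rule retract_p2_bounded[OF retract_sum_right[OF mV mW] bVW mW mVW p(1)])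
  obtain Vs :: "('a, 'c) mod_pair list" where Vs: "\<forall>V \<in> set Vs. standard_pair R p V \<and> is_pair R V"
    and isoV: "pair_iso R V (pair_list_sum Vs)" using standard_decomposition[OF _ bV] VW by blast
  obtain Ws :: "('a, 'c) mod_pair list" where Ws: "\<forall>V \<in> set Ws. standard_pair R p V \<and> is_pair R V"
    and isoW: "pair_iso R W (pair_list_sum Ws)" using standard_decomposition[OF _ bW] VW by blast
  have ks: "krull_schmidt_summand R N" if "N \<in> set (Vs @ Ws)" for N
  proof -
    have "N \<in> set Vs \<or> N \<in> set Ws" using that by simp
    then show ?thesis using Vs Ws standard_pair_krull_schmidt[OF p] is_pair_mpair by blast
  qed
  have mWs: "mpair R N" if "N \<in> set Ws" for N using that Ws is_pair_mpair by blast
  have "pair_iso R (pair_list_sum [U]) U" by (rule pair_iso_sym[OF pair_list_sum_single])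
  also have "pair_iso R U (pair_sum V W)" using VW by blast
  also have "pair_iso R \<dots> (pair_sum (pair_list_sum Vs) (pair_list_sum Ws))" by (rule pair_sum_cong[OF isoV isoW])
  also have "pair_iso R \<dots> (pair_list_sum (Vs @ Ws))" by (rule pair_iso_sym[OF pair_list_sum_append[OF mWs is_cring]])
  finally have iso: "pair_iso R (pair_list_sum [U]) (pair_list_sum (Vs @ Ws))" .
  have ksU: "krull_schmidt_summand R N" if "N \<in> set [U]" for N
    using that standard_pair_krull_schmidt[OF p std mU] by simp
  have "rel_mset (pair_iso R) (mset [U]) (mset (Vs @ Ws))" by (rule krull_schmidt_unique[OF ksU ks iso])
  then have "size (mset [U]) = size (mset (Vs @ Ws))" by (rule rel_mset_size)
  then have "length Vs + length Ws = 1" by simp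
  then have "Vs = [] \<or> Ws = []" by (cases Vs; cases Ws) auto
  moreover have "zero_pair N" if iN: "pair_iso R N (pair_list_sum ([] :: ('a, 'c) mod_pair list))" and "mpair R N" for N :: "('a, 'c) mod_pair"
  proof (rule zero_pair_iso[OF pair_iso_sym[OF iN]])
    show "module R (fst N)" by (rule mpairD(1)[OF \<open>mpair R N\<close>])
    show "module R (fst (pair_list_sum ([] :: ('a, 'c) mod_pair list)))"
      by (rule mpairD(1)[OF mpair_pair_list_sum[OF is_cring]]) simp
    show "zero_pair (pair_list_sum ([] :: ('a, 'c) mod_pair list))" by (simp add: zero_pair_def restrict_def)
  qed
  ultimately show "zero_pair V \<or> zero_pair W" using isoV isoW mV mW by blast
qed

end

end

theorem corollary5p4:
  fixes \<Lambda> :: "('a, 'r) ring_scheme" and p :: 'a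
    and B :: "('a, 'b) module" and A :: "'b set"
  assumes "principal_domain \<Lambda>"
    and "p \<in> carrier \<Lambda>" and "ring_prime\<^bsub>\<Lambda>\<^esub> p"
    and "module \<Lambda> B" and "finitely_generated \<Lambda> B"
    and "submodule A \<Lambda> B" and "p2_bounded \<Lambda> p (B, A)"
  shows "\<exists>Us :: ('a, 'b) mod_pair list.
           indecomposable_decomposition \<Lambda> (B, A) Us \<and>
           (\<forall>U \<in> set Us.
              type_prime_to_p \<Lambda> p U \<or>
              (\<exists>n. type_P \<Lambda> p n U \<or> type_Q \<Lambda> p n U) \<or>
              type_free \<Lambda> U) \<and>
           (\<forall>Vs :: ('a, 'c) mod_pair list.
              indecomposable_decomposition \<Lambda> (B, A) Vs \<longrightarrow>
              same_up_to_iso_and_order \<Lambda> Us Vs)"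
proof -
  interpret principal_domain \<Lambda> by fact
  have BA: "is_pair \<Lambda> (B, A)" using assms(4-6) by (simp add: is_pair_def)
  note mBA = is_pair_mpair[OF BA]
  have bounded: "p2_bounded \<Lambda> p V"
    if "\<And>V. V \<in> set Vs \<Longrightarrow> is_pair \<Lambda> V" "pair_iso \<Lambda> (B, A) (pair_list_sum Vs)" "V \<in> set Vs"
    for V and Vs :: "('a, 'd) mod_pair list"
  proof -
    have mVs: "mpair \<Lambda> V" if "V \<in> set Vs" for V using \<open>\<And>V. V \<in> set Vs \<Longrightarrow> is_pair \<Lambda> V\<close>[OF that] by (rule is_pair_mpair)
    have "retract \<Lambda> V (B, A)"
      by (rule retract_iso[OF retract_list_summand[OF is_cring mVs \<open>V \<in> set Vs\<close>] pair_iso_sym[OF that(2)]])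
    then show ?thesis by (rule retract_p2_bounded[OF _ assms(7) mVs[OF \<open>V \<in> set Vs\<close>] mBA assms(2)])
  qed
  obtain Us :: "('a, 'b) mod_pair list" where Us: "\<And>U. U \<in> set Us \<Longrightarrow> standard_pair \<Lambda> p U"
    "\<And>U. U \<in> set Us \<Longrightarrow> is_pair \<Lambda> U" and iso: "pair_iso \<Lambda> (B, A) (pair_list_sum Us)"
    using standard_decomposition[OF assms(2,3) BA assms(7)] by blast
  have ks: "krull_schmidt_summand \<Lambda> U" if "U \<in> set Us" for U
    by (rule standard_pair_krull_schmidt[OF assms(2,3) Us(1)[OF that] is_pair_mpair[OF Us(2)[OF that]]])
  show ?thesis
  proof (intro exI[of _ Us] conjI ballI allI impI)
    show "indecomposable_decomposition \<Lambda> (B, A) Us"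
      unfolding indecomposable_decomposition_def
      using standard_indecomposable[OF assms(2,3) Us(2) bounded[OF Us(2) iso] Us(1)] iso by blast
    show "type_prime_to_p \<Lambda> p U \<or> (\<exists>n. type_P \<Lambda> p n U \<or> type_Q \<Lambda> p n U) \<or> type_free \<Lambda> U"
      if "U \<in> set Us" for U by (rule standard_pair_type[OF assms(2) Us(1)[OF that]])
    fix Vs :: "('a, 'c) mod_pair list" assume dec: "indecomposable_decomposition \<Lambda> (B, A) Vs"
    then have Vs: "\<And>V. V \<in> set Vs \<Longrightarrow> indecomposable_pair \<Lambda> V" and isoV: "pair_iso \<Lambda> (B, A) (pair_list_sum Vs)"
      unfolding indecomposable_decomposition_def by blast+
    have pV: "is_pair \<Lambda> V" if "V \<in> set Vs" for V using Vs[OF that] unfolding indecomposable_pair_def by blast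
    have ksV: "krull_schmidt_summand \<Lambda> V" if V: "V \<in> set Vs" for V
      by (rule standard_pair_krull_schmidt[OF assms(2,3)
            indecomposable_standard[OF assms(2,3) Vs[OF V] bounded[OF pV isoV V]] is_pair_mpair[OF pV[OF V]]])
    show "same_up_to_iso_and_order \<Lambda> Us Vs"
      by (rule same_up_to_iso_and_order_if_rel_mset[OF krull_schmidt_unique[OF ks ksV pair_iso_trans[OF pair_iso_sym[OF iso] isoV]]])
  qed
qed

end
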